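(* For every $n\ge5$, the singular pure braid group $SP_n$ is a subgroup of camomile type in the singular braid group $SG_n$, namely $SP_n=Cam_{SG_n}(SP_4,M_{n,4})$, with highlighted petal $SP_4$ and conjugated set $M_{n,4}=M_n\setminus(M_4\setminus\{e\})$.
   Context: The singular braid group $SG_n$ ($n\ge2$) is the group generated by $\sigma_1,\dots,\sigma_{n-1},\tau_1,\dots,\tau_{n-1}$ with defining relations: $\sigma_i\sigma_{i+1}\sigma_i=\sigma_{i+1}\sigma_i\sigma_{i+1}$ ($1\le i\le n-2$); $\sigma_i\sigma_j=\sigma_j\sigma_i$, $\tau_i\tau_j=\tau_j\tau_i$, $\tau_i\sigma_j=\sigma_j\tau_i$ for $|i-j|\ge2$; $\tau_i\sigma_i=\sigma_i\tau_i$ ($1\le i\le n-1$); $\sigma_i\sigma_{i+1}\tau_i=\tau_{i+1}\sigma_i\sigma_{i+1}$ and $\sigma_{i+1}\sigma_i\tau_{i+1}=\tau_i\sigma_{i+1}\sigma_i$ ($1\le i\le n-2$). The singular pure braid group $SP_n$ is the kernel of the homomorphism $\pi:SG_n\to S_n$ with $\pi(\sigma_i)=\pi(\tau_i)=(i,i+1)$ for all $i$. Put $a_{i,i+1}=\sigma_i^2$, $b_{i,i+1}=\tau_i\sigma_i$, and for $i+1<j\le n$, $a_{ij}=\sigma_{j-1}\cdots\sigma_{i+1}\,a_{i,i+1}\,\sigma_{i+1}^{-1}\cdots\sigma_{j-1}^{-1}$, $b_{ij}=\sigma_{j-1}\cdots\sigma_{i+1}\,b_{i,i+1}\,\sigma_{i+1}^{-1}\cdots\sigma_{j-1}^{-1}$.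 The group $SP_n$ is generated by all $a_{ij},b_{ij}$, $1\le i<j\le n$. For $n\ge5$, $SP_4$ is regarded as the subgroup of $SP_n$ generated by $a_{ij},b_{ij}$, $1\le i<j\le4$. Coset representatives: put $n_{kl}=\sigma_{k-1}^{-1}\sigma_{k-2}^{-1}\cdots\sigma_l^{-1}$ for $l<k$, and $n_{kl}=1$ in other cases. The set $M_n=\{\,n_{2,j_2}n_{3,j_3}\cdots n_{n,j_n} : 1\le j_k\le k\,\}$ is a Schreier set of coset representatives of $SP_n$ in $SG_n$. For $n>2$ and $1<m<n$ put $M_{n,m}=M_n\setminus(M_m\setminus\{e\})$, where $e$ is the unit element. Camomile type: if a group $K$ is defined by a set of generators $X$ and a set of defining relations $R$, one says that $K$ has the presentation $\mathcal P(K)=\langle X\mid R\rangle$ and writes $\mathcal G(K)=X$, $\mathcal R(K)=R$. Let $G$ be a group, $H$ a normal subgroup of $G$, and $M$ a set of coset representatives of $H$ in $G$. For $m\in G$ write $x^m=m^{-1}xm$ and $H_0^m=m^{-1}H_0m$; $\mathcal P(H_0^m)$ is the presentation of $H_0^m$ obtained from $\mathcal P(H_0)$ by conjugation by $m$. The subgroup $H$ is said to be of camomile type with highlighted petal $H_0$ and conjugated set $M_0$, written $H=Cam_G(H_0,M_0)$, if $H_0$ is a proper subgroup of $H$, $M_0$ is a subset of $M$ containing the unit $e$ of $G$, and $\mathcal P(H)=\bigcup_{m\in M_0}\mathcal P(H_0^m)$, which means that $\mathcal G(H)=\bigcup_{m\in M_0}\mathcal G(H_0^m)$ and $\mathcal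 R(H)=\bigcup_{m\in M_0}\mathcal R(H_0^m)$. *)

theory Defs
  imports "HOL-Algebra.Sym_Groups"
begin

section \<open>Groups given by generators and relations\<close>

text \<open>
  A letter \<open>(x, True)\<close> stands for the generator \<open>x\<close>, and \<open>(x, False)\<close> for its formal inverse.
  A relation \<open>u = v\<close> is the pair \<open>(u, v)\<close> of words.
\<close>

type_synonym 'g word = "('g \<times> bool) list"

definition words :: "'g set \<Rightarrow> 'g word set" where
  "words X = lists (X \<times> UNIV)"

inductive pres_cong :: "'g set \<Rightarrow> ('g word \<times> 'g word) set \<Rightarrow> 'g word \<Rightarrow> 'g word \<Rightarrow> bool"
  for X R where
    refl: "u \<in> words X \<Longrightarrow> pres_cong X R u u"
  | sym: "pres_cong X R u v \<Longrightarrow> pres_cong X R v u"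
  | trans: "pres_cong X R u v \<Longrightarrow> pres_cong X R v w \<Longrightarrow> pres_cong X R u w"
  | cancel: "p \<in> words X \<Longrightarrow> q \<in> words X \<Longrightarrow> x \<in> X \<Longrightarrow>
      pres_cong X R (p @ [(x, e), (x, \<not> e)] @ q) (p @ q)"
  | rel: "p \<in> words X \<Longrightarrow> q \<in> words X \<Longrightarrow> (u, v) \<in> R \<Longrightarrow>
      pres_cong X R (p @ u @ q) (p @ v @ q)"

definition pres_rel :: "'g set \<Rightarrow> ('g word \<times> 'g word) set \<Rightarrow> 'g word rel" where
  "pres_rel X R = {(u, v). pres_cong X R u v}"

definition presented_group :: "'g set \<Rightarrow> ('g word \<times> 'g word) set \<Rightarrow> 'g word set monoid" where
  "presented_group X R =
     \<lparr> carrier = words X // pres_rel X R,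
       mult = (\<lambda>A B. \<Union>u\<in>A. \<Union>v\<in>B. pres_rel X R `` {u @ v}),
       one = pres_rel X R `` {[]} \<rparr>"

definition gen_class :: "'g set \<Rightarrow> ('g word \<times> 'g word) set \<Rightarrow> 'g \<Rightarrow> 'g word set" where
  "gen_class X R x = pres_rel X R `` {[(x, True)]}"

definition word_eval :: "('a, 'c) monoid_scheme \<Rightarrow> ('g \<Rightarrow> 'a) \<Rightarrow> 'g word \<Rightarrow> 'a" where
  "word_eval G f w =
     foldr (\<lambda>(x, e) y. (if e then f x else inv\<^bsub>G\<^esub> (f x)) \<otimes>\<^bsub>G\<^esub> y) w \<one>\<^bsub>G\<^esub>"

text \<open>
  The map induced on a presented group by an assignment \<open>f\<close> of the generators that respects the
  relations; it is meaningful only in that case, see \<open>presented_map_class\<close> and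
  \<open>presented_map_hom\<close> below.
\<close>

definition presented_map :: "('a, 'c) monoid_scheme \<Rightarrow> ('g \<Rightarrow> 'a) \<Rightarrow> 'g word set \<Rightarrow> 'a" where
  "presented_map G f A = the_elem (word_eval G f ` A)"

text \<open>
  \<open>K\<close> has the presentation \<open>\<langle>X | R\<rangle>\<close>, where the generators are elements of \<open>K\<close>.
\<close>

definition has_presentation ::
    "('a, 'c) monoid_scheme \<Rightarrow> 'a set \<Rightarrow> ('a word \<times> 'a word) set \<Rightarrow> bool" where
  "has_presentation K X R \<longleftrightarrow>
     X \<subseteq> carrier K \<and> R \<subseteq> words X \<times> words X \<and>
     (\<exists>\<phi> \<in> iso (presented_group X R) K. \<forall>x\<in>X. \<phi> (gen_class X R x) = x)"

lemma words_append [simp]: "u @ v \<in> words X \<longleftrightarrow> u \<in> words X \<and> v \<in> words X"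
  by (auto simp: words_def)

lemma words_Nil [simp]: "[] \<in> words X"
  by (simp add: words_def)

lemma words_Cons [simp]: "(x, e) # w \<in> words X \<longleftrightarrow> x \<in> X \<and> w \<in> words X"
  by (auto simp: words_def)

context
  fixes X :: "'g set" and R :: "('g word \<times> 'g word) set"
  assumes R: "R \<subseteq> words X \<times> words X"
begin

lemma pres_cong_words: "pres_cong X R u v \<Longrightarrow> u \<in> words X \<and> v \<in> words X"
  by (induction rule: pres_cong.induct) (use R in auto)

lemma equiv_pres_rel: "equiv (words X) (pres_rel X R)"
proof (rule equivI)
  show "pres_rel X R \<subseteq> words X \<times> words X"
    using pres_cong_words by (auto simp: pres_rel_def)
  show "refl_on (words X) (pres_rel X R)"
    by (auto simp: refl_on_def pres_rel_def pres_cong.refl)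
  show "sym (pres_rel X R)"
    by (rule symI) (simp add: pres_rel_def pres_cong.sym)
  show "trans (pres_rel X R)"
    by (rule transI) (simp add: pres_rel_def, erule (1) pres_cong.trans)
qed

lemma pres_cong_context:
  "pres_cong X R u v \<Longrightarrow> a \<in> words X \<Longrightarrow> b \<in> words X \<Longrightarrow> pres_cong X R (a @ u @ b) (a @ v @ b)"
proof (induction rule: pres_cong.induct)
  case (refl u)
  then show ?case by (simp add: pres_cong.refl)
next
  case (sym u v)
  then show ?case by (simp add: pres_cong.sym)
next
  case (trans u v w)
  then show ?case using pres_cong.trans by blast
next
  case (cancel p q x e)
  then show ?case using pres_cong.cancel[of "a @ p" X "q @ b" x R e] by simp
next
  case (rel p q u v)
  then show ?case using pres_cong.rel[of "a @ p" X "q @ b" u v R] by simp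
qed

lemma pres_cong_append:
  assumes "pres_cong X R u u'" "pres_cong X R v v'"
  shows "pres_cong X R (u @ v) (u' @ v')"
  using pres_cong_context[OF assms(1), of "[]" v] pres_cong_context[OF assms(2), of u' "[]"]
    pres_cong_words[OF assms(1)] pres_cong_words[OF assms(2)] pres_cong.trans[of X R "u @ v" "u' @ v" "u' @ v'"]
  by simp

lemma class_eq_iff:
  "u \<in> words X \<Longrightarrow> v \<in> words X \<Longrightarrow> pres_rel X R `` {u} = pres_rel X R `` {v} \<longleftrightarrow> pres_cong X R u v"
  using eq_equiv_class_iff[OF equiv_pres_rel, of u v] by (simp add: pres_rel_def)

lemma presented_mult:
  assumes "u \<in> words X" "v \<in> words X"
  shows "(pres_rel X R `` {u}) \<otimes>\<^bsub>presented_group X R\<^esub> (pres_rel X R `` {v}) = pres_rel X R `` {u @ v}"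
proof -
  have eq: "pres_rel X R `` {u' @ v'} = pres_rel X R `` {u @ v}"
    if "u' \<in> pres_rel X R `` {u}" "v' \<in> pres_rel X R `` {v}" for u' v'
  proof -
    have *: "pres_cong X R (u @ v) (u' @ v')"
      using that pres_cong_append by (simp add: pres_rel_def)
    show ?thesis
      using class_eq_iff[of "u' @ v'" "u @ v"] pres_cong_words[OF *] pres_cong.sym[OF *] by simp
  qed
  have mem: "u \<in> pres_rel X R `` {u}" "v \<in> pres_rel X R `` {v}"
    using assms by (simp_all add: pres_rel_def pres_cong.refl)
  have "(\<Union>v'\<in>pres_rel X R `` {v}. pres_rel X R `` {u' @ v'}) = pres_rel X R `` {u @ v}"
    if "u' \<in> pres_rel X R `` {u}" for u'
    by (rule UN_constant_eq[OF mem(2)]) (use eq[OF that] in blast)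
  then have "(\<Union>u'\<in>pres_rel X R `` {u}. \<Union>v'\<in>pres_rel X R `` {v}. pres_rel X R `` {u' @ v'})
      = pres_rel X R `` {u @ v}"
    by (intro UN_constant_eq[OF mem(1)]) blast
  then show ?thesis
    by (simp add: presented_group_def)
qed

lemma inverse_word:
  "u \<in> words X \<Longrightarrow> \<exists>v\<in>words X. pres_cong X R (v @ u) []"
proof (induction u)
  case Nil
  then show ?case by (auto intro!: bexI[of _ "[]"] pres_cong.refl)
next
  case (Cons a u)
  obtain x e where a: "a = (x, e)" by force
  then obtain v where v: "v \<in> words X" "pres_cong X R (v @ u) []" using Cons by auto
  have "pres_cong X R (v @ [(x, \<not> e), (x, \<not> \<not> e)] @ u) (v @ u)"
    using Cons v a by (intro pres_cong.cancel) auto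
  then have "pres_cong X R ((v @ [(x, \<not> e)]) @ a # u) []"
    using v(2) a pres_cong.trans[of X R _ "v @ u" "[]"] by simp
  then show ?case using v Cons a by (intro bexI[of _ "v @ [(x, \<not> e)]"]) auto
qed

lemma presented_group_carrierE:
  assumes "A \<in> carrier (presented_group X R)"
  obtains u where "u \<in> words X" "A = pres_rel X R `` {u}"
  using assms by (auto simp: presented_group_def elim: quotientE)

lemma class_in_carrier: "u \<in> words X \<Longrightarrow> pres_rel X R `` {u} \<in> carrier (presented_group X R)"
  by (auto simp: presented_group_def intro: quotientI)

lemma presented_one: "\<one>\<^bsub>presented_group X R\<^esub> = pres_rel X R `` {[]}"
  by (simp add: presented_group_def)

theorem group_presented_group: "group (presented_group X R)"
proof (rule groupI)
  fix A assume "A \<in> carrier (presented_group X R)"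
  then obtain u where u: "u \<in> words X" "A = pres_rel X R `` {u}"
    by (rule presented_group_carrierE)
  then obtain v where v: "v \<in> words X" "pres_cong X R (v @ u) []"
    using inverse_word by blast
  have "pres_rel X R `` {v @ u} = pres_rel X R `` {[]}"
    using u v class_eq_iff by auto
  then show "\<exists>B\<in>carrier (presented_group X R). B \<otimes>\<^bsub>presented_group X R\<^esub> A = \<one>\<^bsub>presented_group X R\<^esub>"
    using u v by (intro bexI[of _ "pres_rel X R `` {v}"]) (auto simp: presented_mult presented_one class_in_carrier)
qed (auto elim!: presented_group_carrierE simp: presented_mult presented_one class_in_carrier)

context
  fixes G :: "('a, 'c) monoid_scheme" and f :: "'g \<Rightarrow> 'a"
  assumes G: "group G" and f: "\<And>x. x \<in> X \<Longrightarrow> f x \<in> carrier G"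
    and fR: "\<And>u v. (u, v) \<in> R \<Longrightarrow> word_eval G f u = word_eval G f v"
begin

lemma word_eval_closed: "u \<in> words X \<Longrightarrow> word_eval G f u \<in> carrier G"
proof (induction u)
  case Nil
  then show ?case using G by (simp add: word_eval_def group.is_monoid)
next
  case (Cons a u)
  interpret group G by (rule G)
  show ?case using Cons f
    by (cases a) (auto simp: word_eval_def)
qed

lemma word_eval_append:
  "u \<in> words X \<Longrightarrow> v \<in> words X \<Longrightarrow>
    word_eval G f (u @ v) = word_eval G f u \<otimes>\<^bsub>G\<^esub> word_eval G f v"
proof (induction u)
  case Nil
  then show ?case using G word_eval_closed[of v]
    by (simp add: word_eval_def group.is_monoid)
next
  case (Cons a u)
  obtain x e where a: "a = (x, e)" by force
  interpret group G by (rule G)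
  have step: "word_eval G f ((x, e) # w) = (if e then f x else inv\<^bsub>G\<^esub> (f x)) \<otimes>\<^bsub>G\<^esub> word_eval G f w" for w
    by (simp add: word_eval_def)
  show ?case
    using Cons a f word_eval_closed[of u] word_eval_closed[of v]
    by (simp add: step m_assoc)
qed

lemma word_eval_cong: "pres_cong X R u v \<Longrightarrow> word_eval G f u = word_eval G f v"
proof (induction rule: pres_cong.induct)
  case (cancel p q x e)
  interpret group G by (rule G)
  have "word_eval G f [(x, e), (x, \<not> e)] = \<one>\<^bsub>G\<^esub>"
    using cancel f by (cases e) (auto simp: word_eval_def)
  then have "word_eval G f ([(x, e), (x, \<not> e)] @ q) = word_eval G f q"
    using cancel word_eval_closed[of q] word_eval_append[of "[(x, e), (x, \<not> e)]" q] by simp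
  then show ?case
    using cancel word_eval_append[of p "[(x, e), (x, \<not> e)] @ q"] word_eval_append[of p q] by simp
next
  case (rel p q u v)
  then show ?case using R fR[of u v] by (auto simp: word_eval_append)
qed simp_all

lemma presented_map_class:
  assumes "u \<in> words X"
  shows "presented_map G f (pres_rel X R `` {u}) = word_eval G f u"
proof -
  have "word_eval G f ` (pres_rel X R `` {u}) = {word_eval G f u}"
  proof (intro equalityI subsetI)
    fix y assume "y \<in> word_eval G f ` (pres_rel X R `` {u})"
    then show "y \<in> {word_eval G f u}"
      by (auto simp: pres_rel_def word_eval_cong[symmetric])
  next
    fix y assume "y \<in> {word_eval G f u}"
    moreover have "u \<in> pres_rel X R `` {u}"
      using pres_cong.refl[OF assms] by (simp add: pres_rel_def)
    ultimately show "y \<in> word_eval G f ` (pres_rel X R `` {u})"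
      by blast
  qed
  then show ?thesis by (simp add: presented_map_def)
qed

lemma presented_map_hom: "presented_map G f \<in> hom (presented_group X R) G"
  by (rule homI; elim presented_group_carrierE)
    (auto simp: presented_map_class presented_mult word_eval_closed word_eval_append)

end

end


section \<open>Camomile type\<close>

definition conj_elt :: "('a, 'c) monoid_scheme \<Rightarrow> 'a \<Rightarrow> 'a \<Rightarrow> 'a" where
  "conj_elt G m x = inv\<^bsub>G\<^esub> m \<otimes>\<^bsub>G\<^esub> x \<otimes>\<^bsub>G\<^esub> m"

definition conj_word :: "('a, 'c) monoid_scheme \<Rightarrow> 'a \<Rightarrow> 'a word \<Rightarrow> 'a word" where
  "conj_word G m w = map (\<lambda>(x, e). (conj_elt G m x, e)) w"

text \<open>Left and right cosets agree here, since \<open>H\<close> is normal.\<close>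

definition coset_representatives :: "('a, 'c) monoid_scheme \<Rightarrow> 'a set \<Rightarrow> 'a set \<Rightarrow> bool" where
  "coset_representatives G H M \<longleftrightarrow>
     M \<subseteq> carrier G \<and> (\<forall>C \<in> rcosets\<^bsub>G\<^esub> H. \<exists>!m. m \<in> M \<and> m \<in> C)"

text \<open>
  The presentation \<open>\<langle>X | R\<rangle>\<close> of the petal \<open>H0\<close> is existentially quantified. The generators are
  elements of \<open>G\<close>, so generators of different conjugates that are equal in \<open>G\<close> are the same
  generator of the united presentation.
\<close>

definition camomile ::
    "('a, 'c) monoid_scheme \<Rightarrow> 'a set \<Rightarrow> 'a set \<Rightarrow> 'a set \<Rightarrow> 'a set \<Rightarrow> bool" where
  "camomile G H M H0 M0 \<longleftrightarrow>
     group G \<and> H \<lhd> G \<and> coset_representatives G H M \<and>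
     subgroup H0 G \<and> H0 \<subset> H \<and> M0 \<subseteq> M \<and> \<one>\<^bsub>G\<^esub> \<in> M0 \<and>
     (\<exists>X R.
        has_presentation (G\<lparr>carrier := H0\<rparr>) X R \<and>
        has_presentation (G\<lparr>carrier := H\<rparr>)
          (\<Union>m\<in>M0. conj_elt G m ` X)
          (\<Union>m\<in>M0. (\<lambda>(u, v). (conj_word G m u, conj_word G m v)) ` R))"


section \<open>The singular braid group and the singular pure braid group\<close>

datatype sgen = Sigma nat | Tau nat

abbreviation s_ltr :: "nat \<Rightarrow> sgen \<times> bool" where "s_ltr i \<equiv> (Sigma i, True)"
abbreviation t_ltr :: "nat \<Rightarrow> sgen \<times> bool" where "t_ltr i \<equiv> (Tau i, True)"

definition sg_gens :: "nat \<Rightarrow> sgen set" where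
  "sg_gens n = Sigma ` {1..<n} \<union> Tau ` {1..<n}"

definition sg_rels :: "nat \<Rightarrow> (sgen word \<times> sgen word) set" where
  "sg_rels n =
     {([s_ltr i, s_ltr (i+1), s_ltr i], [s_ltr (i+1), s_ltr i, s_ltr (i+1)]) | i. 1 \<le> i \<and> i + 2 \<le> n} \<union>
     {([s_ltr i, s_ltr j], [s_ltr j, s_ltr i]) | i j.
        i \<in> {1..<n} \<and> j \<in> {1..<n} \<and> \<bar>int i - int j\<bar> \<ge> 2} \<union>
     {([t_ltr i, t_ltr j], [t_ltr j, t_ltr i]) | i j.
        i \<in> {1..<n} \<and> j \<in> {1..<n} \<and> \<bar>int i - int j\<bar> \<ge> 2} \<union>
     {([t_ltr i, s_ltr j], [s_ltr j, t_ltr i]) | i j.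
        i \<in> {1..<n} \<and> j \<in> {1..<n} \<and> \<bar>int i - int j\<bar> \<ge> 2} \<union>
     {([t_ltr i, s_ltr i], [s_ltr i, t_ltr i]) | i. i \<in> {1..<n}} \<union>
     {([s_ltr i, s_ltr (i+1), t_ltr i], [t_ltr (i+1), s_ltr i, s_ltr (i+1)]) | i. 1 \<le> i \<and> i + 2 \<le> n} \<union>
     {([s_ltr (i+1), s_ltr i, t_ltr (i+1)], [t_ltr i, s_ltr (i+1), s_ltr i]) | i. 1 \<le> i \<and> i + 2 \<le> n}"

definition SG :: "nat \<Rightarrow> sgen word set monoid" where
  "SG n = presented_group (sg_gens n) (sg_rels n)"

definition sigma :: "nat \<Rightarrow> nat \<Rightarrow> sgen word set" where
  "sigma n i = gen_class (sg_gens n) (sg_rels n) (Sigma i)"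

definition tau :: "nat \<Rightarrow> nat \<Rightarrow> sgen word set" where
  "tau n i = gen_class (sg_gens n) (sg_rels n) (Tau i)"

fun sgen_perm :: "sgen \<Rightarrow> nat \<Rightarrow> nat" where
  "sgen_perm (Sigma i) = transpose i (i + 1)"
| "sgen_perm (Tau i) = transpose i (i + 1)"

definition sg_pi :: "nat \<Rightarrow> sgen word set \<Rightarrow> nat \<Rightarrow> nat" where
  "sg_pi n = presented_map (sym_group n) sgen_perm"

definition SP :: "nat \<Rightarrow> sgen word set set" where
  "SP n = kernel (SG n) (sym_group n) (sg_pi n)"

definition list_mult :: "('a, 'c) monoid_scheme \<Rightarrow> 'a list \<Rightarrow> 'a" where
  "list_mult G xs = foldr (\<lambda>x y. x \<otimes>\<^bsub>G\<^esub> y) xs \<one>\<^bsub>G\<^esub>"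

text \<open>\<open>\<sigma>\<^bsub>j-1\<^esub> \<cdots> \<sigma>\<^bsub>i+1\<^esub>\<close>, empty for \<open>j = i + 1\<close>\<close>

definition desc_sigma :: "nat \<Rightarrow> nat \<Rightarrow> nat \<Rightarrow> sgen word set" where
  "desc_sigma n i j = list_mult (SG n) (map (sigma n) (rev [i+1..<j]))"

definition sp_a :: "nat \<Rightarrow> nat \<Rightarrow> nat \<Rightarrow> sgen word set" where
  "sp_a n i j = desc_sigma n i j \<otimes>\<^bsub>SG n\<^esub> (sigma n i \<otimes>\<^bsub>SG n\<^esub> sigma n i) \<otimes>\<^bsub>SG n\<^esub> inv\<^bsub>SG n\<^esub> (desc_sigma n i j)"

definition sp_b :: "nat \<Rightarrow> nat \<Rightarrow> nat \<Rightarrow> sgen word set" where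
  "sp_b n i j = desc_sigma n i j \<otimes>\<^bsub>SG n\<^esub> (tau n i \<otimes>\<^bsub>SG n\<^esub> sigma n i) \<otimes>\<^bsub>SG n\<^esub> inv\<^bsub>SG n\<^esub> (desc_sigma n i j)"

text \<open>\<open>SP\<^bsub>m\<^esub>\<close>, regarded as a subgroup of \<open>SG\<^bsub>n\<^esub>\<close>\<close>

definition SP_sub :: "nat \<Rightarrow> nat \<Rightarrow> sgen word set set" where
  "SP_sub n m = generate (SG n)
     ({sp_a n i j | i j. 1 \<le> i \<and> i < j \<and> j \<le> m} \<union> {sp_b n i j | i j. 1 \<le> i \<and> i < j \<and> j \<le> m})"

text \<open>\<open>n\<^bsub>kl\<^esub> = \<sigma>\<^bsub>k-1\<^esub>\<^sup>-\<^sup>1 \<cdots> \<sigma>\<^bsub>l\<^esub>\<^sup>-\<^sup>1\<close> in \<open>SG\<^bsub>n\<^esub>\<close>; the list is empty for \<open>l \<ge> k\<close>\<close>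

definition rep_n :: "nat \<Rightarrow> nat \<Rightarrow> nat \<Rightarrow> sgen word set" where
  "rep_n n k l = list_mult (SG n) (map (\<lambda>i. inv\<^bsub>SG n\<^esub> (sigma n i)) (rev [l..<k]))"

text \<open>\<open>M\<^bsub>m\<^esub>\<close> as a subset of \<open>SG\<^bsub>n\<^esub>\<close>\<close>

definition sg_M :: "nat \<Rightarrow> nat \<Rightarrow> sgen word set set" where
  "sg_M n m = {list_mult (SG n) (map (\<lambda>k. rep_n n k (j k)) [2..<m+1]) | j.
                 \<forall>k\<in>{2..m}. 1 \<le> j k \<and> j k \<le> k}"

definition sg_M_conj :: "nat \<Rightarrow> nat \<Rightarrow> sgen word set set" where
  "sg_M_conj n m = sg_M n n - (sg_M n m - {\<one>\<^bsub>SG n\<^esub>})"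

lemma sg_rels_words: "sg_rels n \<subseteq> words (sg_gens n) \<times> words (sg_gens n)"
  by (auto simp: sg_rels_def sg_gens_def)

lemma group_SG: "group (SG n)"
  unfolding SG_def by (rule group_presented_group[OF sg_rels_words])

lemma sgen_perm_closed: "x \<in> sg_gens n \<Longrightarrow> sgen_perm x \<in> carrier (sym_group n)"
  by (auto simp: sg_gens_def sym_group_carrier intro!: permutes_swap_id)

lemma sgen_perm_rels:
  assumes "(u, v) \<in> sg_rels n"
  shows "word_eval (sym_group n) sgen_perm u = word_eval (sym_group n) sgen_perm v"
  using assms
  by (auto simp: sg_rels_def word_eval_def sym_group_mult sym_group_one fun_eq_iff transpose_def)

lemma sg_pi_hom: "sg_pi n \<in> hom (SG n) (sym_group n)"
  unfolding sg_pi_def SG_def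
  by (rule presented_map_hom[OF sg_rels_words sym_group_is_group sgen_perm_closed sgen_perm_rels])

lemma sg_pi_generators:
  assumes "i \<in> {1..<n}"
  shows "sg_pi n (sigma n i) = transpose i (i + 1)" "sg_pi n (tau n i) = transpose i (i + 1)"
  unfolding sg_pi_def sigma_def tau_def gen_class_def
  by (subst presented_map_class[OF sg_rels_words sym_group_is_group sgen_perm_closed sgen_perm_rels];
      use assms in \<open>force simp: sg_gens_def word_eval_def sym_group_mult sym_group_one\<close>)+

end

(*
  The conjugates of SP_4 by M_{n,4} are the "petals" P_S = < a_ij, b_ij : i, j in S > for the
  4-element sets S, because the inverse of a coset representative is a positive permutation braid
  which, up to an element of SG_4, carries the first four strands to S in front of the others.
  Take for X all of SP_4 and for R all relations valid there.  It then has to be shown that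
  SP_n is the amalgam K of the petals, i.e. that K = < a_ij, b_ij | all relations valid in some
  petal > maps injectively to SG_n.

  Conjugation by sigma_i lifts to an endomorphism s_i of K, and the s_i satisfy the braid
  relations, since every identity to be checked on a generator involves at most four strands and
  hence holds in a petal.  Choosing the positive permutation braids m_w as a section of SG_n -> S_n,
  one gets a cocycle c(w, x) lifting m_w x (m_{w pi(x)})^-1 to K, and with it a right action of the
  words of SG_n on K x S_n.  A defining relation of SG_n involves a parabolic subgroup W_J of rank
  at most two; after translation to the minimal representative of the coset w W_J it is a relation in one
  petal, so the action descends to SG_n.  As k in K acts by right translation on K x {1},
  K embeds into SG_n.
*)
theory Submission
  imports Defs
begin

text \<open>The number four comes from the relations. A braid relation occupies three strands, and a
  generator that meets them brings in at most one more; a far commutation occupies four by itself.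
  Identities in \<open>K\<close> come from the subgroups spanned by at most four strands, where all
  valid relations were imposed and the map \<open>p\<close> to \<open>SG n\<close> is injective. So,
  after reduction to generators, both sides of an identity are steered into one such subgroup and
  compared in \<open>SG n\<close>.

  This fails for conjugation by \<open>sigma n i\<close> when strand \<open>i + 1\<close> is present
  without \<open>i\<close>: four strands may become five. The remedy is to split off conjugation by
  the square of \<open>sigma n i\<close>; the rest is conjugation by the inverse, which keeps the
  number of strands.

  Only positive words are evaluated in the maps \<open>s_map i\<close>, so the calculus of reduced
  words is developed over monoids and serves \<open>SG n\<close> and these maps alike. The pair
  \<open>(k, w)\<close> of the action stands for \<open>p k\<close> times the braid of
  \<open>w\<close>, but keeps \<open>k\<close> itself, which makes the kernel of \<open>p\<close>
  visible.\<close>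

section \<open>Presented groups\<close>

lemma word_eval_Nil [simp]: "word_eval G f [] = \<one>\<^bsub>G\<^esub>"
  by (simp add: word_eval_def)

lemma word_eval_Cons [simp]:
  "word_eval G f ((x, e) # w) = (if e then f x else inv\<^bsub>G\<^esub> (f x)) \<otimes>\<^bsub>G\<^esub> word_eval G f w"
  by (simp add: word_eval_def)

lemma words_mono: "X \<subseteq> Y \<Longrightarrow> u \<in> words X \<Longrightarrow> u \<in> words Y"
  by (auto simp: words_def)

lemma words_induct [consumes 1, case_names Nil Cons]:
  assumes "u \<in> words X" "P []" "\<And>x e u. x \<in> X \<Longrightarrow> u \<in> words X \<Longrightarrow> P u \<Longrightarrow> P ((x, e) # u)"
  shows "P u"
  using assms(1)
proof (induction u)
  case (Cons a u)
  then show ?case using assms(3) by (cases a) auto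
qed (rule assms(2))

context group
begin

lemma word_eval_in_carrier:
  "(\<And>x. x \<in> X \<Longrightarrow> f x \<in> carrier G) \<Longrightarrow> u \<in> words X \<Longrightarrow> word_eval G f u \<in> carrier G"
  by (rule word_eval_closed[of "{}" X G f]) (auto simp: is_group)

lemma word_eval_append_gens:
  "(\<And>x. x \<in> X \<Longrightarrow> f x \<in> carrier G) \<Longrightarrow> u \<in> words X \<Longrightarrow> v \<in> words X \<Longrightarrow>
    word_eval G f (u @ v) = word_eval G f u \<otimes> word_eval G f v"
  by (rule word_eval_append[of "{}" X G f]) (auto simp: is_group)

lemma word_eval_in_subgroup:
  assumes "subgroup S G" "\<And>x. x \<in> X \<Longrightarrow> f x \<in> S" "u \<in> words X"
  shows "word_eval G f u \<in> S"
  using assms(3)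
  by (induction rule: words_induct)
    (use assms(1,2) in \<open>auto intro: subgroup.m_closed subgroup.m_inv_closed subgroup.one_closed\<close>)

lemma word_eval_cong_gens:
  assumes "u \<in> words X" "\<And>x. x \<in> X \<Longrightarrow> f x = g x"
  shows "word_eval G f u = word_eval G g u"
  using assms(1) by (induction rule: words_induct) (simp_all add: assms(2))

text \<open>Membership in a generated subgroup is turned into a word, to which the relations of a
  presentation can be applied.\<close>

lemma generate_eq_word_eval:
  assumes f: "\<And>x. x \<in> X \<Longrightarrow> f x \<in> carrier G"
  shows "generate G (f ` X) = word_eval G f ` words X"
proof
  show "generate G (f ` X) \<subseteq> word_eval G f ` words X"
  proof
    fix y assume "y \<in> generate G (f ` X)"
    then show "y \<in> word_eval G f ` words X"
    proof (induction rule: generate.induct)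
      case one
      then show ?case by (auto intro!: image_eqI[of _ _ "[]"])
    next
      case (incl h)
      then obtain x where "x \<in> X" "h = f x" by blast
      then show ?case using f by (auto intro!: image_eqI[of _ _ "[(x, True)]"])
    next
      case (inv h)
      then obtain x where "x \<in> X" "h = f x" by blast
      then show ?case using f by (auto intro!: image_eqI[of _ _ "[(x, False)]"])
    next
      case (eng h1 h2)
      then obtain u v where "u \<in> words X" "v \<in> words X" "h1 = word_eval G f u" "h2 = word_eval G f v"
        by blast
      then show ?case using word_eval_append_gens[of X f u v] f
        by (auto intro!: image_eqI[of _ _ "u @ v"])
    qed
  qed
  show "word_eval G f ` words X \<subseteq> generate G (f ` X)"
  proof
    fix y assume "y \<in> word_eval G f ` words X"
    then obtain u where u: "u \<in> words X" "y = word_eval G f u" by blast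
    have "subgroup (generate G (f ` X)) G" using f by (intro generate_is_subgroup) auto
    then show "y \<in> generate G (f ` X)"
      unfolding u(2) by (rule word_eval_in_subgroup[OF _ _ u(1)]) (simp add: generate.incl)
  qed
qed

end

locale presentation =
  fixes X :: "'g set" and R :: "('g word \<times> 'g word) set"
  assumes rels: "R \<subseteq> words X \<times> words X"
begin

abbreviation "K \<equiv> presented_group X R"
abbreviation "gen \<equiv> gen_class X R"

sublocale K: group K
  by (rule group_presented_group[OF rels])

lemma gen_closed: "x \<in> X \<Longrightarrow> gen x \<in> carrier K"
  unfolding gen_class_def by (rule class_in_carrier[OF rels]) simp

lemma gen_class_inv:
  assumes "x \<in> X"
  shows "pres_rel X R `` {[(x, False)]} = inv\<^bsub>K\<^esub> (gen x)"
proof (rule K.inv_equality[symmetric])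
  have "pres_cong X R ([] @ [(x, False), (x, \<not> False)] @ []) ([] @ [])"
    using assms by (intro pres_cong.cancel) auto
  then show "pres_rel X R `` {[(x, False)]} \<otimes>\<^bsub>K\<^esub> gen x = \<one>\<^bsub>K\<^esub>"
    using assms by (simp add: gen_class_def presented_mult[OF rels] presented_one[OF rels] class_eq_iff[OF rels])
qed (use assms class_in_carrier[OF rels, of "[(x, False)]"] in \<open>auto intro: gen_closed\<close>)

lemma class_eq_word_eval: "u \<in> words X \<Longrightarrow> pres_rel X R `` {u} = word_eval K gen u"
proof (induction rule: words_induct)
  case Nil
  then show ?case by (simp add: presented_one[OF rels])
next
  case (Cons x e u)
  have "pres_rel X R `` {(x, e) # u} = pres_rel X R `` {[(x, e)]} \<otimes>\<^bsub>K\<^esub> pres_rel X R `` {u}"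
    using Cons by (subst presented_mult[OF rels]) auto
  then show ?case using Cons gen_class_inv by (cases e) (auto simp: gen_class_def)
qed

lemma carrier_eq_generate: "carrier K = generate K (gen ` X)"
proof -
  have "carrier K = word_eval K gen ` words X"
    using class_eq_word_eval class_in_carrier[OF rels]
    by (auto elim!: presented_group_carrierE[OF rels] intro!: K.word_eval_in_carrier[of X] gen_closed)
  then show ?thesis using K.generate_eq_word_eval[of X gen] gen_closed by simp
qed

lemma carrierE_word:
  assumes "A \<in> carrier K" obtains u where "u \<in> words X" "A = word_eval K gen u"
  using assms class_eq_word_eval by (metis presented_group_carrierE[OF rels])

lemma word_eval_gen_eq_iff:
  "u \<in> words X \<Longrightarrow> v \<in> words X \<Longrightarrow> word_eval K gen u = word_eval K gen v \<longleftrightarrow> pres_cong X R u v"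
  using class_eq_iff[OF rels, of u v] by (simp add: class_eq_word_eval)

lemma carrier_induct [consumes 1, case_names one gen mult inv]:
  assumes "A \<in> carrier K" "P \<one>\<^bsub>K\<^esub>" "\<And>x. x \<in> X \<Longrightarrow> P (gen x)"
    "\<And>A B. A \<in> carrier K \<Longrightarrow> B \<in> carrier K \<Longrightarrow> P A \<Longrightarrow> P B \<Longrightarrow> P (A \<otimes>\<^bsub>K\<^esub> B)"
    "\<And>A. A \<in> carrier K \<Longrightarrow> P A \<Longrightarrow> P (inv\<^bsub>K\<^esub> A)"
  shows "P A"
proof -
  have "A \<in> generate K (gen ` X)" using assms(1) carrier_eq_generate by simp
  then show ?thesis
  proof (induction rule: generate.induct)
    case (eng h1 h2)
    then show ?case using assms(4) carrier_eq_generate by blast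
  qed (use assms gen_closed in auto)
qed

lemma hom_eqI:
  assumes "group H" "h \<in> hom K H" "h' \<in> hom K H" "\<And>x. x \<in> X \<Longrightarrow> h (gen x) = h' (gen x)"
    "A \<in> carrier K"
  shows "h A = h' A"
proof -
  interpret h: group_hom K H h using assms by (simp add: group_hom_def group_hom_axioms_def K.is_group)
  interpret h': group_hom K H h' using assms by (simp add: group_hom_def group_hom_axioms_def K.is_group)
  show ?thesis using assms(5) by (induction rule: carrier_induct) (use assms(4) in simp_all)
qed

context
  fixes G :: "('a, 'c) monoid_scheme" and f :: "'g \<Rightarrow> 'a"
  assumes G: "group G" and f: "\<And>x. x \<in> X \<Longrightarrow> f x \<in> carrier G"
    and fR: "\<And>u v. (u, v) \<in> R \<Longrightarrow> word_eval G f u = word_eval G f v"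
begin

lemma map_hom: "group_hom K G (presented_map G f)"
  using presented_map_hom[OF rels G f fR] G by (simp add: group_hom_def group_hom_axioms_def K.is_group)

lemma map_gen:
  assumes "x \<in> X" shows "presented_map G f (gen x) = f x"
proof -
  interpret group G by (rule G)
  show ?thesis
    using presented_map_class[OF rels G f fR, of "[(x, True)]"] assms f by (simp add: gen_class_def)
qed

lemma map_word_eval:
  assumes "u \<in> words X" shows "presented_map G f (word_eval K gen u) = word_eval G f u"
  using presented_map_class[OF rels G f fR, of u] assms by (simp add: class_eq_word_eval)

end

end

text \<open>The induced homomorphism onto \<open>H\<close> is injective once its kernel is trivial,
  so only words with trivial value have to be reduced to the empty word.\<close>

lemma has_presentationI:
  assumes G: "group G" and H: "H = generate G X" and X: "X \<subseteq> carrier G"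
    and R: "R \<subseteq> words X \<times> words X"
    and valid: "\<And>u v. (u, v) \<in> R \<Longrightarrow> word_eval G id u = word_eval G id v"
    and inj: "\<And>u. u \<in> words X \<Longrightarrow> word_eval G id u = \<one>\<^bsub>G\<^esub> \<Longrightarrow> pres_cong X R u []"
  shows "has_presentation (G\<lparr>carrier := H\<rparr>) X R"
proof -
  interpret G: group G by (rule G)
  interpret presentation X R by unfold_locales (rule R)
  have idX: "\<And>x. x \<in> X \<Longrightarrow> id x \<in> carrier G" using X by auto
  let ?p = "presented_map G id"
  interpret p: group_hom K G ?p using map_hom[OF G idX valid] .
  have eval: "?p (word_eval K gen u) = word_eval G id u" if "u \<in> words X" for u
    using map_word_eval[OF G idX valid that] .
  have "?p ` carrier K = H"
  proof -
    have "carrier K = word_eval K gen ` words X"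
      unfolding carrier_eq_generate using gen_closed by (intro K.generate_eq_word_eval)
    then have "?p ` carrier K = word_eval G id ` words X" using eval by (auto simp: image_image)
    then show ?thesis using G.generate_eq_word_eval[of X id, OF idX] H by (simp only: image_id id_apply)
  qed
  moreover have "inj_on ?p (carrier K)"
  proof (rule p.inj_on_one_iff[THEN iffD2], intro allI impI)
    fix A assume A: "A \<in> carrier K" "?p A = \<one>\<^bsub>G\<^esub>"
    then obtain u where u: "u \<in> words X" "A = word_eval K gen u" using carrierE_word by blast
    then have "pres_cong X R u []" using A eval inj by simp
    then show "A = \<one>\<^bsub>K\<^esub>" using word_eval_gen_eq_iff[of u "[]"] u by simp
  qed
  ultimately have "?p \<in> iso K (G\<lparr>carrier := H\<rparr>)"
    by (auto simp: iso_def bij_betw_def hom_def)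
  moreover have "\<forall>x\<in>X. ?p (gen x) = x" using map_gen[OF G idX valid] by simp
  moreover have "X \<subseteq> H" using H by (auto intro: generate.incl)
  ultimately show ?thesis using R unfolding has_presentation_def by auto
qed

lemma (in group_hom) word_eval_hom:
  assumes "u \<in> words X" "\<And>x. x \<in> X \<Longrightarrow> f x \<in> carrier G"
  shows "h (word_eval G f u) = word_eval H (\<lambda>x. h (f x)) u"
  using assms(1)
proof (induction rule: words_induct)
  case (Cons x e u)
  then show ?case using assms(2) G.word_eval_in_carrier[of X f u] by (cases e) simp_all
qed simp

lemma (in group_hom) image_generate_le:
  assumes "Y \<subseteq> carrier G" "subgroup S H" "\<And>y. y \<in> Y \<Longrightarrow> h y \<in> S" "x \<in> generate G Y"
  shows "h x \<in> S"
proof -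
  have "h ` Y \<subseteq> S" using assms(3) by blast
  then have "h ` generate G Y \<subseteq> S"
    using generate_img[OF assms(1)] H.generate_subgroup_incl[OF _ assms(2), of "h ` Y"] by simp
  then show ?thesis using assms(4) by blast
qed

lemma group_hom_comp: "group_hom G H h \<Longrightarrow> group_hom H J g \<Longrightarrow> group_hom G J (\<lambda>x. g (h x))"
  unfolding group_hom_def group_hom_axioms_def hom_def by (auto simp: Pi_iff)

text \<open>The opposite of \<open>conj_elt\<close>: coset representatives are inverses of positive
  braids, so conjugation in the convention of camomile type becomes \<open>conj_by\<close> with a
  positive braid.\<close>

definition conj_by :: "('a, 'c) monoid_scheme \<Rightarrow> 'a \<Rightarrow> 'a \<Rightarrow> 'a" where
  "conj_by G g x = g \<otimes>\<^bsub>G\<^esub> x \<otimes>\<^bsub>G\<^esub> inv\<^bsub>G\<^esub> g"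

context group
begin

lemma conj_by_closed [simp, intro]: "g \<in> carrier G \<Longrightarrow> x \<in> carrier G \<Longrightarrow> conj_by G g x \<in> carrier G"
  by (simp add: conj_by_def)

lemma conj_by_mult:
  "g \<in> carrier G \<Longrightarrow> h \<in> carrier G \<Longrightarrow> x \<in> carrier G \<Longrightarrow> conj_by G (g \<otimes> h) x = conj_by G g (conj_by G h x)"
  by (simp add: conj_by_def m_assoc inv_mult_group)

lemma conj_by_one [simp]: "x \<in> carrier G \<Longrightarrow> conj_by G \<one> x = x"
  by (simp add: conj_by_def)

lemma conj_by_eqI:
  "g \<in> carrier G \<Longrightarrow> x \<in> carrier G \<Longrightarrow> y \<in> carrier G \<Longrightarrow> g \<otimes> x = y \<otimes> g \<Longrightarrow> conj_by G g x = y"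
  by (simp add: conj_by_def m_assoc)

lemma conj_by_hom: "g \<in> carrier G \<Longrightarrow> group_hom G G (conj_by G g)"
proof -
  assume g: "g \<in> carrier G"
  have "conj_by G g (x \<otimes> y) = conj_by G g x \<otimes> conj_by G g y" if "x \<in> carrier G" "y \<in> carrier G" for x y
  proof -
    have "g \<otimes> x \<otimes> inv g \<otimes> (g \<otimes> y \<otimes> inv g) = g \<otimes> x \<otimes> (inv g \<otimes> g) \<otimes> y \<otimes> inv g"
      using g that by (simp only: m_assoc m_closed inv_closed)
    then show ?thesis using g that by (simp add: conj_by_def m_assoc)
  qed
  then show ?thesis
    using g by (auto simp: group_hom_def group_hom_axioms_def is_group hom_def)
qed

lemma conj_by_inv_cancel:
  "g \<in> carrier G \<Longrightarrow> x \<in> carrier G \<Longrightarrow> conj_by G g (conj_by G (inv g) x) = x"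
  "g \<in> carrier G \<Longrightarrow> x \<in> carrier G \<Longrightarrow> conj_by G (inv g) (conj_by G g x) = x"
  by (simp_all add: conj_by_mult[symmetric])

lemma conj_by_in_subgroup: "subgroup H G \<Longrightarrow> g \<in> H \<Longrightarrow> x \<in> H \<Longrightarrow> conj_by G g x \<in> H"
  unfolding conj_by_def by (simp add: subgroup.m_closed subgroup.m_inv_closed)

lemma conj_by_generate:
  assumes "g \<in> carrier G" "Y \<subseteq> carrier G"
  shows "conj_by G g ` generate G Y = generate G (conj_by G g ` Y)"
  using group_hom.generate_img[OF conj_by_hom[OF assms(1)] assms(2)] by simp

end

lemma (in group_hom) conj_by_map:
  "g \<in> carrier G \<Longrightarrow> x \<in> carrier G \<Longrightarrow> h (conj_by G g x) = conj_by H (h g) (h x)"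
  by (simp add: conj_by_def)

definition map_word :: "('a \<Rightarrow> 'b) \<Rightarrow> 'a word \<Rightarrow> 'b word" where
  "map_word f w = map (\<lambda>(x, e). (f x, e)) w"

lemma map_word_Nil [simp]: "map_word f [] = []"
  and map_word_Cons [simp]: "map_word f ((x, e) # w) = (f x, e) # map_word f w"
  by (simp_all add: map_word_def)

lemma map_word_words: "u \<in> words X \<Longrightarrow> (\<And>x. x \<in> X \<Longrightarrow> f x \<in> Y) \<Longrightarrow> map_word f u \<in> words Y"
  by (induction rule: words_induct) simp_all

lemma word_eval_map_word: "word_eval G g (map_word f u) = word_eval G (\<lambda>x. g (f x)) u"
  by (induction u) auto

lemma map_word_map_word: "u \<in> words X \<Longrightarrow> (\<And>x. x \<in> X \<Longrightarrow> g (f x) = x) \<Longrightarrow> map_word g (map_word f u) = u"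
  by (induction rule: words_induct) simp_all

lemma conj_word_eq: "conj_word G m = map_word (conj_elt G m)"
  by (simp add: fun_eq_iff conj_word_def map_word_def)

text \<open>Every element is taken as a generator and every true equation as a relation, so that
  conjugation carries this presentation of a subgroup to the same kind of presentation of its
  conjugate.\<close>

definition valid_rels :: "('a, 'c) monoid_scheme \<Rightarrow> 'a set \<Rightarrow> ('a word \<times> 'a word) set" where
  "valid_rels G H = {(u, v). u \<in> words H \<and> v \<in> words H \<and> word_eval G id u = word_eval G id v}"

context group
begin

lemma has_presentation_valid_rels:
  assumes H: "subgroup H G"
  shows "has_presentation (G\<lparr>carrier := H\<rparr>) H (valid_rels G H)"
proof (rule has_presentationI[OF is_group])
  show "H = generate G H"
    using generate_subgroup_incl[OF order.refl H] by (auto intro: generate.incl)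
  show "H \<subseteq> carrier G" by (rule subgroup.subset[OF H])
  fix u assume "u \<in> words H" "word_eval G id u = \<one>"
  then have "(u, []) \<in> valid_rels G H" by (simp add: valid_rels_def)
  then have "pres_cong H (valid_rels G H) ([] @ u @ []) ([] @ [] @ [])"
    by (intro pres_cong.rel) simp_all
  then show "pres_cong H (valid_rels G H) u []" by simp
qed (auto simp: valid_rels_def)

lemma conj_elt_eq: "m \<in> carrier G \<Longrightarrow> conj_elt G (inv m) x = conj_by G m x"
  by (simp add: conj_elt_def conj_by_def)

text \<open>Words over the conjugate pull back along the inverse conjugation. The conjugated
  relations therefore depend on the conjugate subgroup only, and representatives with the same petal
  contribute the same relations.\<close>

lemma conj_word_valid_rels:
  assumes m: "m \<in> carrier G" and H: "H \<subseteq> carrier G"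
  shows "(\<lambda>(u, v). (conj_word G (inv m) u, conj_word G (inv m) v)) ` valid_rels G H
    = valid_rels G (conj_by G m ` H)"
proof -
  let ?H = "conj_by G m ` H"
  have ce: "conj_word G (inv m) = map_word (conj_by G m)"
  proof -
    have "conj_elt G (inv m) = conj_by G m" by (rule ext) (rule conj_elt_eq[OF m])
    then show ?thesis by (simp only: conj_word_eq)
  qed
  have bk: "conj_by G (inv m) y \<in> H \<and> conj_by G m (conj_by G (inv m) y) = y" if "y \<in> ?H" for y
    using that conj_by_inv_cancel[OF m] H by (metis imageE subsetD)
  have ev: "word_eval G id (map_word (conj_by G g) u) = conj_by G g (word_eval G id u)"
    if "u \<in> words Y" "Y \<subseteq> carrier G" "g \<in> carrier G" for u g Y
    using group_hom.word_eval_hom[OF conj_by_hom[OF that(3)] that(1), of id] that(2)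
    by (simp add: word_eval_map_word subset_iff)
  have HC: "?H \<subseteq> carrier G" using m H by auto
  show ?thesis
  proof (intro equalityI subsetI)
    fix r assume "r \<in> (\<lambda>(u, v). (conj_word G (inv m) u, conj_word G (inv m) v)) ` valid_rels G H"
    then obtain u v where r: "r = (map_word (conj_by G m) u, map_word (conj_by G m) v)"
      and uv: "u \<in> words H" "v \<in> words H" "word_eval G id u = word_eval G id v"
      by (auto simp: ce valid_rels_def)
    have "map_word (conj_by G m) u \<in> words ?H" "map_word (conj_by G m) v \<in> words ?H"
      using uv by (auto intro: map_word_words)
    then show "r \<in> valid_rels G ?H"
      using ev[OF uv(1) H m] ev[OF uv(2) H m] uv(3) by (simp add: valid_rels_def r)
  next
    fix r assume "r \<in> valid_rels G ?H"
    then obtain u v where r: "r = (u, v)" and uv: "u \<in> words ?H" "v \<in> words ?H"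
      "word_eval G id u = word_eval G id v" by (auto simp: valid_rels_def)
    let ?u = "map_word (conj_by G (inv m)) u" and ?v = "map_word (conj_by G (inv m)) v"
    have w: "?u \<in> words H" "?v \<in> words H"
      using map_word_words[OF uv(1), of "conj_by G (inv m)" H] map_word_words[OF uv(2), of "conj_by G (inv m)" H] bk
      by blast+
    have "word_eval G id ?u = word_eval G id ?v"
      using ev[OF uv(1) HC inv_closed[OF m]] ev[OF uv(2) HC inv_closed[OF m]] uv(3) by simp
    then have "(?u, ?v) \<in> valid_rels G H" using w by (simp add: valid_rels_def)
    moreover have "map_word (conj_by G m) ?u = u" "map_word (conj_by G m) ?v = v"
      using map_word_map_word[OF uv(1)] map_word_map_word[OF uv(2)] bk by blast+
    ultimately show "r \<in> (\<lambda>(u, v). (conj_word G (inv m) u, conj_word G (inv m) v)) ` valid_rels G H"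
      unfolding r ce by (intro image_eqI[of _ _ "(?u, ?v)"]) simp_all
  qed
qed

end

section \<open>Reduced words of permutations\<close>

abbreviation adj :: "nat \<Rightarrow> nat \<Rightarrow> nat" where "adj i \<equiv> transpose i (i + 1)"

definition cycle_down :: "nat \<Rightarrow> nat \<Rightarrow> nat \<Rightarrow> nat" where
  "cycle_down l k x = (if x = l then k else if l < x \<and> x \<le> k then x - 1 else x)"

text \<open>The permutation of the ascending word \<open>[l..<k]\<close>, see
  \<open>list_perm_upt\<close>; \<open>cycle_down\<close> is its inverse.\<close>

definition cycle_up :: "nat \<Rightarrow> nat \<Rightarrow> nat \<Rightarrow> nat" where
  "cycle_up l k x = (if x = k then l else if l \<le> x \<and> x < k then x + 1 else x)"

lemma cycle_down_up [simp]: "l \<le> k \<Longrightarrow> cycle_down l k (cycle_up l k x) = x"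
  and cycle_up_down [simp]: "l \<le> k \<Longrightarrow> cycle_up l k (cycle_down l k x) = x"
  by (auto simp: cycle_down_def cycle_up_def)

lemma cycle_down_permutes: "1 \<le> l \<Longrightarrow> l \<le> k \<Longrightarrow> cycle_down l k permutes {1..k}"
  by (rule bij_imp_permutes, rule bij_betw_byWitness[where f' = "cycle_up l k"])
    (auto, auto simp: cycle_down_def cycle_up_def split: if_splits)

lemma cycle_up_permutes: "1 \<le> l \<Longrightarrow> l \<le> k \<Longrightarrow> cycle_up l k permutes {1..k}"
  by (rule bij_imp_permutes, rule bij_betw_byWitness[where f' = "cycle_down l k"])
    (auto, auto simp: cycle_down_def cycle_up_def split: if_splits)

lemma permutes_in: "w permutes {1..k} \<Longrightarrow> 1 \<le> i \<Longrightarrow> i \<le> k \<Longrightarrow> 1 \<le> w i \<and> w i \<le> k"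
  using permutes_in_image[of w "{1..k}" i] by simp

lemma cycle_down_comp_permutes:
  assumes "w permutes {1..Suc k}"
  shows "cycle_down (w (Suc k)) (Suc k) \<circ> w permutes {1..k}"
proof (rule permutes_superset)
  show "cycle_down (w (Suc k)) (Suc k) \<circ> w permutes {1..Suc k}"
    using permutes_in[OF assms, of "Suc k"] by (intro permutes_compose[OF assms] cycle_down_permutes) auto
  fix x assume "x \<in> {1..Suc k} - {1..k}"
  then have "x = Suc k" by auto
  then show "(cycle_down (w (Suc k)) (Suc k) \<circ> w) x = x" by (simp add: cycle_down_def)
qed

lemma cycle_up_comp_permutes:
  assumes "w permutes {1..k}" "1 \<le> l" "l \<le> Suc k"
  shows "cycle_up l (Suc k) \<circ> w permutes {1..Suc k}"
  using assms by (intro permutes_compose cycle_up_permutes permutes_subset[OF assms(1)]) auto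

lemma adj_permutes: "1 \<le> i \<Longrightarrow> i < n \<Longrightarrow> adj i permutes {1..n}"
  by (rule permutes_swap_id) auto

text \<open>
  A reduced word of the permutation \<open>w\<close> of \<open>{1..k}\<close>: moving \<open>k\<close> to its value \<open>w k\<close> contributes
  the letters \<open>w k, \<dots>, k - 1\<close>, and what remains is a permutation of \<open>{1..k-1}\<close>.
\<close>

fun red_word :: "nat \<Rightarrow> (nat \<Rightarrow> nat) \<Rightarrow> nat list" where
  "red_word 0 w = []"
| "red_word (Suc k) w = [w (Suc k)..<Suc k] @ red_word k (cycle_down (w (Suc k)) (Suc k) \<circ> w)"

lemma red_word_letters: "w permutes {1..k} \<Longrightarrow> set (red_word k w) \<subseteq> {1..<k}"
proof (induction k arbitrary: w)
  case (Suc k)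
  have "set (red_word k (cycle_down (w (Suc k)) (Suc k) \<circ> w)) \<subseteq> {1..<k}"
    by (rule Suc.IH[OF cycle_down_comp_permutes[OF Suc.prems]])
  moreover have "{1..<k} \<subseteq> {1..<Suc k}" by auto
  moreover have "set [w (Suc k)..<Suc k] \<subseteq> {1..<Suc k}"
    using permutes_in[OF Suc.prems, of "Suc k"] by auto
  ultimately show ?case unfolding red_word.simps set_append by blast
qed simp

lemma red_word_id [simp]: "red_word k id = []"
proof (induction k)
  case (Suc k)
  have "cycle_down (Suc k) (Suc k) \<circ> id = id" by (auto simp: cycle_down_def fun_eq_iff)
  then show ?case using Suc by simp
qed simp

lemma red_word_fixpoint: "red_word (Suc k) w = red_word k w" if "w (Suc k) = Suc k"
proof -
  have "cycle_down (Suc k) (Suc k) \<circ> w = w" by (auto simp: cycle_down_def fun_eq_iff)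
  then show ?thesis using that by simp
qed

text \<open>Trailing fixed points contribute empty runs. So the elements of \<open>sg_M n 4\<close>
  are representatives from \<open>sg_M n n\<close> word for word, and not only up to braid
  relations.\<close>

lemma red_word_restrict: "w permutes {1..m} \<Longrightarrow> m \<le> n \<Longrightarrow> red_word n w = red_word m w"
proof (induction n)
  case (Suc n)
  show ?case
  proof (cases "m = Suc n")
    case False
    then have "w (Suc n) = Suc n" using Suc.prems by (auto simp: permutes_def)
    then show ?thesis using Suc False red_word_fixpoint by simp
  qed simp
qed simp

lemma adj_adj [simp]: "w \<circ> adj i \<circ> adj i = w"
  by (simp add: fun_eq_iff)

lemma adj_adj_Suc [simp]: "w \<circ> transpose i (Suc i) \<circ> transpose i (Suc i) = w"
  by (simp add: fun_eq_iff)

lemma adj_image_same: "i \<in> S \<Longrightarrow> i + 1 \<in> S \<Longrightarrow> adj i ` S = S"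
  by (auto simp: transpose_def image_iff)

lemma adj_image_subset: "1 \<le> i \<Longrightarrow> i < n \<Longrightarrow> S \<subseteq> {1..n} \<Longrightarrow> adj i ` S \<subseteq> {1..n}"
  by (auto simp: transpose_def subset_iff)

lemma adj_image_card: "card (adj i ` S) = card S"
  by (rule card_image) (rule inj_on_subset[OF inj_transpose], simp)

lemma adj_commute: "i + 2 \<le> j \<Longrightarrow> w \<circ> adj j \<circ> adj i = w \<circ> adj i \<circ> adj j"
  by (rule ext) (simp add: transpose_def)

lemma adj_braid: "w \<circ> adj (i + 1) \<circ> adj i \<circ> adj (i + 1) = w \<circ> adj i \<circ> adj (i + 1) \<circ> adj i"
  by (rule ext) (simp add: transpose_def)

lemma permutes_Suc_cases:
  assumes "w permutes {1..Suc m}"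
  obtains l v where "v permutes {1..m}" "1 \<le> l" "l \<le> Suc m" "w = cycle_up l (Suc m) \<circ> v"
proof (rule that[of "cycle_down (w (Suc m)) (Suc m) \<circ> w" "w (Suc m)"])
  show "cycle_down (w (Suc m)) (Suc m) \<circ> w permutes {1..m}" by (rule cycle_down_comp_permutes[OF assms])
  show l: "1 \<le> w (Suc m)" "w (Suc m) \<le> Suc m" using permutes_in[OF assms, of "Suc m"] by simp_all
  show "w = cycle_up (w (Suc m)) (Suc m) \<circ> (cycle_down (w (Suc m)) (Suc m) \<circ> w)"
    using l by (simp add: fun_eq_iff)
qed

fun list_perm :: "nat list \<Rightarrow> nat \<Rightarrow> nat" where
  "list_perm [] = id"
| "list_perm (i # l) = adj i \<circ> list_perm l"

lemma list_perm_append: "list_perm (l @ l') = list_perm l \<circ> list_perm l'"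
  by (induction l) (simp_all add: comp_assoc)

lemma list_perm_upt: "l \<le> k \<Longrightarrow> list_perm [l..<k] = cycle_up l k"
proof (induction k)
  case 0
  then show ?case by (auto simp: cycle_up_def fun_eq_iff)
next
  case (Suc k)
  show ?case
  proof (cases "l = Suc k")
    case True
    then show ?thesis by (auto simp: cycle_up_def fun_eq_iff)
  next
    case False
    then have "list_perm [l..<Suc k] = cycle_up l k \<circ> adj k"
      using Suc by (simp add: list_perm_append)
    also have "\<dots> = cycle_up l (Suc k)"
      using Suc.prems False by (auto simp: cycle_up_def fun_eq_iff transpose_def)
    finally show ?thesis .
  qed
qed

lemma list_perm_red_word: "w permutes {1..k} \<Longrightarrow> list_perm (red_word k w) = w"
proof (induction k arbitrary: w)
  case 0
  then show ?case by simp
next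
  case (Suc k)
  let ?l = "w (Suc k)"
  have l: "?l \<le> Suc k" using permutes_in[OF Suc.prems, of "Suc k"] by simp
  have "list_perm (red_word (Suc k) w) = list_perm [?l..<Suc k] \<circ> list_perm (red_word k (cycle_down ?l (Suc k) \<circ> w))"
    by (simp only: red_word.simps list_perm_append)
  also have "\<dots> = cycle_up ?l (Suc k) \<circ> (cycle_down ?l (Suc k) \<circ> w)"
    by (simp only: list_perm_upt[OF l] Suc.IH[OF cycle_down_comp_permutes[OF Suc.prems]])
  also have "\<dots> = w" using l by (simp add: fun_eq_iff)
  finally show ?case .
qed

text \<open>Bijections of \<open>B\<close> onto \<open>C\<close> and of the complements are glued.
  This brings every four-element set within reach of \<open>{1..4}\<close>.\<close>

lemma ex_permutes_image:
  assumes "finite A" "B \<subseteq> A" "C \<subseteq> A" "card B = card C"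
  shows "\<exists>w. w permutes A \<and> w ` B = C"
proof -
  have fin: "finite B" "finite C" using assms finite_subset by blast+
  obtain f where f: "bij_betw f B C"
    using finite_same_card_bij[OF fin assms(4)] by blast
  have "card (A - B) = card (A - C)" using assms fin by (simp add: card_Diff_subset)
  then obtain g where g: "bij_betw g (A - B) (A - C)"
    using finite_same_card_bij[of "A - B" "A - C"] assms(1) by blast
  define w where "w x = (if x \<in> B then f x else if x \<in> A then g x else x)" for x
  have wB: "bij_betw w B C" using f by (subst bij_betw_cong[of B w f]) (simp_all add: w_def)
  moreover have "bij_betw w (A - B) (A - C)"
    using g by (subst bij_betw_cong[of "A - B" w g]) (simp_all add: w_def)
  ultimately have "bij_betw w (B \<union> (A - B)) (C \<union> (A - C))" by (rule bij_betw_combine) blast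
  moreover have "B \<union> (A - B) = A" "C \<union> (A - C) = A" using assms by blast+
  ultimately have "bij_betw w A A" by simp
  then have "w permutes A" by (rule bij_imp_permutes) (use assms(2) in \<open>auto simp: w_def\<close>)
  then show ?thesis using wB by (auto simp: bij_betw_def)
qed

section \<open>Reduced words evaluated in a monoid with braid relations\<close>

locale braid_monoid = monoid M for M (structure) +
  fixes n :: nat and s :: "nat \<Rightarrow> 'a"
  assumes s_closed: "1 \<le> i \<Longrightarrow> i < n \<Longrightarrow> s i \<in> carrier M"
    and braid: "1 \<le> i \<Longrightarrow> i + 2 \<le> n \<Longrightarrow> s i \<otimes> s (i + 1) \<otimes> s i = s (i + 1) \<otimes> s i \<otimes> s (i + 1)"
    and far: "1 \<le> i \<Longrightarrow> i + 2 \<le> j \<Longrightarrow> j < n \<Longrightarrow> s i \<otimes> s j = s j \<otimes> s i"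
begin

definition ev :: "nat list \<Rightarrow> 'a" where
  "ev l = foldr (\<lambda>i y. s i \<otimes> y) l \<one>"

lemma ev_Nil [simp]: "ev [] = \<one>" and ev_Cons [simp]: "ev (i # l) = s i \<otimes> ev l"
  by (simp_all add: ev_def)

lemma ev_closed: "set l \<subseteq> {1..<n} \<Longrightarrow> ev l \<in> carrier M"
  by (induction l) (auto intro!: s_closed m_closed)

lemma ev_append: "set l \<subseteq> {1..<n} \<Longrightarrow> set l' \<subseteq> {1..<n} \<Longrightarrow> ev (l @ l') = ev l \<otimes> ev l'"
  by (induction l) (auto simp: ev_closed s_closed m_assoc)

lemma ev_far:
  "set l \<subseteq> {1..<i - 1} \<Longrightarrow> 1 \<le> i \<Longrightarrow> i < n \<Longrightarrow> ev l \<otimes> s i = s i \<otimes> ev l"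
proof (induction l)
  case (Cons j l)
  have cl: "ev l \<in> carrier M" "s j \<in> carrier M" "s i \<in> carrier M"
    using Cons.prems by (auto intro!: ev_closed s_closed dest!: subsetD)
  have "s j \<otimes> ev l \<otimes> s i = s j \<otimes> s i \<otimes> ev l"
    using Cons cl by (simp add: m_assoc)
  also have "s j \<otimes> s i = s i \<otimes> s j" using Cons.prems by (intro far) auto
  finally show ?case using cl by (simp add: m_assoc)
qed (use s_closed in simp)

text \<open>The letter \<open>i\<close> moves left: it passes the letters above \<open>i + 1\<close>
  by commutation, becomes \<open>i + 1\<close> in a braid relation, and passes the letters below
  \<open>i\<close> again by commutation.\<close>

lemma ev_shift:
  "1 \<le> l \<Longrightarrow> l \<le> i \<Longrightarrow> i + 1 < k \<Longrightarrow> k \<le> n \<Longrightarrow> ev [l..<k] \<otimes> s i = s (i + 1) \<otimes> ev [l..<k]"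
proof (induction k)
  case (Suc k)
  have cl: "ev [l..<j] \<in> carrier M" if "j \<le> n" for j using Suc.prems that by (intro ev_closed) auto
  have sc: "s k \<in> carrier M" "s i \<in> carrier M" "s (i + 1) \<in> carrier M"
    using Suc.prems by (auto intro!: s_closed)
  have snoc: "ev [l..<Suc j] = ev [l..<j] \<otimes> s j" if "l \<le> j" "j < n" for j
  proof -
    have "ev ([l..<j] @ [j]) = ev [l..<j] \<otimes> ev [j]"
      using Suc.prems that by (intro ev_append) auto
    then show ?thesis using that Suc.prems by (simp add: s_closed)
  qed
  show ?case
  proof (cases "i + 1 < k")
    case True
    have "ev [l..<Suc k] \<otimes> s i = ev [l..<k] \<otimes> (s k \<otimes> s i)"
      using Suc.prems sc cl[of k] by (simp add: snoc m_assoc del: upt_Suc)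
    also have "s k \<otimes> s i = s i \<otimes> s k" using Suc.prems True by (intro far[symmetric]) auto
    also have "ev [l..<k] \<otimes> (s i \<otimes> s k) = (ev [l..<k] \<otimes> s i) \<otimes> s k"
      using Suc.prems sc cl[of k] by (simp add: m_assoc)
    also have "\<dots> = s (i + 1) \<otimes> (ev [l..<k] \<otimes> s k)"
      using Suc True sc cl[of k] by (simp add: m_assoc)
    finally show ?thesis using Suc.prems by (simp add: snoc del: upt_Suc)
  next
    case False
    then have k: "k = i + 1" using Suc.prems by simp
    have e: "ev [l..<Suc k] = ev [l..<i] \<otimes> (s i \<otimes> s k)"
      using Suc.prems sc cl[of i] k by (simp add: snoc m_assoc del: upt_Suc)
    have "ev [l..<Suc k] \<otimes> s i = ev [l..<i] \<otimes> (s i \<otimes> s (i + 1) \<otimes> s i)"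
      unfolding e using Suc.prems sc cl[of i] k by (simp add: m_assoc)
    also have "s i \<otimes> s (i + 1) \<otimes> s i = s (i + 1) \<otimes> s i \<otimes> s (i + 1)"
      using Suc.prems k by (intro braid) auto
    also have "ev [l..<i] \<otimes> (s (i + 1) \<otimes> s i \<otimes> s (i + 1)) = (ev [l..<i] \<otimes> s (i + 1)) \<otimes> (s i \<otimes> s (i + 1))"
      using Suc.prems sc cl[of i] by (simp add: m_assoc)
    also have "ev [l..<i] \<otimes> s (i + 1) = s (i + 1) \<otimes> ev [l..<i]"
      using Suc.prems k by (intro ev_far) auto
    finally show ?thesis unfolding e using Suc.prems sc cl[of i] k by (simp add: m_assoc)
  qed
qed simp

text \<open>Two ascending runs are exchanged one letter at a time; \<open>ev_red_word_adj\<close>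
  requires this when the last two values of a permutation are interchanged.\<close>

lemma ev_shift_list:
  "1 \<le> l \<Longrightarrow> l \<le> i \<Longrightarrow> j < k \<Longrightarrow> k \<le> n \<Longrightarrow>
    ev [l..<k] \<otimes> ev [i..<j] = ev [Suc i..<Suc j] \<otimes> ev [l..<k]"
proof (induction "j - i" arbitrary: i)
  case 0
  then have "ev [l..<k] \<in> carrier M" by (intro ev_closed) auto
  then show ?case using 0 by simp
next
  case (Suc d)
  have cl: "ev [l..<k] \<in> carrier M" "ev [Suc i..<j] \<in> carrier M" "ev [Suc (Suc i)..<Suc j] \<in> carrier M"
    "s i \<in> carrier M" "s (Suc i) \<in> carrier M"
    using Suc.prems Suc.hyps by (auto intro!: ev_closed s_closed)
  have ij: "i < j" using Suc by simp
  have "ev [l..<k] \<otimes> ev [i..<j] = (ev [l..<k] \<otimes> s i) \<otimes> ev [Suc i..<j]"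
    using cl ij by (simp add: upt_conv_Cons m_assoc)
  also have "ev [l..<k] \<otimes> s i = s (Suc i) \<otimes> ev [l..<k]"
    using ev_shift[of l i k] Suc.prems ij by simp
  also have "s (Suc i) \<otimes> ev [l..<k] \<otimes> ev [Suc i..<j] = s (Suc i) \<otimes> (ev [Suc (Suc i)..<Suc j] \<otimes> ev [l..<k])"
    using Suc.hyps(1)[of "Suc i"] Suc.hyps(2) Suc.prems cl by (simp add: m_assoc del: upt_Suc)
  also have "\<dots> = (s (Suc i) \<otimes> ev [Suc (Suc i)..<Suc j]) \<otimes> ev [l..<k]"
    using cl by (simp add: m_assoc del: upt_Suc)
  also have "s (Suc i) \<otimes> ev [Suc (Suc i)..<Suc j] = ev [Suc i..<Suc j]"
    using ij by (simp add: upt_conv_Cons del: upt_Suc)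
  finally show ?case .
qed

text \<open>The condition \<open>w i < w (i + 1)\<close> means that \<open>adj i\<close> lengthens
  \<open>w\<close>. If \<open>i\<close> is not the last letter, the first run is unaffected and the
  claim passes to a smaller permutation; if it is, the first two runs of the word have to be
  exchanged.\<close>

lemma ev_red_word_adj:
  "w permutes {1..k} \<Longrightarrow> k \<le> n \<Longrightarrow> 1 \<le> i \<Longrightarrow> i < k \<Longrightarrow> w i < w (i + 1) \<Longrightarrow>
    ev (red_word k (w \<circ> adj i)) = ev (red_word k w) \<otimes> s i"
proof (induction k arbitrary: w)
  case (Suc k)
  let ?l = "w (Suc k)" and ?w = "cycle_down (w (Suc k)) (Suc k) \<circ> w"
  have l: "1 \<le> ?l" "?l \<le> Suc k" using permutes_in[OF Suc.prems(1)] by auto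
  have w': "?w permutes {1..k}" by (rule cycle_down_comp_permutes[OF Suc.prems(1)])
  have inj: "w x = w y \<longleftrightarrow> x = y" for x y
    using permutes_inj[OF Suc.prems(1)] by (auto dest: injD)
  have si: "s i \<in> carrier M" using Suc.prems by (intro s_closed) auto
  have red_word_perm_letters: "set (red_word k v) \<subseteq> {1..<n}" if "v permutes {1..k}" for v
    using red_word_letters[OF that] Suc.prems by auto
  show ?case
  proof (cases "i < k")
    case True
    have eq: "(w \<circ> adj i) (Suc k) = ?l" using True by (auto simp: transpose_def)
    \<comment> \<open>Removing a third value does not change the order of the other two.\<close>
    have "?w i < ?w (i + 1)"
      using Suc.prems(5) True inj[of i "Suc k"] inj[of "i + 1" "Suc k"] permutes_in[OF Suc.prems(1), of i]
        permutes_in[OF Suc.prems(1), of "i + 1"] Suc.prems(3) l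
      by (auto simp: cycle_down_def)
    then have IH: "ev (red_word k (?w \<circ> adj i)) = ev (red_word k ?w) \<otimes> s i"
      using Suc.IH[OF w' _ Suc.prems(3) True] Suc.prems(2) by (meson Suc_leD)
    have p: "?w \<circ> adj i permutes {1..k}"
      using Suc.prems True by (intro permutes_compose[OF adj_permutes w']) auto
    have "ev (red_word (Suc k) (w \<circ> adj i)) = ev [?l..<Suc k] \<otimes> ev (red_word k (?w \<circ> adj i))"
      using red_word_perm_letters[OF p] l Suc.prems ev_append[of "[?l..<Suc k]" "red_word k (?w \<circ> adj i)"] eq
      by (simp add: comp_assoc del: upt_Suc)
    also have "\<dots> = ev [?l..<Suc k] \<otimes> ev (red_word k ?w) \<otimes> s i"
      unfolding IH using red_word_perm_letters[OF w'] l Suc.prems si by (simp add: m_assoc ev_closed del: upt_Suc)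
    also have "ev [?l..<Suc k] \<otimes> ev (red_word k ?w) = ev (red_word (Suc k) w)"
      using red_word_perm_letters[OF w'] l Suc.prems by (simp add: ev_append del: upt_Suc)
    finally show ?thesis .
  next
    case False
    then have i: "i = k" using Suc.prems by simp
    then obtain k' where k': "k = Suc k'" using Suc.prems(3) by (cases k) auto
    let ?j = "w k" and ?v = "w \<circ> adj i"
    have j: "1 \<le> ?j" "?j < ?l" using Suc.prems i permutes_in[OF Suc.prems(1), of k] by auto
    have v: "?v (Suc k) = ?j" "?v k = ?l" using i by auto
    \<comment> \<open>Once the smaller value \<open>?j\<close> is removed, \<open>?l\<close> has
      dropped to \<open>?l - 1\<close>. Removing the two values in either order leaves the same
      permutation.\<close>
    let ?u = "cycle_down ?j k \<circ> ?w" and ?u' = "cycle_down (?l - 1) k \<circ> (cycle_down ?j (Suc k) \<circ> ?v)"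
    have wk: "?w k = ?j" using j l by (auto simp: cycle_down_def)
    have vk: "(cycle_down ?j (Suc k) \<circ> ?v) k = ?l - 1" using j l v by (auto simp: cycle_down_def)
    have uu: "?u = ?u'"
    proof
      fix x
      consider "x = k" | "x = Suc k" | "x \<noteq> k" "x \<noteq> Suc k" by blast
      then show "?u x = ?u' x"
      proof cases
        case 3
        then have "?v x = w x" using i by (simp add: transpose_def)
        moreover have "w x \<noteq> ?j" "w x \<noteq> ?l" using 3 inj by auto
        ultimately show ?thesis using j l by (auto simp: cycle_down_def)
      qed (use i j l v in \<open>auto simp: cycle_down_def\<close>)
    qed
    have up: "?u permutes {1..k'}"
      using cycle_down_comp_permutes[of ?w k'] w' wk k' by simp
    have ul: "set (red_word k' ?u) \<subseteq> {1..<n}" "set (red_word k' ?u) \<subseteq> {1..<k - 1}"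
      using red_word_letters[OF up] k' Suc.prems by auto
    have cl: "ev [?l..<Suc k] \<in> carrier M" "ev [?j..<k] \<in> carrier M" "ev [?j..<Suc k] \<in> carrier M"
      "ev [?l - 1..<k] \<in> carrier M" "s k \<in> carrier M"
      using j l Suc.prems i by (auto intro!: ev_closed s_closed simp del: upt_Suc)
    have clu: "ev (red_word k' ?u) \<in> carrier M" by (rule ev_closed[OF ul(1)])
    note cl = cl clu
    have 1: "red_word k ?w = [?j..<k] @ red_word k' ?u"
      using wk k' by (simp del: upt_Suc)
    have 2: "red_word k (cycle_down ?j (Suc k) \<circ> ?v) = [?l - 1..<k] @ red_word k' ?u"
      unfolding uu using vk k' by (simp del: upt_Suc)
    have "ev (red_word (Suc k) ?v) = ev [?j..<Suc k] \<otimes> (ev [?l - 1..<k] \<otimes> ev (red_word k' ?u))"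
    proof -
      have "red_word (Suc k) ?v = [?j..<Suc k] @ [?l - 1..<k] @ red_word k' ?u"
        using v 2 by (simp del: upt_Suc)
      moreover have "set [?j..<Suc k] \<subseteq> {1..<n}" "set [?l - 1..<k] \<subseteq> {1..<n}"
        using j l Suc.prems(2) by auto
      ultimately show ?thesis using ul(1) by (simp only: ev_append set_append Un_subset_iff simp_thms)
    qed
    also have "\<dots> = (ev [?j..<Suc k] \<otimes> ev [?l - 1..<k]) \<otimes> ev (red_word k' ?u)"
      using cl by (simp add: m_assoc del: upt_Suc)
    \<comment> \<open>After this exchange the second run ends in \<open>k\<close>, which is split
      off and moved to the right past letters that are all below \<open>k - 1\<close>.\<close>
    also have "ev [?j..<Suc k] \<otimes> ev [?l - 1..<k] = ev [Suc (?l - 1)..<Suc k] \<otimes> ev [?j..<Suc k]"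
      using j l Suc.prems by (intro ev_shift_list) auto
    also have "Suc (?l - 1) = ?l" using l by simp
    also have "ev [?j..<Suc k] = ev [?j..<k] \<otimes> s k"
      using j l Suc.prems ev_append[of "[?j..<k]" "[k]"] cl by simp
    also have "ev [?l..<Suc k] \<otimes> (ev [?j..<k] \<otimes> s k) \<otimes> ev (red_word k' ?u)
        = ev [?l..<Suc k] \<otimes> ev [?j..<k] \<otimes> (s k \<otimes> ev (red_word k' ?u))"
      using cl by (simp add: m_assoc del: upt_Suc)
    also have "s k \<otimes> ev (red_word k' ?u) = ev (red_word k' ?u) \<otimes> s k"
      using ev_far[OF ul(2)] Suc.prems by simp
    also have "ev [?l..<Suc k] \<otimes> ev [?j..<k] \<otimes> (ev (red_word k' ?u) \<otimes> s k)
        = ev [?l..<Suc k] \<otimes> (ev [?j..<k] \<otimes> ev (red_word k' ?u)) \<otimes> s k"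
      using cl by (simp add: m_assoc del: upt_Suc)
    also have "ev [?l..<Suc k] \<otimes> (ev [?j..<k] \<otimes> ev (red_word k' ?u)) = ev (red_word (Suc k) w)"
      using 1 j l ul Suc.prems by (simp add: ev_append del: upt_Suc)
    finally show ?thesis using i by simp
  qed
qed simp

end

lemma card_insert4_le: "card {a, b, c, d} \<le> 4"
  by (simp add: card_insert_if)

lemma three_orders:
  fixes x y z :: nat
  assumes "x \<noteq> y" "x \<noteq> z" "y \<noteq> z"
  shows "x < y \<and> y < z \<or> y < x \<and> x < z \<or> x < z \<and> z < y \<or> y < z \<and> z < x \<or> z < x \<and> x < y \<or> z < y \<and> y < x"
  using assms by (cases "x < y"; cases "y < z"; cases "x < z"; simp)

lemma image_eq_of_correspondence:
  assumes "\<And>a. a \<in> A \<Longrightarrow> \<exists>b\<in>B. f a = g b" "\<And>b. b \<in> B \<Longrightarrow> \<exists>a\<in>A. f a = g b"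
  shows "f ` A = g ` B"
proof (intro equalityI subsetI)
  fix y assume "y \<in> f ` A"
  then show "y \<in> g ` B" using assms(1) by fastforce
next
  fix y assume "y \<in> g ` B"
  then obtain b where "b \<in> B" "y = g b" by blast
  then show "y \<in> f ` A" using assms(2)[of b] by (metis imageI)
qed

section \<open>Conjugates of the generators of the singular pure braid group\<close>

text \<open>The Boolean tells an \<open>a\<close> from a \<open>b\<close>. Both families obey the
  same conjugation rules, which are proved once for both.\<close>

type_synonym label = "bool \<times> nat \<times> nat"

definition labels :: "nat set \<Rightarrow> label set" where
  "labels S = {(e, i, j). i \<in> S \<and> j \<in> S \<and> i < j}"

text \<open>The pair \<open>i\<close>, \<open>i + 1\<close> is left alone, since
  \<open>adj i\<close> would make it decreasing; on its generators conjugation by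
  \<open>sigma n i\<close> is trivial.\<close>

fun lab_swap :: "nat \<Rightarrow> label \<Rightarrow> label" where
  "lab_swap i (e, j, k) = (if j = i \<and> k = i + 1 then (e, j, k) else (e, adj i j, adj i k))"

fun lab :: "nat \<Rightarrow> label \<Rightarrow> sgen word set" where
  "lab n (e, i, j) = (if e then sp_a n i j else sp_b n i j)"

lemma labels_mono: "S \<subseteq> T \<Longrightarrow> labels S \<subseteq> labels T"
  by (auto simp: labels_def)

fun sgen_index :: "sgen \<Rightarrow> nat" where
  "sgen_index (Sigma i) = i" | "sgen_index (Tau i) = i"

locale singular_braid =
  fixes n :: nat
  assumes n: "4 \<le> n"
begin

abbreviation "G \<equiv> SG n"
abbreviation "selt \<equiv> gen_class (sg_gens n) (sg_rels n)"
abbreviation "cj \<equiv> conj_by G"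

sublocale G: group G by (rule group_SG)

sublocale sg: presentation "sg_gens n" "sg_rels n"
  by unfold_locales (rule sg_rels_words)

lemma rel_holds: "(u, v) \<in> sg_rels n \<Longrightarrow> word_eval G selt u = word_eval G selt v"
proof -
  assume uv: "(u, v) \<in> sg_rels n"
  then have "pres_cong (sg_gens n) (sg_rels n) ([] @ u @ []) ([] @ v @ [])"
    by (intro pres_cong.rel) auto
  then show ?thesis using uv sg_rels_words[of n] sg.word_eval_gen_eq_iff[of u v] by (auto simp: SG_def)
qed

lemma sigma_closed [simp]: "1 \<le> i \<Longrightarrow> i < n \<Longrightarrow> sigma n i \<in> carrier G"
  and tau_closed [simp]: "1 \<le> i \<Longrightarrow> i < n \<Longrightarrow> tau n i \<in> carrier G"
  using sg.gen_closed by (auto simp: sigma_def tau_def sg_gens_def SG_def)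

lemma sigma_closed_less [simp]: "i < n \<Longrightarrow> 0 < i \<Longrightarrow> sigma n i \<in> carrier G"
  and tau_closed_less [simp]: "i < n \<Longrightarrow> 0 < i \<Longrightarrow> tau n i \<in> carrier G"
  by simp_all

definition xelt :: "bool \<Rightarrow> nat \<Rightarrow> sgen word set" where
  "xelt e i = (if e then sigma n i else tau n i)"

definition bas :: "bool \<Rightarrow> nat \<Rightarrow> sgen word set" where
  "bas e i = xelt e i \<otimes>\<^bsub>G\<^esub> sigma n i"

lemma xelt_closed: "1 \<le> i \<Longrightarrow> i < n \<Longrightarrow> xelt e i \<in> carrier G"
  by (simp add: xelt_def)

lemma bas_closed: "1 \<le> i \<Longrightarrow> i < n \<Longrightarrow> bas e i \<in> carrier G"
  by (simp add: bas_def xelt_closed)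

section \<open>Defining relations, and conjugation of the generators with adjacent strands\<close>

lemma sigma_braid:
  assumes "1 \<le> i" "i + 2 \<le> n"
  shows "sigma n i \<otimes>\<^bsub>G\<^esub> sigma n (i + 1) \<otimes>\<^bsub>G\<^esub> sigma n i = sigma n (i + 1) \<otimes>\<^bsub>G\<^esub> sigma n i \<otimes>\<^bsub>G\<^esub> sigma n (i + 1)"
proof -
  have "([s_ltr i, s_ltr (i+1), s_ltr i], [s_ltr (i+1), s_ltr i, s_ltr (i+1)]) \<in> sg_rels n"
    using assms by (auto simp: sg_rels_def)
  from rel_holds[OF this] show ?thesis
    using assms by (simp add: G.m_assoc sigma_def[symmetric])
qed

lemma xelt_far:
  assumes "1 \<le> i" "1 \<le> j" "i < n" "j < n" "i + 2 \<le> j \<or> j + 2 \<le> i"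
  shows "xelt e i \<otimes>\<^bsub>G\<^esub> sigma n j = sigma n j \<otimes>\<^bsub>G\<^esub> xelt e i"
proof -
  have "([s_ltr i, s_ltr j], [s_ltr j, s_ltr i]) \<in> sg_rels n" "([t_ltr i, s_ltr j], [s_ltr j, t_ltr i]) \<in> sg_rels n"
    using assms by (auto simp: sg_rels_def)
  from this[THEN rel_holds] show ?thesis
    using assms by (simp add: xelt_def sigma_def[symmetric] tau_def[symmetric])
qed

lemma sigma_far:
  assumes "1 \<le> i" "1 \<le> j" "i < n" "j < n" "i + 2 \<le> j \<or> j + 2 \<le> i"
  shows "sigma n i \<otimes>\<^bsub>G\<^esub> sigma n j = sigma n j \<otimes>\<^bsub>G\<^esub> sigma n i"
  using xelt_far[OF assms, of True] by (simp add: xelt_def)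

lemma xelt_sigma:
  assumes "1 \<le> i" "i < n"
  shows "xelt e i \<otimes>\<^bsub>G\<^esub> sigma n i = sigma n i \<otimes>\<^bsub>G\<^esub> xelt e i"
proof -
  have "([t_ltr i, s_ltr i], [s_ltr i, t_ltr i]) \<in> sg_rels n"
    using assms by (auto simp: sg_rels_def)
  from rel_holds[OF this] show ?thesis
    using assms by (simp add: xelt_def sigma_def[symmetric] tau_def[symmetric])
qed

lemma xelt_braid:
  assumes "1 \<le> i" "i + 2 \<le> n"
  shows "sigma n i \<otimes>\<^bsub>G\<^esub> sigma n (i + 1) \<otimes>\<^bsub>G\<^esub> xelt e i = xelt e (i + 1) \<otimes>\<^bsub>G\<^esub> sigma n i \<otimes>\<^bsub>G\<^esub> sigma n (i + 1)"
proof -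
  have "([s_ltr i, s_ltr (i+1), t_ltr i], [t_ltr (i+1), s_ltr i, s_ltr (i+1)]) \<in> sg_rels n"
    using assms by (auto simp: sg_rels_def)
  from rel_holds[OF this] show ?thesis
    using assms sigma_braid[OF assms] by (auto simp add: G.m_assoc xelt_def sigma_def[symmetric] tau_def[symmetric])
qed

sublocale B: braid_monoid G n "sigma n"
proof unfold_locales
  show "sigma n i \<in> carrier G" if "1 \<le> i" "i < n" for i using that by (rule sigma_closed)
  show "sigma n i \<otimes>\<^bsub>G\<^esub> sigma n (i + 1) \<otimes>\<^bsub>G\<^esub> sigma n i = sigma n (i + 1) \<otimes>\<^bsub>G\<^esub> sigma n i \<otimes>\<^bsub>G\<^esub> sigma n (i + 1)"
    if "1 \<le> i" "i + 2 \<le> n" for i using that by (rule sigma_braid)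
  show "sigma n i \<otimes>\<^bsub>G\<^esub> sigma n j = sigma n j \<otimes>\<^bsub>G\<^esub> sigma n i" if "1 \<le> i" "i + 2 \<le> j" "j < n" for i j
    using that by (intro sigma_far) auto
qed

lemma bas_sigma: "1 \<le> i \<Longrightarrow> i < n \<Longrightarrow> cj (sigma n i) (bas e i) = bas e i"
  unfolding bas_def
  by (rule G.conj_by_eqI) (auto simp: xelt_closed xelt_sigma G.m_assoc)

lemma bas_far:
  assumes "1 \<le> i" "1 \<le> j" "i < n" "j < n" "i + 2 \<le> j \<or> j + 2 \<le> i"
  shows "cj (sigma n j) (bas e i) = bas e i"
proof (rule G.conj_by_eqI)
  have cl: "sigma n i \<in> carrier G" "sigma n j \<in> carrier G" "xelt e i \<in> carrier G"
    using assms by (auto intro!: xelt_closed)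
  have "bas e i \<otimes>\<^bsub>G\<^esub> sigma n j = xelt e i \<otimes>\<^bsub>G\<^esub> (sigma n i \<otimes>\<^bsub>G\<^esub> sigma n j)"
    unfolding bas_def using cl by (simp add: G.m_assoc)
  also have "\<dots> = xelt e i \<otimes>\<^bsub>G\<^esub> sigma n j \<otimes>\<^bsub>G\<^esub> sigma n i"
    using cl by (simp add: sigma_far[OF assms] G.m_assoc)
  also have "\<dots> = sigma n j \<otimes>\<^bsub>G\<^esub> bas e i"
    unfolding bas_def using cl by (simp add: xelt_far[OF assms] G.m_assoc)
  finally show "sigma n j \<otimes>\<^bsub>G\<^esub> bas e i = bas e i \<otimes>\<^bsub>G\<^esub> sigma n j" ..
qed (use assms bas_closed in auto)

lemma bas_braid:
  assumes "1 \<le> i" "i + 2 \<le> n"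
  shows "cj (sigma n i) (cj (sigma n (i + 1)) (bas e i)) = bas e (i + 1)"
proof -
  have cl: "sigma n i \<in> carrier G" "sigma n (i + 1) \<in> carrier G" "xelt e i \<in> carrier G" "xelt e (i + 1) \<in> carrier G"
    using assms by (auto intro!: xelt_closed)
  have "sigma n i \<otimes>\<^bsub>G\<^esub> sigma n (i + 1) \<otimes>\<^bsub>G\<^esub> bas e i = sigma n i \<otimes>\<^bsub>G\<^esub> sigma n (i + 1) \<otimes>\<^bsub>G\<^esub> xelt e i \<otimes>\<^bsub>G\<^esub> sigma n i"
    unfolding bas_def using cl by (simp add: G.m_assoc)
  also have "\<dots> = xelt e (i + 1) \<otimes>\<^bsub>G\<^esub> (sigma n i \<otimes>\<^bsub>G\<^esub> sigma n (i + 1) \<otimes>\<^bsub>G\<^esub> sigma n i)"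
    unfolding xelt_braid[OF assms] using cl by (simp add: G.m_assoc)
  also have "\<dots> = bas e (i + 1) \<otimes>\<^bsub>G\<^esub> (sigma n i \<otimes>\<^bsub>G\<^esub> sigma n (i + 1))"
    unfolding sigma_braid[OF assms] bas_def using cl by (simp add: G.m_assoc)
  finally have "cj (sigma n i \<otimes>\<^bsub>G\<^esub> sigma n (i + 1)) (bas e i) = bas e (i + 1)"
    using assms by (intro G.conj_by_eqI) (auto intro!: bas_closed)
  then show ?thesis using assms by (simp add: G.conj_by_mult bas_closed)
qed

lemma cj_far:
  assumes "1 \<le> i" "1 \<le> j" "i < n" "j < n" "i + 2 \<le> j \<or> j + 2 \<le> i" "x \<in> carrier G"
  shows "cj (sigma n i) (cj (sigma n j) x) = cj (sigma n j) (cj (sigma n i) x)"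
  using sigma_far[OF assms(1-5)] assms by (simp add: G.conj_by_mult[symmetric])

lemma cj_braid:
  assumes "1 \<le> i" "i + 2 \<le> n" "x \<in> carrier G"
  shows "cj (sigma n i) (cj (sigma n (i + 1)) (cj (sigma n i) x)) =
    cj (sigma n (i + 1)) (cj (sigma n i) (cj (sigma n (i + 1)) x))"
proof -
  have "cj (sigma n i \<otimes>\<^bsub>G\<^esub> sigma n (i + 1) \<otimes>\<^bsub>G\<^esub> sigma n i) x = cj (sigma n (i + 1) \<otimes>\<^bsub>G\<^esub> sigma n i \<otimes>\<^bsub>G\<^esub> sigma n (i + 1)) x"
    by (simp only: sigma_braid[OF assms(1,2)])
  then show ?thesis using assms by (simp add: G.conj_by_mult)
qed

section \<open>Conjugates of all \<open>a\<close> and \<open>b\<close> by the braid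
  generators\<close>

lemma list_mult_closed: "set xs \<subseteq> carrier G \<Longrightarrow> list_mult G xs \<in> carrier G"
  by (induction xs) (auto simp: list_mult_def)

lemma desc_sigma_closed: "1 \<le> i \<Longrightarrow> j \<le> n \<Longrightarrow> desc_sigma n i j \<in> carrier G"
  unfolding desc_sigma_def by (rule list_mult_closed) auto

lemma desc_sigma_base: "desc_sigma n i (Suc i) = \<one>\<^bsub>G\<^esub>"
  by (simp add: desc_sigma_def list_mult_def)

lemma desc_sigma_Suc: "i < j \<Longrightarrow> desc_sigma n i (Suc j) = sigma n j \<otimes>\<^bsub>G\<^esub> desc_sigma n i j"
  by (simp add: desc_sigma_def list_mult_def)

lemma lab_eq: "lab n (e, i, j) = cj (desc_sigma n i j) (bas e i)"
  by (simp add: conj_by_def sp_a_def sp_b_def bas_def xelt_def)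

lemma lab_base: "1 \<le> i \<Longrightarrow> i < n \<Longrightarrow> lab n (e, i, Suc i) = bas e i"
  by (simp add: lab_eq desc_sigma_base bas_closed del: lab.simps)

lemma lab_closed: "1 \<le> i \<Longrightarrow> i < j \<Longrightarrow> j \<le> n \<Longrightarrow> lab n (e, i, j) \<in> carrier G"
  unfolding lab_eq by (auto intro!: desc_sigma_closed bas_closed)

lemma lab_Suc: "1 \<le> i \<Longrightarrow> i < j \<Longrightarrow> j < n \<Longrightarrow> lab n (e, i, Suc j) = cj (sigma n j) (lab n (e, i, j))"
  unfolding lab_eq desc_sigma_Suc by (simp add: G.conj_by_mult desc_sigma_closed bas_closed)

lemma lab_closed_labels: "y \<in> labels S \<Longrightarrow> S \<subseteq> {1..n} \<Longrightarrow> lab n y \<in> carrier G"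
proof (cases y)
  case (fields e i j)
  then show "y \<in> labels S \<Longrightarrow> S \<subseteq> {1..n} \<Longrightarrow> lab n y \<in> carrier G"
    using lab_closed[of i j e] by (auto simp: labels_def subset_iff simp del: lab.simps)
qed

lemma cj_lab_above:
  "1 \<le> j \<Longrightarrow> j < k \<Longrightarrow> k < i \<Longrightarrow> i < n \<Longrightarrow> cj (sigma n i) (lab n (e, j, k)) = lab n (e, j, k)"
proof (induction k)
  case (Suc k)
  show ?case
  proof (cases "k = j")
    case True
    then show ?thesis using Suc.prems bas_far[of j i e] by (simp add: lab_base del: lab.simps)
  next
    case False
    then show ?thesis
      using Suc by (simp add: lab_Suc cj_far[of i k] lab_closed del: lab.simps)
  qed
qed simp

lemma cj_lab_below:
  "1 \<le> i \<Longrightarrow> i + 1 < j \<Longrightarrow> j < k \<Longrightarrow> k \<le> n \<Longrightarrow> cj (sigma n i) (lab n (e, j, k)) = lab n (e, j, k)"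
proof (induction k)
  case (Suc k)
  show ?case
  proof (cases "k = j")
    case True
    then show ?thesis using Suc.prems bas_far[of j i e] by (simp add: lab_base del: lab.simps)
  next
    case False
    then show ?thesis
      using Suc by (simp add: lab_Suc cj_far[of i k] lab_closed del: lab.simps)
  qed
qed simp

lemma cj_lab_left:
  "1 \<le> j \<Longrightarrow> j + 1 < k \<Longrightarrow> k \<le> n \<Longrightarrow> cj (sigma n j) (lab n (e, j, k)) = lab n (e, j + 1, k)"
proof (induction k)
  case (Suc k)
  show ?case
  proof (cases "k = j + 1")
    case True
    then show ?thesis using Suc.prems bas_braid[of j e] by (simp add: lab_base lab_Suc del: lab.simps)
  next
    case False
    then show ?thesis
      using Suc by (simp add: lab_Suc cj_far[of j k] lab_closed del: lab.simps)
  qed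
qed simp

text \<open>At \<open>k = i + 2\<close> the braid relation turns the outer \<open>sigma n i\<close>
  into an inner \<open>sigma n (i + 1)\<close>, which fixes \<open>lab n (e, j, i)\<close>. For
  larger \<open>k\<close> the new factor commutes with \<open>sigma n i\<close>.\<close>

lemma cj_lab_between:
  "1 \<le> j \<Longrightarrow> j < i \<Longrightarrow> i + 1 < k \<Longrightarrow> k \<le> n \<Longrightarrow> cj (sigma n i) (lab n (e, j, k)) = lab n (e, j, k)"
proof (induction k)
  case (Suc k)
  show ?case
  proof (cases "k = i + 1")
    case True
    then show ?thesis
      using Suc.prems cj_braid[of i "lab n (e, j, i)"] cj_lab_above[of j i "i + 1" e]
      by (simp add: lab_Suc lab_closed del: lab.simps)
  next
    case False
    then show ?thesis
      using Suc by (simp add: lab_Suc cj_far[of i k] lab_closed del: lab.simps)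
  qed
qed simp

text \<open>The case left out has strand \<open>i + 1\<close> but not \<open>i\<close>; there the
  conjugate is a generator only up to conjugation by the square of \<open>sigma n i\<close>.\<close>

lemma cj_lab:
  assumes "1 \<le> i" "i < n" "1 \<le> j" "j < k" "k \<le> n" "i \<in> {j, k} \<or> i + 1 \<notin> {j, k}"
  shows "cj (sigma n i) (lab n (e, j, k)) = lab n (lab_swap i (e, j, k))"
proof -
  consider "j = i" "k = i + 1" | "j = i" "k > i + 1" | "k = i" | "j > i + 1" | "k < i" | "j < i" "k > i + 1"
    using assms(4,6) by (cases "j = i"; cases "k = i"; cases "j < i"; cases "k < i"; simp; linarith)
  then show ?thesis
  proof cases
    case 1
    then show ?thesis using assms bas_sigma[of i e] by (simp add: lab_base del: lab.simps)
  next
    case 2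
    then show ?thesis using assms cj_lab_left[of i k e] by (simp del: lab.simps add: transpose_def)
  next
    case 3
    then show ?thesis using assms lab_Suc[of j i e] by (simp del: lab.simps add: transpose_def)
  next
    case 4
    then show ?thesis using assms cj_lab_below[of i j k e] by (simp del: lab.simps add: transpose_def)
  next
    case 5
    then show ?thesis using assms cj_lab_above[of j k i e] by (simp del: lab.simps add: transpose_def)
  next
    case 6
    then show ?thesis using assms cj_lab_between[of j i k e] by (simp del: lab.simps add: transpose_def)
  qed
qed

declare lab.simps [simp del] lab_swap.simps [simp del]

section \<open>Petals in the singular braid group and their conjugates\<close>

definition petal :: "nat set \<Rightarrow> sgen word set set" where
  "petal S = generate G (lab n ` labels S)"

lemma petal_subgroup: "S \<subseteq> {1..n} \<Longrightarrow> subgroup (petal S) G"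
  unfolding petal_def using lab_closed_labels by (intro G.generate_is_subgroup) blast

lemma lab_in_petal: "y \<in> labels S \<Longrightarrow> lab n y \<in> petal S"
  unfolding petal_def by (simp add: generate.incl)

lemma lab_swap_labels: "y \<in> labels S \<Longrightarrow> i + 1 \<notin> S \<or> i \<in> S \<and> i + 1 \<in> S \<Longrightarrow> lab_swap i y \<in> labels (adj i ` S)"
  by (cases y) (auto simp: labels_def lab_swap.simps transpose_def image_iff split: if_splits)

lemma lab_swap_labels_image:
  assumes "i + 1 \<notin> S"
  shows "lab_swap i ` labels S = labels (adj i ` S)"
proof
  show "lab_swap i ` labels S \<subseteq> labels (adj i ` S)"
    using lab_swap_labels assms by blast
  show "labels (adj i ` S) \<subseteq> lab_swap i ` labels S"
  proof
    fix y assume y: "y \<in> labels (adj i ` S)"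
    obtain e j k where yy: "y = (e, j, k)" by (cases y)
    with y obtain j' k' where jk: "j' \<in> S" "k' \<in> S" "j = adj i j'" "k = adj i k'" "j < k"
      by (auto simp: labels_def)
    have "j' < k'" using jk assms by (auto simp: transpose_def split: if_splits)
    moreover have "lab_swap i (e, j', k') = y"
      using jk assms yy by (auto simp: lab_swap.simps)
    ultimately show "y \<in> lab_swap i ` labels S" using jk
      by (auto simp: labels_def intro!: image_eqI[of _ _ "(e, j', k')"])
  qed
qed

lemma cj_lab_label:
  assumes "1 \<le> i" "i < n" "S \<subseteq> {1..n}" "(e, j, k) \<in> labels S" "i \<in> {j, k} \<or> i + 1 \<notin> {j, k}"
  shows "cj (sigma n i) (lab n (e, j, k)) = lab n (lab_swap i (e, j, k))"
proof (rule cj_lab)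
  show "1 \<le> j" "j < k" "k \<le> n" using assms(3,4) by (auto simp: labels_def)
qed fact+

text \<open>\<open>\<sigma>\<^sub>i\<close> moves the strand \<open>i\<close> in front of \<open>i + 1\<close>, whereas the strand \<open>i + 1\<close> passes behind.\<close>

lemma cj_petal_move:
  assumes i: "1 \<le> i" "i < n" and S: "S \<subseteq> {1..n}" "i + 1 \<notin> S"
  shows "cj (sigma n i) ` petal S = petal (adj i ` S)"
proof -
  have "cj (sigma n i) ` lab n ` labels S = lab n ` lab_swap i ` labels S"
    unfolding image_image
  proof (rule image_cong[OF HOL.refl])
    fix y assume y: "y \<in> labels S"
    obtain e j k where yy: "y = (e, j, k)" by (cases y)
    then have "i + 1 \<notin> {j, k}" using y S(2) by (auto simp: labels_def)
    then show "cj (sigma n i) (lab n y) = lab n (lab_swap i y)"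
      using cj_lab_label[OF i S(1)] y unfolding yy by blast
  qed
  also have "\<dots> = lab n ` labels (adj i ` S)"
    by (simp only: lab_swap_labels_image[OF S(2)])
  finally show ?thesis
    unfolding petal_def
    using i G.conj_by_generate[of "sigma n i" "lab n ` labels S"] lab_closed_labels[OF _ S(1)]
    by (simp add: image_subset_iff)
qed

lemma lab_swap_swap: "y \<in> labels S \<Longrightarrow> lab_swap i (lab_swap i y) = y"
  by (cases y) (auto simp: lab_swap.simps labels_def transpose_def split: if_splits)

text \<open>A label or its swap falls under \<open>cj_lab\<close>, and the square of
  \<open>sigma n i\<close> belongs to the petal; up to that square, conjugation by
  \<open>sigma n i\<close> and by its inverse agree.\<close>

lemma cj_sigma_lab_in_petal:
  assumes i: "1 \<le> i" "i < n" and S: "S \<subseteq> {1..n}" "i \<in> S" "i + 1 \<in> S" and y: "y \<in> labels S"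
  shows "cj (sigma n i) (lab n y) \<in> petal S" "cj (inv\<^bsub>G\<^esub> (sigma n i)) (lab n y) \<in> petal S"
proof -
  obtain e j k where yy: "y = (e, j, k)" by (cases y)
  obtain e' j' k' where yy': "lab_swap i y = (e', j', k')" by (cases "lab_swap i y")
  have cl: "sigma n i \<in> carrier G" "lab n y \<in> carrier G" using i S y lab_closed_labels by simp_all
  have adjS: "adj i ` S = S" using S by (auto simp: transpose_def image_iff)
  have y': "lab_swap i y \<in> labels S" using lab_swap_labels[OF y, of i] adjS S by simp
  let ?A = "lab n (True, i, Suc i)"
  have sub: "subgroup (petal S) G" by (rule petal_subgroup[OF S(1)])
  have "(True, i, Suc i) \<in> labels S" using S by (simp add: labels_def)
  then have A: "?A \<in> petal S" "inv\<^bsub>G\<^esub> ?A \<in> petal S"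
    using sub by (simp_all add: lab_in_petal subgroup.m_inv_closed)
  have A_eq: "?A = sigma n i \<otimes>\<^bsub>G\<^esub> sigma n i"
    using i by (simp add: lab_base bas_def xelt_def)
  have mem: "lab n y \<in> petal S" "lab n (lab_swap i y) \<in> petal S" using y y' by (simp_all add: lab_in_petal)
  have 1: "cj (sigma n i) (lab n y) = lab n (lab_swap i y)" if "i \<in> {j, k} \<or> i + 1 \<notin> {j, k}"
    using cj_lab_label[OF i S(1), of e j k] y yy that by simp
  have 2: "cj (sigma n i) (lab n (lab_swap i y)) = lab n y" if "i \<in> {j', k'} \<or> i + 1 \<notin> {j', k'}"
    using cj_lab_label[OF i S(1), of e' j' k'] y' yy' that lab_swap_swap[OF y, of i] by simp
  have cl': "lab n (lab_swap i y) \<in> carrier G" using y' S lab_closed_labels by blast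
  have 3: "i \<in> {j, k} \<or> i + 1 \<notin> {j, k} \<or> i \<in> {j', k'} \<or> i + 1 \<notin> {j', k'}"
    using yy yy' by (auto simp: lab_swap.simps transpose_def split: if_splits)
  have up: "cj ?A (cj (inv\<^bsub>G\<^esub> (sigma n i)) x) = cj (sigma n i) x" if "x \<in> carrier G" for x
    using that cl by (simp add: A_eq G.conj_by_mult G.conj_by_inv_cancel)
  have down: "cj (inv\<^bsub>G\<^esub> ?A) (cj (sigma n i) x) = cj (inv\<^bsub>G\<^esub> (sigma n i)) x" if "x \<in> carrier G" for x
    using that cl by (simp add: A_eq G.inv_mult_group G.conj_by_mult G.conj_by_inv_cancel)
  show s: "cj (sigma n i) (lab n y) \<in> petal S"
  proof (cases "i \<in> {j, k} \<or> i + 1 \<notin> {j, k}")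
    case False
    then have "cj (inv\<^bsub>G\<^esub> (sigma n i)) (lab n y) = lab n (lab_swap i y)"
      using 2 3 cl cl' G.conj_by_inv_cancel(2) by metis
    then show ?thesis using up[OF cl(2)] mem A G.conj_by_in_subgroup[OF sub] by metis
  qed (use 1 mem in simp)
  show "cj (inv\<^bsub>G\<^esub> (sigma n i)) (lab n y) \<in> petal S"
    using down[OF cl(2)] s A G.conj_by_in_subgroup[OF sub] by metis
qed

lemma cj_petal_inside:
  assumes i: "1 \<le> i" "i < n" and S: "S \<subseteq> {1..n}" "i \<in> S" "i + 1 \<in> S"
  shows "cj (sigma n i) ` petal S = petal S"
proof -
  have car: "lab n ` labels S \<subseteq> carrier G" using lab_closed_labels S by auto
  have si: "sigma n i \<in> carrier G" "inv\<^bsub>G\<^esub> (sigma n i) \<in> carrier G" using i by simp_all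
  have sub: "subgroup (petal S) G" by (rule petal_subgroup[OF S(1)])
  have le: "cj g ` petal S \<subseteq> petal S"
    if g: "g \<in> carrier G" and "\<And>y. y \<in> labels S \<Longrightarrow> cj g (lab n y) \<in> petal S" for g
  proof -
    have "cj g ` lab n ` labels S \<subseteq> petal S" using that(2) by blast
    then have "generate G (cj g ` lab n ` labels S) \<subseteq> petal S"
      using G.generate_subgroup_incl sub by blast
    then show ?thesis unfolding petal_def G.conj_by_generate[OF g car] .
  qed
  have "petal S \<subseteq> cj (sigma n i) ` petal S"
  proof
    fix x assume x: "x \<in> petal S"
    then have xc: "x \<in> carrier G" by (rule subgroup.mem_carrier[OF sub])
    have "cj (inv\<^bsub>G\<^esub> (sigma n i)) x \<in> petal S"
      using le[OF si(2) cj_sigma_lab_in_petal(2)[OF i S]] x by blast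
    then have "cj (sigma n i) (cj (inv\<^bsub>G\<^esub> (sigma n i)) x) \<in> cj (sigma n i) ` petal S"
      by (rule imageI)
    then show "x \<in> cj (sigma n i) ` petal S"
      unfolding G.conj_by_inv_cancel(1)[OF si(1) xc] .
  qed
  moreover have "cj (sigma n i) ` petal S \<subseteq> petal S"
    by (rule le[OF si(1) cj_sigma_lab_in_petal(1)[OF i S]])
  ultimately show ?thesis by (rule equalityI[rotated])
qed

end

section \<open>The amalgam of the petals\<close>

context singular_braid
begin

text \<open>
  The amalgam is presented on labels, since the elements \<open>a\<^sub>i\<^sub>j\<close>, \<open>b\<^sub>i\<^sub>j\<close> are not yet known to be distinct.
\<close>

definition petal_rels :: "(label word \<times> label word) set" where
  "petal_rels = {(u, v). \<exists>S \<subseteq> {1..n}. card S \<le> 4 \<and> u \<in> words (labels S) \<and> v \<in> words (labels S) \<and>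
     word_eval G (lab n) u = word_eval G (lab n) v}"

definition "L = labels {1..n}"
abbreviation "K \<equiv> presented_group L petal_rels"
abbreviation "kgen \<equiv> gen_class L petal_rels"
abbreviation "cK \<equiv> conj_by K"
definition "p = presented_map G (lab n)"

sublocale k: presentation L petal_rels
  by unfold_locales (use words_mono[OF labels_mono] in \<open>unfold petal_rels_def L_def, blast\<close>)

lemma lab_in_carrier: "y \<in> L \<Longrightarrow> lab n y \<in> carrier G"
  using lab_closed_labels unfolding L_def by blast

lemma petal_rels_valid: "(u, v) \<in> petal_rels \<Longrightarrow> word_eval G (lab n) u = word_eval G (lab n) v"
  unfolding petal_rels_def by blast

sublocale p: group_hom K G p
  unfolding p_def by (rule k.map_hom[OF G.is_group lab_in_carrier petal_rels_valid])

lemma p_kgen: "y \<in> L \<Longrightarrow> p (kgen y) = lab n y"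
  unfolding p_def by (rule k.map_gen[OF G.is_group lab_in_carrier petal_rels_valid])

lemma p_word: "u \<in> words L \<Longrightarrow> p (word_eval K kgen u) = word_eval G (lab n) u"
  unfolding p_def by (rule k.map_word_eval[OF G.is_group lab_in_carrier petal_rels_valid])

section \<open>Petals of the amalgam\<close>

definition kpetal :: "nat set \<Rightarrow> label word set set" where
  "kpetal T = generate K (kgen ` labels T)"

lemma labels_L: "T \<subseteq> {1..n} \<Longrightarrow> y \<in> labels T \<Longrightarrow> y \<in> L"
  unfolding L_def using labels_mono by blast

lemma mem_L: "(e, j, k) \<in> L \<longleftrightarrow> 1 \<le> j \<and> j < k \<and> k \<le> n"
  by (auto simp: L_def labels_def)

lemma labels_words_L: "T \<subseteq> {1..n} \<Longrightarrow> u \<in> words (labels T) \<Longrightarrow> u \<in> words L"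
  by (erule words_mono[rotated]) (use labels_L in blast)

lemma cj_lab_L:
  assumes "1 \<le> i" "i < n" "(e, j, k) \<in> L" "i \<in> {j, k} \<or> i + 1 \<notin> {j, k}"
  shows "cj (sigma n i) (lab n (e, j, k)) = lab n (lab_swap i (e, j, k))"
  using cj_lab[of i j k e] assms unfolding mem_L by blast

lemma lab_swap_swap_L: "y \<in> L \<Longrightarrow> lab_swap i (lab_swap i y) = y"
  unfolding L_def by (rule lab_swap_swap)

lemma kgen_labels: "T \<subseteq> {1..n} \<Longrightarrow> kgen ` labels T \<subseteq> carrier K"
  using labels_L k.gen_closed by blast

lemma kpetal_subgroup: "T \<subseteq> {1..n} \<Longrightarrow> subgroup (kpetal T) K"
  unfolding kpetal_def by (rule k.K.generate_is_subgroup[OF kgen_labels])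

lemma kpetal_carrier: "T \<subseteq> {1..n} \<Longrightarrow> k \<in> kpetal T \<Longrightarrow> k \<in> carrier K"
  using subgroup.mem_carrier[OF kpetal_subgroup] .

lemma kgen_in_kpetal: "y \<in> labels T \<Longrightarrow> kgen y \<in> kpetal T"
  unfolding kpetal_def by (simp add: generate.incl)

text \<open>Two words over the labels of \<open>T\<close> with the same value in \<open>SG n\<close>
  form one of the imposed relations. Nearly all identities in \<open>K\<close> are obtained from
  this lemma.\<close>

lemma kpetal_inj:
  assumes T: "T \<subseteq> {1..n}" "card T \<le> 4" and k: "k \<in> kpetal T" "k' \<in> kpetal T" and eq: "p k = p k'"
  shows "k = k'"
proof -
  have cl: "\<And>y. y \<in> labels T \<Longrightarrow> kgen y \<in> carrier K" using k.gen_closed labels_L[OF T(1)] .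
  have eqT: "kpetal T = word_eval K kgen ` words (labels T)"
    unfolding kpetal_def by (rule k.K.generate_eq_word_eval[OF cl])
  obtain u where u: "u \<in> words (labels T)" "k = word_eval K kgen u"
    using k(1) unfolding eqT by (rule imageE)
  obtain v where v: "v \<in> words (labels T)" "k' = word_eval K kgen v"
    using k(2) unfolding eqT by (rule imageE)
  have uv: "u \<in> words L" "v \<in> words L"
    by (rule labels_words_L[OF T(1) u(1)], rule labels_words_L[OF T(1) v(1)])
  have "word_eval G (lab n) u = word_eval G (lab n) v"
    using eq p_word[OF uv(1)] p_word[OF uv(2)] u(2) v(2) by simp
  then have "(u, v) \<in> petal_rels"
    unfolding petal_rels_def using T u(1) v(1) by blast
  then have "pres_cong L petal_rels ([] @ u @ []) ([] @ v @ [])"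
    by (intro pres_cong.rel) simp_all
  then show ?thesis using u(2) v(2) k.word_eval_gen_eq_iff[OF uv] by simp
qed

section \<open>Lifting conjugation by a braid generator\<close>

definition "kA i = kgen (True, i, Suc i)"
definition "kB i = kgen (False, i, Suc i)"

lemma kAB_in_kpetal: "i \<in> T \<Longrightarrow> i + 1 \<in> T \<Longrightarrow> kA i \<in> kpetal T" "i \<in> T \<Longrightarrow> i + 1 \<in> T \<Longrightarrow> kB i \<in> kpetal T"
  unfolding kA_def kB_def by (rule kgen_in_kpetal, simp add: labels_def)+

lemma kAB_closed [simp]:
  assumes "1 \<le> i" "i < n" shows "kA i \<in> carrier K" "kB i \<in> carrier K"
  using kAB_in_kpetal[of i "{1..n}"] kpetal_carrier[of "{1..n}"] assms by simp_all

lemma p_kA: "1 \<le> i \<Longrightarrow> i < n \<Longrightarrow> p (kA i) = sigma n i \<otimes>\<^bsub>G\<^esub> sigma n i"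
  unfolding kA_def using p_kgen[of "(True, i, Suc i)"] lab_base[of i True]
  by (simp add: mem_L bas_def xelt_def)

lemma p_kB: "1 \<le> i \<Longrightarrow> i < n \<Longrightarrow> p (kB i) = tau n i \<otimes>\<^bsub>G\<^esub> sigma n i"
  unfolding kB_def using p_kgen[of "(False, i, Suc i)"] lab_base[of i False]
  by (simp add: mem_L bas_def xelt_def)

text \<open>
  If the strand \<open>i + 1\<close> but not \<open>i\<close> is involved, it passes behind, so that conjugation by \<open>\<sigma>\<^sub>i\<close>
  leaves the petals; one uses \<open>\<sigma>\<^sub>i = A\<^sub>i \<sigma>\<^sub>i\<^sup>-\<^sup>1\<close> with \<open>A\<^sub>i = \<sigma>\<^sub>i\<^sup>2\<close> instead.
\<close>

fun s_lab :: "nat \<Rightarrow> label \<Rightarrow> label word set" where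
  "s_lab i (e, j, k) =
     (if i + 1 \<in> {j, k} \<and> i \<notin> {j, k} then cK (kA i) (kgen (lab_swap i (e, j, k)))
      else kgen (lab_swap i (e, j, k)))"

lemma lab_swap_L: "y \<in> L \<Longrightarrow> 1 \<le> i \<Longrightarrow> i < n \<Longrightarrow> lab_swap i y \<in> L"
  by (cases y) (auto simp: mem_L lab_swap.simps transpose_def)

lemma s_lab_closed: "y \<in> L \<Longrightarrow> 1 \<le> i \<Longrightarrow> i < n \<Longrightarrow> s_lab i y \<in> carrier K"
  by (cases y) (simp add: k.gen_closed lab_swap_L)

text \<open>The swapped label contains \<open>i\<close> and not \<open>i + 1\<close>, so
  \<open>cj_lab_L\<close> applies to it and is read backwards.\<close>

lemma cj_lab_swap_inv:
  assumes "1 \<le> i" "i < n" "(e, j, k) \<in> L" "i + 1 \<in> {j, k}" "i \<notin> {j, k}"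
  shows "cj (inv\<^bsub>G\<^esub> (sigma n i)) (lab n (e, j, k)) = lab n (lab_swap i (e, j, k))"
proof -
  have sL: "lab_swap i (e, j, k) \<in> L" using lab_swap_L assms by blast
  have "cj (sigma n i) (lab n (lab_swap i (e, j, k))) = lab n (lab_swap i (lab_swap i (e, j, k)))"
  proof -
    obtain e' j' k' where e: "lab_swap i (e, j, k) = (e', j', k')" by (cases "lab_swap i (e, j, k)")
    then have "i \<in> {j', k'} \<or> i + 1 \<notin> {j', k'}"
      using assms by (auto simp: lab_swap.simps transpose_def split: if_splits)
    then show ?thesis using cj_lab_L[OF assms(1,2), of e' j' k'] sL unfolding e by blast
  qed
  also have "\<dots> = lab n (e, j, k)" by (simp only: lab_swap_swap_L[OF assms(3)])
  finally show ?thesis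
    using G.conj_by_inv_cancel(2)[OF sigma_closed[OF assms(1,2)] lab_in_carrier[OF sL]] by simp
qed

lemma p_s_lab:
  assumes y: "y \<in> L" and i: "1 \<le> i" "i < n"
  shows "p (s_lab i y) = cj (sigma n i) (lab n y)"
proof -
  obtain e j k where yy: "y = (e, j, k)" by (cases y)
  have sL: "lab_swap i y \<in> L" by (rule lab_swap_L[OF y i])
  show ?thesis
  proof (cases "i + 1 \<in> {j, k} \<and> i \<notin> {j, k}")
    case True
    then have "p (s_lab i y) = cj (sigma n i \<otimes>\<^bsub>G\<^esub> sigma n i) (lab n (lab_swap i y))"
      using i sL by (simp add: yy p.conj_by_map k.gen_closed p_kgen p_kA)
    also have "lab n (lab_swap i y) = cj (inv\<^bsub>G\<^esub> (sigma n i)) (lab n y)"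
      using cj_lab_swap_inv[OF i, of e j k] True y yy by simp
    also have "cj (sigma n i \<otimes>\<^bsub>G\<^esub> sigma n i) \<dots> = cj (sigma n i) (lab n y)"
      using i lab_in_carrier[OF y] by (simp add: G.conj_by_mult G.conj_by_inv_cancel)
    finally show ?thesis .
  next
    case False
    then have "s_lab i y = kgen (lab_swap i y)" by (simp only: yy s_lab.simps if_False)
    moreover have "cj (sigma n i) (lab n y) = lab n (lab_swap i y)"
      using cj_lab_L[OF i, of e j k] y False unfolding yy by blast
    ultimately show ?thesis using p_kgen[OF sL] by simp
  qed
qed

lemma s_lab_in_kpetal_inside:
  assumes "y \<in> labels T" "i \<in> T" "i + 1 \<in> T" "T \<subseteq> {1..n}"
  shows "s_lab i y \<in> kpetal T"
proof -
  have "lab_swap i y \<in> labels T" using lab_swap_labels[OF assms(1), of i] adj_image_same[OF assms(2,3)] assms(2,3) by simp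
  then have "kgen (lab_swap i y) \<in> kpetal T" by (rule kgen_in_kpetal)
  then show ?thesis
    using kAB_in_kpetal(1)[of i T] assms k.K.conj_by_in_subgroup[OF kpetal_subgroup[OF assms(4)]]
    by (cases y) simp
qed

lemma s_lab_fix:
  assumes "y \<in> labels T" "i \<notin> T" "i + 1 \<notin> T"
  shows "s_lab i y = kgen y"
  using assms by (cases y) (auto simp: labels_def lab_swap.simps transpose_def)

text \<open>The strands of the two pairs are four in all, so the equation holds in one
  petal.\<close>

lemma kA_commute:
  assumes i: "1 \<le> i" "i < n" and y: "(e, j, k) \<in> L" "i \<notin> {j, k}" "i + 1 \<notin> {j, k}"
  shows "cK (kA i) (kgen (e, j, k)) = kgen (e, j, k)"
proof -
  let ?T = "{i, i + 1, j, k}"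
  have T: "?T \<subseteq> {1..n}" using y i by (auto simp: mem_L)
  have gen: "kgen (e, j, k) \<in> kpetal ?T"
    using y by (intro kgen_in_kpetal) (simp add: labels_def mem_L)
  have "cK (kA i) (kgen (e, j, k)) \<in> kpetal ?T"
    using k.K.conj_by_in_subgroup[OF kpetal_subgroup[OF T]] gen kAB_in_kpetal(1)[of i ?T] by blast
  moreover have "p (cK (kA i) (kgen (e, j, k))) = p (kgen (e, j, k))"
  proof -
    have "lab_swap i (e, j, k) = (e, j, k)" using y by (simp add: lab_swap.simps)
    then have "cj (sigma n i) (lab n (e, j, k)) = lab n (e, j, k)"
      using cj_lab_L[OF i, of e j k] y by simp
    then show ?thesis
      using i y(1) lab_in_carrier[OF y(1)]
      by (simp add: p.conj_by_map k.gen_closed p_kgen p_kA G.conj_by_mult)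
  qed
  ultimately show ?thesis using kpetal_inj[OF T card_insert4_le] gen by blast
qed

text \<open>If \<open>S\<close> contains \<open>i + 1\<close> but not \<open>i\<close>, the images
  of the labels may spread over five strands. Their common conjugation by \<open>kA i\<close> is
  split off; what remains is conjugation by the inverse of \<open>sigma n i\<close>, which stays on
  the image of \<open>S\<close> under \<open>adj i\<close>. In the other case the images lie there
  already.\<close>

lemma s_lab_respects:
  assumes i: "1 \<le> i" "i < n" and uv: "(u, v) \<in> petal_rels"
  shows "word_eval K (s_lab i) u = word_eval K (s_lab i) v"
proof -
  obtain S where S: "S \<subseteq> {1..n}" "card S \<le> 4" and u: "u \<in> words (labels S)" and v: "v \<in> words (labels S)"
    and eq: "word_eval G (lab n) u = word_eval G (lab n) v"
    using uv unfolding petal_rels_def by blast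
  let ?S' = "adj i ` S"
  have S': "?S' \<subseteq> {1..n}" "card ?S' \<le> 4"
    using adj_image_subset[OF i S(1)] adj_image_card[of i S] S(2) by auto
  have sg: "subgroup (kpetal ?S') K" by (rule kpetal_subgroup[OF S'(1)])
  have labcl: "lab n y \<in> carrier G" "y \<in> L" if "y \<in> labels S" for y
    using lab_closed_labels[OF that S(1)] labels_L[OF S(1) that] .
  have key: "word_eval K f u = word_eval K f v"
    if g: "g \<in> carrier G" and f: "\<And>y. y \<in> labels S \<Longrightarrow> f y \<in> kpetal ?S'"
      and pf: "\<And>y. y \<in> labels S \<Longrightarrow> p (f y) = cj g (lab n y)" for f g
  proof -
    have cl: "\<And>y. y \<in> labels S \<Longrightarrow> f y \<in> carrier K" using f kpetal_carrier[OF S'(1)] by blast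
    have mem: "word_eval K f w \<in> kpetal ?S'" if "w \<in> words (labels S)" for w
      by (rule k.K.word_eval_in_subgroup[OF sg f that])
    have pw: "p (word_eval K f w) = cj g (word_eval G (lab n) w)" if w: "w \<in> words (labels S)" for w
    proof -
      have "p (word_eval K f w) = word_eval G (\<lambda>y. p (f y)) w" by (rule p.word_eval_hom[OF w cl])
      also have "\<dots> = word_eval G (\<lambda>y. cj g (lab n y)) w" by (rule G.word_eval_cong_gens[OF w pf])
      also have "\<dots> = cj g (word_eval G (lab n) w)"
        by (rule group_hom.word_eval_hom[OF G.conj_by_hom[OF g] w labcl(1), symmetric])
      finally show ?thesis .
    qed
    show ?thesis using kpetal_inj[OF S' mem[OF u] mem[OF v]] pw[OF u] pw[OF v] eq by simp
  qed
  show ?thesis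
  proof (cases "i \<in> S \<or> i + 1 \<notin> S")
    case True
    show ?thesis
    proof (rule key)
      show "sigma n i \<in> carrier G" using i by simp
      show "p (s_lab i y) = cj (sigma n i) (lab n y)" if "y \<in> labels S" for y
        by (rule p_s_lab[OF labcl(2)[OF that] i])
      show "s_lab i y \<in> kpetal ?S'" if y: "y \<in> labels S" for y
      proof (cases "i + 1 \<in> S")
        case False
        then have "lab_swap i y \<in> labels ?S'" using lab_swap_labels[OF y] by blast
        moreover have "s_lab i y = kgen (lab_swap i y)"
          using False y by (cases y) (auto simp: labels_def)
        ultimately show ?thesis by (simp add: kgen_in_kpetal)
      next
        case True
        then show ?thesis
          using s_lab_in_kpetal_inside[OF y _ True S(1)] adj_image_same[OF _ True] \<open>i \<in> S \<or> i + 1 \<notin> S\<close> by simp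
      qed
    qed
  next
    case False
    then have F: "i \<notin> S" "i + 1 \<in> S" by auto
    let ?f = "\<lambda>y. kgen (lab_swap i y)"
    have sw: "lab_swap i y \<in> labels ?S'" if "y \<in> labels S" for y
      using that F by (cases y) (auto simp: labels_def lab_swap.simps transpose_def image_iff)
    have fcl: "?f y \<in> carrier K" if "y \<in> labels S" for y
      using sw[OF that] labels_L[OF S'(1)] k.gen_closed by blast
    \<comment> \<open>Labels that avoid both strands can be written this way too, because
      \<open>kA i\<close> commutes with their generators.\<close>
    have eqf: "s_lab i y = cK (kA i) (?f y)" if y: "y \<in> labels S" for y
    proof -
      obtain e j k where yy: "y = (e, j, k)" by (cases y)
      show ?thesis
      proof (cases "i + 1 \<in> {j, k}")
        case True
        then show ?thesis using y F yy by (auto simp: labels_def)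
      next
        case False
        then have "i \<notin> {j, k}" using y F yy by (auto simp: labels_def)
        then have "lab_swap i y = y" "s_lab i y = kgen y"
          using False yy by (auto simp: lab_swap.simps)
        then show ?thesis using kA_commute[OF i, of e j k] labcl(2)[OF y] False \<open>i \<notin> {j, k}\<close> yy by simp
      qed
    qed
    have A: "kA i \<in> carrier K" using i by simp
    have ww: "word_eval K (s_lab i) w = cK (kA i) (word_eval K ?f w)" if w: "w \<in> words (labels S)" for w
      using k.K.word_eval_cong_gens[OF w eqf] group_hom.word_eval_hom[OF k.K.conj_by_hom[OF A] w fcl]
      by simp
    have "word_eval K ?f u = word_eval K ?f v"
    proof (rule key)
      show "inv\<^bsub>G\<^esub> (sigma n i) \<in> carrier G" using i by simp
      show "?f y \<in> kpetal ?S'" if "y \<in> labels S" for y by (rule kgen_in_kpetal[OF sw[OF that]])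
      show "p (?f y) = cj (inv\<^bsub>G\<^esub> (sigma n i)) (lab n y)" if y: "y \<in> labels S" for y
      proof -
        obtain e j k where yy: "y = (e, j, k)" by (cases y)
        have pk: "p (?f y) = lab n (lab_swap i y)" using p_kgen sw[OF y] labels_L[OF S'(1)] by blast
        have nij: "i \<notin> {j, k}" using y F yy by (auto simp: labels_def)
        show ?thesis
        proof (cases "i + 1 \<in> {j, k}")
          case True
          then show ?thesis using cj_lab_swap_inv[OF i, of e j k] labcl(2)[OF y] nij yy pk by simp
        next
          case False
          then have "lab_swap i y = y" using yy nij by (auto simp: lab_swap.simps)
          moreover have "cj (sigma n i) (lab n y) = lab n (lab_swap i y)"
            using cj_lab_label[OF i S(1), of e j k] y False unfolding yy by blast
          ultimately have "cj (inv\<^bsub>G\<^esub> (sigma n i)) (lab n y) = lab n y"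
            using G.conj_by_inv_cancel(2)[of "sigma n i" "lab n y"] i labcl(1)[OF y] by simp
          then show ?thesis using pk \<open>lab_swap i y = y\<close> by simp
        qed
      qed
    qed
    then show ?thesis using ww u v by simp
  qed
qed

text \<open>Being the identity off the carrier makes the endomorphisms satisfy the braid relations as functions.\<close>

definition s_map :: "nat \<Rightarrow> label word set \<Rightarrow> label word set" where
  "s_map i k = (if k \<in> carrier K then presented_map K (s_lab i) k else k)"

context
  fixes i assumes i: "1 \<le> i" "i < n"
begin

lemma s_map_group_hom: "group_hom K K (s_map i)"
proof -
  interpret h: group_hom K K "presented_map K (s_lab i)"
    by (rule k.map_hom[OF k.K.is_group s_lab_closed[OF _ i] s_lab_respects[OF i]])
  show ?thesis
    by unfold_locales (simp add: hom_def s_map_def)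
qed

lemma s_map_kgen: "y \<in> L \<Longrightarrow> s_map i (kgen y) = s_lab i y"
  unfolding s_map_def using k.gen_closed
    k.map_gen[OF k.K.is_group s_lab_closed[OF _ i] s_lab_respects[OF i]] by simp

lemma s_map_closed: "k \<in> carrier K \<Longrightarrow> s_map i k \<in> carrier K"
  by (rule group_hom.hom_closed[OF s_map_group_hom])

lemma p_s_map:
  assumes "k \<in> carrier K" shows "p (s_map i k) = cj (sigma n i) (p k)"
proof (rule k.hom_eqI[OF G.is_group _ _ _ assms])
  show "(\<lambda>k. p (s_map i k)) \<in> hom K G"
    by (rule group_hom.homh[OF group_hom_comp[OF s_map_group_hom p.group_hom_axioms]])
  show "(\<lambda>k. cj (sigma n i) (p k)) \<in> hom K G"
    by (rule group_hom.homh[OF group_hom_comp[OF p.group_hom_axioms G.conj_by_hom[OF sigma_closed[OF i]]]])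
  show "p (s_map i (kgen y)) = cj (sigma n i) (p (kgen y))" if "y \<in> L" for y
    using that s_map_kgen p_s_lab[OF _ i] p_kgen by simp
qed

lemma s_map_in_kpetal:
  assumes "T \<subseteq> {1..n}" "i \<in> T" "i + 1 \<in> T" "k \<in> kpetal T"
  shows "s_map i k \<in> kpetal T"
proof (rule group_hom.image_generate_le[OF s_map_group_hom kgen_labels[OF assms(1)] kpetal_subgroup[OF assms(1)]])
  show "k \<in> generate K (kgen ` labels T)" using assms(4) by (simp only: kpetal_def)
  fix z assume "z \<in> kgen ` labels T"
  then obtain y where "y \<in> labels T" "z = kgen y" by blast
  then show "s_map i z \<in> kpetal T"
    using s_map_kgen labels_L[OF assms(1)] s_lab_in_kpetal_inside[OF _ assms(2,3,1)] by simp
qed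

lemma s_map_fix:
  assumes "T \<subseteq> {1..n}" "i \<notin> T" "i + 1 \<notin> T" "k \<in> kpetal T"
  shows "s_map i k = k"
proof -
  have "k \<in> generate K (kgen ` labels T)" using assms(4) by (simp only: kpetal_def)
  then show ?thesis
  proof (induction rule: generate.induct)
    case one
    then show ?case by (rule group_hom.hom_one[OF s_map_group_hom])
  next
    case (incl h)
    then show ?case using s_map_kgen labels_L[OF assms(1)] s_lab_fix[OF _ assms(2,3)] by blast
  next
    case (inv h)
    then have "s_map i h = h" "h \<in> carrier K"
      using s_map_kgen labels_L[OF assms(1)] s_lab_fix[OF _ assms(2,3)] kgen_labels[OF assms(1)] by blast+
    then show ?case using group_hom.hom_inv[OF s_map_group_hom] by simp
  next
    case (eng h1 h2)
    then have "h1 \<in> carrier K" "h2 \<in> carrier K"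
      using k.K.generate_in_carrier[OF kgen_labels[OF assms(1)]] by blast+
    then show ?case using eng group_hom.hom_mult[OF s_map_group_hom] by simp
  qed
qed

lemma s_map_kgen_fix:
  assumes "(e, j, l) \<in> L" "i \<notin> {j, l}" "i + 1 \<notin> {j, l}"
  shows "s_map i (kgen (e, j, l)) = kgen (e, j, l)"
proof (rule s_map_fix)
  show "{j, l} \<subseteq> {1..n}" using assms(1) by (simp add: mem_L)
  show "kgen (e, j, l) \<in> kpetal {j, l}"
    using assms(1) by (intro kgen_in_kpetal) (simp add: labels_def mem_L)
qed (use assms in auto)

text \<open>On a generator both sides use at most four strands, its own and \<open>i\<close>,
  \<open>i + 1\<close>. The descending case of \<open>cocycle_conj\<close> rests on this
  square.\<close>

lemma s_map_square:
  assumes "k \<in> carrier K" shows "s_map i (s_map i k) = cK (kA i) k"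
proof (rule k.hom_eqI[OF k.K.is_group _ _ _ assms])
  show "(\<lambda>k. s_map i (s_map i k)) \<in> hom K K"
    by (rule group_hom.homh[OF group_hom_comp[OF s_map_group_hom s_map_group_hom]])
  show "cK (kA i) \<in> hom K K" using i by (intro group_hom.homh[OF k.K.conj_by_hom]) simp
  fix y assume y: "y \<in> L"
  obtain e j l where yy: "y = (e, j, l)" by (cases y)
  let ?T = "{i, i + 1, j, l}"
  have T: "?T \<subseteq> {1..n}" using y i by (simp add: mem_L yy)
  have g: "kgen y \<in> kpetal ?T"
    using y unfolding yy by (intro kgen_in_kpetal) (simp add: labels_def mem_L)
  have gc: "kgen y \<in> carrier K" by (rule k.gen_closed[OF y])
  show "s_map i (s_map i (kgen y)) = cK (kA i) (kgen y)"
  proof (rule kpetal_inj[OF T card_insert4_le])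
    show "s_map i (s_map i (kgen y)) \<in> kpetal ?T" using g s_map_in_kpetal[OF T] by simp
    show "cK (kA i) (kgen y) \<in> kpetal ?T"
      using k.K.conj_by_in_subgroup[OF kpetal_subgroup[OF T]] g kAB_in_kpetal(1)[of i ?T] by simp
    show "p (s_map i (s_map i (kgen y))) = p (cK (kA i) (kgen y))"
      using i gc by (simp add: p_s_map s_map_closed p.conj_by_map p_kA G.conj_by_mult)
  qed
qed

lemma s_map_kA: "s_map i (kA i) = kA i"
proof -
  have "(True, i, Suc i) \<in> L" using i by (simp add: mem_L)
  then show ?thesis unfolding kA_def using s_map_kgen by (simp add: lab_swap.simps)
qed

end

section \<open>Braid relations between the lifted conjugations\<close>

lemma s_map_outside: "k \<notin> carrier K \<Longrightarrow> s_map i k = k"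
  by (simp add: s_map_def)

text \<open>A generator that misses the three strands is fixed; one that meets them adds at most one
  strand, and four strands fit into a petal.\<close>

lemma s_map_braid:
  assumes i: "1 \<le> i" "i + 2 \<le> n"
  shows "s_map i (s_map (i + 1) (s_map i k)) = s_map (i + 1) (s_map i (s_map (i + 1) k))"
proof (cases "k \<in> carrier K")
  case True
  have i': "i < n" "1 \<le> i + 1" "i + 1 < n" using i by auto
  have hom: "group_hom K K (s_map i)" "group_hom K K (s_map (i + 1))"
    using s_map_group_hom i i' by blast+
  show ?thesis
  proof (rule k.hom_eqI[OF k.K.is_group _ _ _ True])
    show "(\<lambda>k. s_map i (s_map (i + 1) (s_map i k))) \<in> hom K K"
      by (rule group_hom.homh[OF group_hom_comp[OF group_hom_comp[OF hom(1) hom(2)] hom(1)]])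
    show "(\<lambda>k. s_map (i + 1) (s_map i (s_map (i + 1) k))) \<in> hom K K"
      by (rule group_hom.homh[OF group_hom_comp[OF group_hom_comp[OF hom(2) hom(1)] hom(2)]])
    fix y assume y: "y \<in> L"
    obtain e j l where yy: "y = (e, j, l)" by (cases y)
    have jl: "1 \<le> j" "j < l" "l \<le> n" using y by (simp_all add: yy mem_L)
    have gc: "kgen y \<in> carrier K" by (rule k.gen_closed[OF y])
    show "s_map i (s_map (i + 1) (s_map i (kgen y))) = s_map (i + 1) (s_map i (s_map (i + 1) (kgen y)))"
    proof (cases "{j, l} \<inter> {i, i + 1, i + 1 + 1} = {}")
      case True
      then show ?thesis
        using s_map_kgen_fix[OF i(1) i'(1), of e j l] s_map_kgen_fix[OF i'(2,3), of e j l] y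
        unfolding yy by simp
    next
      case False
      let ?T = "{i, i + 1, i + 1 + 1} \<union> {j, l}"
      have T: "?T \<subseteq> {1..n}" using jl i by auto
      have "card ?T \<le> 4"
      proof -
        have "card ({j, l} - {i, i + 1, i + 1 + 1}) < card {j, l}"
          using False by (intro psubset_card_mono) auto
        then have "card ({j, l} - {i, i + 1, i + 1 + 1}) \<le> 1" using jl by simp
        moreover have "card ({i, i + 1, i + 1 + 1} \<union> ({j, l} - {i, i + 1, i + 1 + 1}))
            \<le> card {i, i + 1, i + 1 + 1} + card ({j, l} - {i, i + 1, i + 1 + 1})"
          by (rule card_Un_le)
        moreover have "{i, i + 1, i + 1 + 1} \<union> ({j, l} - {i, i + 1, i + 1 + 1}) = ?T" by blast
        ultimately show ?thesis by simp
      qed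
      note T = T this
      have st: "s_map i k \<in> kpetal ?T" "s_map (i + 1) k \<in> kpetal ?T" if "k \<in> kpetal ?T" for k
        using that by (intro s_map_in_kpetal[OF i(1) i'(1) T(1)] s_map_in_kpetal[OF i'(2,3) T(1)]; simp)+
      have g: "kgen y \<in> kpetal ?T"
        using jl unfolding yy by (intro kgen_in_kpetal) (simp add: labels_def)
      show ?thesis
      proof (rule kpetal_inj[OF T])
        show "p (s_map i (s_map (i + 1) (s_map i (kgen y)))) = p (s_map (i + 1) (s_map i (s_map (i + 1) (kgen y))))"
          using gc cj_braid[OF i, of "p (kgen y)"]
          by (simp only: p_s_map[OF i(1) i'(1)] p_s_map[OF i'(2,3)] s_map_closed[OF i(1) i'(1)]
            s_map_closed[OF i'(2,3)] p.hom_closed)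
      qed (intro st g)+
    qed
  qed
qed (simp add: s_map_outside)

text \<open>A generator that misses \<open>i\<close> and \<open>i + 1\<close> is fixed by
  \<open>s_map i\<close>, and so is its image under \<open>s_map m\<close>; the same holds with the
  two pairs interchanged. Otherwise both of its strands are among these four.\<close>

lemma s_map_far:
  assumes i: "1 \<le> i" "i + 2 \<le> m" "m < n"
  shows "s_map i (s_map m k) = s_map m (s_map i k)"
proof (cases "k \<in> carrier K")
  case True
  have i': "i < n" "1 \<le> m" using i by auto
  have hom: "group_hom K K (s_map i)" "group_hom K K (s_map m)"
    using s_map_group_hom i i' by blast+
  show ?thesis
  proof (rule k.hom_eqI[OF k.K.is_group _ _ _ True])
    show "(\<lambda>k. s_map i (s_map m k)) \<in> hom K K" "(\<lambda>k. s_map m (s_map i k)) \<in> hom K K"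
      by (rule group_hom.homh[OF group_hom_comp[OF hom(2) hom(1)]],
        rule group_hom.homh[OF group_hom_comp[OF hom(1) hom(2)]])
    fix y assume y: "y \<in> L"
    obtain e j l where yy: "y = (e, j, l)" by (cases y)
    have jl: "1 \<le> j" "j < l" "l \<le> n" using y by (simp_all add: yy mem_L)
    have gc: "kgen y \<in> carrier K" by (rule k.gen_closed[OF y])
    have T2: "{a, a + 1, j, l} \<subseteq> {1..n}" "kgen y \<in> kpetal {a, a + 1, j, l}" if "1 \<le> a" "a < n" for a
      using jl that unfolding yy by (auto intro!: kgen_in_kpetal simp: labels_def)
    have "{i, i + 1} \<inter> {m, m + 1} = {}" using i(2) by auto
    then consider "{j, l} \<inter> {i, i + 1} = {}" | "{j, l} \<inter> {m, m + 1} = {}" | "{j, l} \<subseteq> {i, i + 1, m, m + 1}"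
      by blast
    then show "s_map i (s_map m (kgen y)) = s_map m (s_map i (kgen y))"
    proof cases
      case 1
      have fixy: "s_map i (kgen y) = kgen y"
        using s_map_kgen_fix[OF i(1) i'(1), of e j l] y 1 unfolding yy by simp
      have "s_map m (kgen y) \<in> kpetal {m, m + 1, j, l}"
        using s_map_in_kpetal[OF i'(2) i(3) T2(1)[OF i'(2) i(3)] _ _ T2(2)[OF i'(2) i(3)]] by simp
      then have "s_map i (s_map m (kgen y)) = s_map m (kgen y)"
        using 1 i(2) by (intro s_map_fix[OF i(1) i'(1) T2(1)[OF i'(2) i(3)]]) auto
      then show ?thesis by (simp only: fixy)
    next
      case 2
      have fixy: "s_map m (kgen y) = kgen y"
        using s_map_kgen_fix[OF i'(2) i(3), of e j l] y 2 unfolding yy by simp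
      have "s_map i (kgen y) \<in> kpetal {i, i + 1, j, l}"
        using s_map_in_kpetal[OF i(1) i'(1) T2(1)[OF i(1) i'(1)] _ _ T2(2)[OF i(1) i'(1)]] by simp
      then have "s_map m (s_map i (kgen y)) = s_map i (kgen y)"
        using 2 i(2) by (intro s_map_fix[OF i'(2) i(3) T2(1)[OF i(1) i'(1)]]) auto
      then show ?thesis by (simp only: fixy)
    next
      case 3
      let ?T = "{i, i + 1, m, m + 1}"
      have T: "?T \<subseteq> {1..n}" using i by auto
      have st: "s_map i k \<in> kpetal ?T" "s_map m k \<in> kpetal ?T" if "k \<in> kpetal ?T" for k
        using that by (intro s_map_in_kpetal[OF i(1) i'(1) T] s_map_in_kpetal[OF i'(2) i(3) T]; simp)+
      have g: "kgen y \<in> kpetal ?T"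
        using jl 3 unfolding yy by (intro kgen_in_kpetal) (simp add: labels_def)
      show ?thesis
      proof (rule kpetal_inj[OF T card_insert4_le])
        show "p (s_map i (s_map m (kgen y))) = p (s_map m (s_map i (kgen y)))"
          using gc cj_far[OF i(1) i'(2) i'(1) i(3), of "p (kgen y)"] i(2)
          by (simp add: p_s_map[OF i(1) i'(1)] p_s_map[OF i'(2) i(3)] s_map_closed[OF i(1) i'(1)]
            s_map_closed[OF i'(2) i(3)])
      qed (intro st g)+
    qed
  qed
qed (simp add: s_map_outside)

definition fun_monoid :: "(label word set \<Rightarrow> label word set) monoid" where
  "fun_monoid = \<lparr>carrier = UNIV, mult = (\<circ>), one = id\<rparr>"

lemma fun_monoid_simps [simp]:
  "mult fun_monoid = (\<circ>)" "one fun_monoid = id" "carrier fun_monoid = UNIV"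
  by (simp_all add: fun_monoid_def)

text \<open>The second instance of the calculus of reduced words, beside \<open>SG n\<close>.
  Functions under composition have no inverses in general, which is why \<open>braid_monoid\<close>
  extends monoids.\<close>

sublocale F: braid_monoid fun_monoid n s_map
proof unfold_locales
  show "s_map i \<otimes>\<^bsub>fun_monoid\<^esub> s_map (i + 1) \<otimes>\<^bsub>fun_monoid\<^esub> s_map i =
      s_map (i + 1) \<otimes>\<^bsub>fun_monoid\<^esub> s_map i \<otimes>\<^bsub>fun_monoid\<^esub> s_map (i + 1)"
    if "1 \<le> i" "i + 2 \<le> n" for i
    using s_map_braid[OF that] by (simp add: fun_eq_iff)
  show "s_map i \<otimes>\<^bsub>fun_monoid\<^esub> s_map j = s_map j \<otimes>\<^bsub>fun_monoid\<^esub> s_map i"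
    if "1 \<le> i" "i + 2 \<le> j" "j < n" for i j
    using s_map_far[OF that] by (simp add: fun_eq_iff)
qed (simp_all add: comp_assoc)

definition Phi :: "nat list \<Rightarrow> label word set \<Rightarrow> label word set" where
  "Phi l = F.ev l"

lemma Phi_Nil [simp]: "Phi [] k = k" and Phi_Cons [simp]: "Phi (i # l) k = s_map i (Phi l k)"
  unfolding Phi_def by simp_all

lemma Phi_append: "Phi (l @ l') k = Phi l (Phi l' k)"
  by (induction l) simp_all

lemma Phi_red_word_adj:
  assumes "w permutes {1..n}" "1 \<le> i" "i < n" "w i < w (i + 1)"
  shows "Phi (red_word n (w \<circ> adj i)) k = Phi (red_word n w) (s_map i k)"
proof -
  have "Phi (red_word n (w \<circ> adj i)) = Phi (red_word n w) \<circ> s_map i"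
    using F.ev_red_word_adj[of w n i] assms by (simp add: Phi_def)
  then show ?thesis by simp
qed

lemma Phi_group_hom: "set l \<subseteq> {1..<n} \<Longrightarrow> group_hom K K (Phi l)"
proof (induction l)
  case Nil
  then show ?case by (simp add: group_hom_def group_hom_axioms_def hom_def k.K.is_group)
next
  case (Cons i l)
  then have "group_hom K K (\<lambda>k. s_map i (Phi l k))"
    by (intro group_hom_comp[OF _ s_map_group_hom]) auto
  moreover have "Phi (i # l) = (\<lambda>k. s_map i (Phi l k))" by (simp add: fun_eq_iff)
  ultimately show ?case by (simp only:)
qed

lemma Phi_closed: "set l \<subseteq> {1..<n} \<Longrightarrow> k \<in> carrier K \<Longrightarrow> Phi l k \<in> carrier K"
  by (rule group_hom.hom_closed[OF Phi_group_hom])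

lemma p_Phi: "set l \<subseteq> {1..<n} \<Longrightarrow> k \<in> carrier K \<Longrightarrow> p (Phi l k) = cj (B.ev l) (p k)"
proof (induction l)
  case (Cons i l)
  then show ?case
    using Phi_closed[of l k] p_s_map[of i "Phi l k"] B.ev_closed[of l] by (simp add: G.conj_by_mult)
qed simp

lemma Phi_in_kpetal:
  "set l \<subseteq> {1..<n} \<Longrightarrow> T \<subseteq> {1..n} \<Longrightarrow> (\<And>i. i \<in> set l \<Longrightarrow> i \<in> T \<and> i + 1 \<in> T) \<Longrightarrow>
    k \<in> kpetal T \<Longrightarrow> Phi l k \<in> kpetal T"
proof (induction l)
  case (Cons i l)
  then show ?case using s_map_in_kpetal[of i T "Phi l k"] by simp
qed simp

end

section \<open>The action of the singular braid group\<close>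

context singular_braid
begin

abbreviation "perms \<equiv> {w. w permutes {1..n}}"
abbreviation "mB w \<equiv> B.ev (red_word n w)"
text \<open>Lifts conjugation by \<open>mB w\<close> from \<open>SG n\<close> to \<open>K\<close>,
  by \<open>p_Phi\<close>.\<close>

abbreviation "mP w \<equiv> Phi (red_word n w)"

lemma red_word_perm_letters: "w \<in> perms \<Longrightarrow> set (red_word n w) \<subseteq> {1..<n}"
  using red_word_letters by blast

lemma perm_adj: "w \<in> perms \<Longrightarrow> 1 \<le> i \<Longrightarrow> i < n \<Longrightarrow> w \<circ> adj i \<in> perms"
  using permutes_compose[OF adj_permutes] by blast

lemma perm_cmp: "w \<in> perms \<Longrightarrow> \<not> w i < w (i + 1) \<Longrightarrow> (w \<circ> adj i) i < (w \<circ> adj i) (i + 1)"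
proof -
  assume w: "w \<in> perms" "\<not> w i < w (i + 1)"
  then have "w permutes {1..n}" by simp
  then have "w i \<noteq> w (i + 1)" using injD[OF permutes_inj, of w "{1..n}" i "i + 1"] by auto
  then show ?thesis using w by simp
qed

lemma mP_hom: "w \<in> perms \<Longrightarrow> group_hom K K (mP w)"
  by (rule Phi_group_hom[OF red_word_perm_letters])

lemma mP_closed: "w \<in> perms \<Longrightarrow> k \<in> carrier K \<Longrightarrow> mP w k \<in> carrier K"
  by (rule Phi_closed[OF red_word_perm_letters])

lemma mB_closed: "w \<in> perms \<Longrightarrow> mB w \<in> carrier G"
  by (rule B.ev_closed[OF red_word_perm_letters])

lemma mP_up:
  "w \<in> perms \<Longrightarrow> 1 \<le> i \<Longrightarrow> i < n \<Longrightarrow> w i < w (i + 1) \<Longrightarrow> mP (w \<circ> adj i) k = mP w (s_map i k)"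
  by (rule Phi_red_word_adj) auto

lemma mB_up:
  "w \<in> perms \<Longrightarrow> 1 \<le> i \<Longrightarrow> i < n \<Longrightarrow> w i < w (i + 1) \<Longrightarrow> mB (w \<circ> adj i) = mB w \<otimes>\<^bsub>G\<^esub> sigma n i"
  by (rule B.ev_red_word_adj) auto

lemma mP_down:
  assumes "w \<in> perms" "1 \<le> i" "i < n" "\<not> w i < w (i + 1)"
  shows "mP w k = mP (w \<circ> adj i) (s_map i k)"
  using mP_up[OF perm_adj[OF assms(1-3)] assms(2,3) perm_cmp[OF assms(1,4)]] by (simp only: adj_adj)

lemma mB_down:
  assumes "w \<in> perms" "1 \<le> i" "i < n" "\<not> w i < w (i + 1)"
  shows "mB w = mB (w \<circ> adj i) \<otimes>\<^bsub>G\<^esub> sigma n i"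
  using mB_up[OF perm_adj[OF assms(1-3)] assms(2,3) perm_cmp[OF assms(1,4)]] by (simp only: adj_adj)

text \<open>
  The lift to \<open>K\<close> of \<open>x \<sigma>\<^sub>i\<^sup>-\<^sup>1\<close> (ascending case) and of \<open>\<sigma>\<^sub>i x\<close> (descending case),
  for \<open>x\<close> one of \<open>\<sigma>\<^sub>i\<close>, \<open>\<tau>\<^sub>i\<close>.
\<close>

fun local_lift :: "bool \<Rightarrow> sgen \<Rightarrow> label word set" where
  "local_lift up (Sigma i) = (if up then \<one>\<^bsub>K\<^esub> else kA i)"
| "local_lift up (Tau i) = (if up then kB i \<otimes>\<^bsub>K\<^esub> inv\<^bsub>K\<^esub> (kA i) else kB i)"

text \<open>In the ascending case the braid of \<open>w \<circ> adj i\<close> is \<open>mB w\<close>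
  times \<open>sigma n i\<close>; in the descending case the roles are exchanged. The local lift is
  always conjugated by the shorter of the two braids.\<close>

definition cocycle :: "(nat \<Rightarrow> nat) \<Rightarrow> sgen \<Rightarrow> label word set" where
  "cocycle w x = (let i = sgen_index x in
     if w i < w (i + 1) then mP w (local_lift True x) else mP (w \<circ> adj i) (local_lift False x))"

text \<open>The pair \<open>(k, w)\<close> stands for \<open>p k\<close> times \<open>mB w\<close>,
  and letters act by right multiplication. For an inverse letter the cocycle is taken at the target
  permutation, since the step from there back to \<open>w\<close> is the one to be inverted.\<close>

fun act1 :: "label word set \<times> (nat \<Rightarrow> nat) \<Rightarrow> sgen \<times> bool \<Rightarrow> label word set \<times> (nat \<Rightarrow> nat)" where
  "act1 (k, w) (x, e) = (let w' = w \<circ> adj (sgen_index x) in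
     (if e then k \<otimes>\<^bsub>K\<^esub> cocycle w x else k \<otimes>\<^bsub>K\<^esub> inv\<^bsub>K\<^esub> (cocycle w' x), w'))"

definition act :: "sgen word \<Rightarrow> label word set \<times> (nat \<Rightarrow> nat) \<Rightarrow> label word set \<times> (nat \<Rightarrow> nat)" where
  "act u \<omega> = foldl act1 \<omega> u"

section \<open>The action of words covers right multiplication\<close>

lemma act_Nil [simp]: "act [] \<omega> = \<omega>"
  and act_Cons [simp]: "act (a # u) \<omega> = act u (act1 \<omega> a)"
  and act_append: "act (u @ v) \<omega> = act v (act u \<omega>)"
  by (simp_all add: act_def)

lemma sg_gens_index: "x \<in> sg_gens n \<Longrightarrow> 1 \<le> sgen_index x \<and> sgen_index x < n"
  by (cases x) (auto simp: sg_gens_def)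

lemma selt_index: "selt x = (case x of Sigma i \<Rightarrow> sigma n i | Tau i \<Rightarrow> tau n i)"
  by (cases x) (simp_all add: sigma_def tau_def)

lemma selt_closed: "x \<in> sg_gens n \<Longrightarrow> selt x \<in> carrier G"
  using sg.gen_closed by (simp add: SG_def)

lemma local_lift_in_kpetal:
  assumes "sgen_index x \<in> T" "sgen_index x + 1 \<in> T" "T \<subseteq> {1..n}"
  shows "local_lift e x \<in> kpetal T"
proof -
  have sg: "subgroup (kpetal T) K" by (rule kpetal_subgroup[OF assms(3)])
  show ?thesis
    using assms kAB_in_kpetal[of "sgen_index x" T] subgroup.one_closed[OF sg]
      subgroup.m_closed[OF sg] subgroup.m_inv_closed[OF sg]
    by (cases x) simp_all
qed

lemma local_lift_closed: "x \<in> sg_gens n \<Longrightarrow> local_lift e x \<in> carrier K"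
  using local_lift_in_kpetal[of x "{1..n}" e] sg_gens_index[of x] kpetal_carrier[of "{1..n}"] by simp

lemma cocycle_closed: "x \<in> sg_gens n \<Longrightarrow> w \<in> perms \<Longrightarrow> cocycle w x \<in> carrier K"
  using sg_gens_index[of x] perm_adj[of w "sgen_index x"] mP_closed local_lift_closed[of x]
  by (simp add: cocycle_def Let_def)

lemma p_local_lift:
  assumes "x \<in> sg_gens n"
  shows "p (local_lift True x) \<otimes>\<^bsub>G\<^esub> sigma n (sgen_index x) = selt x"
    and "p (local_lift False x) = sigma n (sgen_index x) \<otimes>\<^bsub>G\<^esub> selt x"
proof -
  have i: "1 \<le> sgen_index x" "sgen_index x < n" using sg_gens_index[OF assms] by auto
  show "p (local_lift True x) \<otimes>\<^bsub>G\<^esub> sigma n (sgen_index x) = selt x"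
  proof (cases x)
    case (Tau j)
    let ?s = "sigma n j" and ?t = "tau n j"
    have cl: "?s \<in> carrier G" "?t \<in> carrier G" using i Tau by simp_all
    have "p (local_lift True x) \<otimes>\<^bsub>G\<^esub> ?s = ?t \<otimes>\<^bsub>G\<^esub> ?s \<otimes>\<^bsub>G\<^esub> inv\<^bsub>G\<^esub> (?s \<otimes>\<^bsub>G\<^esub> ?s) \<otimes>\<^bsub>G\<^esub> ?s"
      using i Tau by (simp add: p_kA p_kB)
    also have "\<dots> = ?t" using cl by (simp add: G.inv_mult_group G.m_assoc G.inv_solve_left)
    finally show ?thesis using Tau by (simp add: selt_index)
  qed (use i in \<open>simp add: selt_index\<close>)
  show "p (local_lift False x) = sigma n (sgen_index x) \<otimes>\<^bsub>G\<^esub> selt x"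
    using i xelt_sigma[of "sgen_index x" False] by (cases x) (simp_all add: selt_index p_kA p_kB xelt_def)
qed

lemma p_mP: "w \<in> perms \<Longrightarrow> k \<in> carrier K \<Longrightarrow> p (mP w k) \<otimes>\<^bsub>G\<^esub> mB w = mB w \<otimes>\<^bsub>G\<^esub> p k"
  using p_Phi[OF red_word_perm_letters] mB_closed[of w] by (simp add: conj_by_def G.m_assoc)

lemma p_cocycle:
  assumes x: "x \<in> sg_gens n" and w: "w \<in> perms"
  shows "p (cocycle w x) \<otimes>\<^bsub>G\<^esub> mB (w \<circ> adj (sgen_index x)) = mB w \<otimes>\<^bsub>G\<^esub> selt x"
proof -
  let ?i = "sgen_index x"
  have i: "1 \<le> ?i" "?i < n" using sg_gens_index[OF x] by auto
  have ll: "local_lift e x \<in> carrier K" for e by (rule local_lift_closed[OF x])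
  show ?thesis
  proof (cases "w ?i < w (?i + 1)")
    case True
    have "p (mP w (local_lift True x)) \<otimes>\<^bsub>G\<^esub> mB (w \<circ> adj ?i)
        = p (mP w (local_lift True x)) \<otimes>\<^bsub>G\<^esub> mB w \<otimes>\<^bsub>G\<^esub> sigma n ?i"
      using mB_up[OF w i True] mB_closed[OF w] mP_closed[OF w ll] i by (simp only: G.m_assoc sigma_closed p.hom_closed)
    also have "\<dots> = mB w \<otimes>\<^bsub>G\<^esub> p (local_lift True x) \<otimes>\<^bsub>G\<^esub> sigma n ?i"
      by (simp only: p_mP[OF w ll])
    also have "\<dots> = mB w \<otimes>\<^bsub>G\<^esub> selt x"
      using p_local_lift(1)[OF x] mB_closed[OF w] i ll by (simp only: G.m_assoc sigma_closed p.hom_closed)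
    finally show ?thesis using True by (simp only: cocycle_def Let_def if_True)
  next
    case False
    have w': "w \<circ> adj ?i \<in> perms" by (rule perm_adj[OF w i])
    have "p (mP (w \<circ> adj ?i) (local_lift False x)) \<otimes>\<^bsub>G\<^esub> mB (w \<circ> adj ?i)
        = mB (w \<circ> adj ?i) \<otimes>\<^bsub>G\<^esub> (sigma n ?i \<otimes>\<^bsub>G\<^esub> selt x)"
      by (simp only: p_mP[OF w' ll] p_local_lift(2)[OF x])
    also have "\<dots> = mB w \<otimes>\<^bsub>G\<^esub> selt x"
      using mB_down[OF w i False] mB_closed[OF w'] selt_closed[OF x] i by (simp only: G.m_assoc sigma_closed)
    finally show ?thesis using False by (simp only: cocycle_def Let_def if_False)
  qed
qed

abbreviation "Omega \<equiv> carrier K \<times> perms"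

lemma act1_closed: "x \<in> sg_gens n \<Longrightarrow> \<omega> \<in> Omega \<Longrightarrow> act1 \<omega> (x, e) \<in> Omega"
proof (cases \<omega>)
  case (Pair k w)
  assume a: "x \<in> sg_gens n" "\<omega> \<in> Omega"
  then have w: "w \<in> perms" "k \<in> carrier K" using Pair by auto
  have "w \<circ> adj (sgen_index x) \<in> perms" using perm_adj[OF w(1)] sg_gens_index[OF a(1)] by simp
  then show ?thesis using cocycle_closed[OF a(1)] w Pair by (simp add: Let_def)
qed

lemma act1_cancel:
  assumes x: "x \<in> sg_gens n" and "\<omega> \<in> Omega"
  shows "act1 (act1 \<omega> (x, e)) (x, \<not> e) = \<omega>"
proof (cases \<omega>)
  case (Pair k w)
  then have w: "w \<in> perms" "k \<in> carrier K" using assms by auto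
  have w': "w \<circ> adj (sgen_index x) \<in> perms" using perm_adj[OF w(1)] sg_gens_index[OF x] by simp
  show ?thesis
    using Pair cocycle_closed[OF x w(1)] cocycle_closed[OF x w'] w
    by (cases e) (simp_all add: Let_def k.K.m_assoc)
qed

lemma act_closed: "u \<in> words (sg_gens n) \<Longrightarrow> \<omega> \<in> Omega \<Longrightarrow> act u \<omega> \<in> Omega"
  by (induction arbitrary: \<omega> rule: words_induct) (use act1_closed in \<open>simp_all only: act_Nil act_Cons\<close>)

text \<open>For words with equal value and equal final permutation, this makes the first entries
  agree under \<open>p\<close>. Their equality in \<open>K\<close> itself is what the parabolic
  cosets are for.\<close>

lemma act_p:
  assumes "u \<in> words (sg_gens n)" "\<omega> \<in> Omega"
  shows "p (fst (act u \<omega>)) \<otimes>\<^bsub>G\<^esub> mB (snd (act u \<omega>)) = p (fst \<omega>) \<otimes>\<^bsub>G\<^esub> mB (snd \<omega>) \<otimes>\<^bsub>G\<^esub> word_eval G selt u"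
  using assms
proof (induction arbitrary: \<omega> rule: words_induct)
  case Nil
  then have "p (fst \<omega>) \<in> carrier G" "mB (snd \<omega>) \<in> carrier G" using mB_closed by auto
  then show ?case by simp
next
  case (Cons x e u)
  obtain k w where o: "\<omega> = (k, w)" by (cases \<omega>)
  then have w: "w \<in> perms" "k \<in> carrier K" using Cons.prems by auto
  let ?i = "sgen_index x" and ?w = "w \<circ> adj (sgen_index x)"
  have w': "?w \<in> perms" using perm_adj[OF w(1)] sg_gens_index[OF Cons.hyps(1)] by simp
  have c: "cocycle w x \<in> carrier K" "cocycle ?w x \<in> carrier K"
    using cocycle_closed[OF Cons.hyps(1)] w w' by simp_all
  note m = mB_closed[OF w(1)] mB_closed[OF w']
  have x: "selt x \<in> carrier G" by (rule selt_closed[OF Cons.hyps(1)])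
  have U: "word_eval G selt u \<in> carrier G"
    by (rule G.word_eval_in_carrier[OF selt_closed Cons.hyps(2)])
  have "p (fst (act1 \<omega> (x, e))) \<otimes>\<^bsub>G\<^esub> mB ?w
      = p k \<otimes>\<^bsub>G\<^esub> (mB w \<otimes>\<^bsub>G\<^esub> (if e then selt x else inv\<^bsub>G\<^esub> (selt x)))"
  proof (cases e)
    case True
    then show ?thesis
      using o w c m p_cocycle[OF Cons.hyps(1) w(1)] by (simp add: Let_def G.m_assoc)
  next
    case False
    have "p (cocycle ?w x) \<otimes>\<^bsub>G\<^esub> mB w = mB ?w \<otimes>\<^bsub>G\<^esub> selt x"
      using p_cocycle[OF Cons.hyps(1) w'] by (simp only: adj_adj)
    then have "inv\<^bsub>G\<^esub> (p (cocycle ?w x)) \<otimes>\<^bsub>G\<^esub> mB ?w = mB w \<otimes>\<^bsub>G\<^esub> inv\<^bsub>G\<^esub> (selt x)"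
      using m x c by (metis G.inv_closed G.inv_solve_left G.inv_solve_right G.m_assoc G.m_closed p.hom_closed)
    then show ?thesis using False o w c m by (simp add: Let_def G.m_assoc)
  qed
  then have "p (fst (act1 \<omega> (x, e))) \<otimes>\<^bsub>G\<^esub> mB (snd (act1 \<omega> (x, e)))
      = p k \<otimes>\<^bsub>G\<^esub> (mB w \<otimes>\<^bsub>G\<^esub> (if e then selt x else inv\<^bsub>G\<^esub> (selt x)))"
    using o by (simp add: Let_def)
  then show ?case
    using Cons.IH[OF act1_closed[OF Cons.hyps(1) Cons.prems, of e]] o w m x U by (simp add: G.m_assoc)
qed

text \<open>Positive words are enough here, since the defining relations have no inverse
  letters.\<close>

lemma act_perm:
  assumes "u \<in> words (sg_gens n)" "\<And>x e. (x, e) \<in> set u \<Longrightarrow> e"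
  shows "snd (act u \<omega>) = snd \<omega> \<circ> word_eval (sym_group n) sgen_perm u"
  using assms
proof (induction arbitrary: \<omega> rule: words_induct)
  case (Cons x e u)
  then have "e" by auto
  have "snd (act1 \<omega> (x, e)) = snd \<omega> \<circ> sgen_perm x" by (cases \<omega>; cases x) (simp_all add: Let_def)
  moreover have "snd (act u (act1 \<omega> (x, e))) = snd (act1 \<omega> (x, e)) \<circ> word_eval (sym_group n) sgen_perm u"
    by (rule Cons.IH) (use Cons.prems in auto)
  ultimately show ?case using \<open>e\<close> by (simp add: sym_group_mult comp_assoc)
qed (simp add: sym_group_one)

text \<open>
  The words in the letters \<open>J\<close> move the permutations of a coset \<open>C\<close> of the parabolic subgroup
  of \<open>J\<close>; after factoring out the minimal representative (the word \<open>l0\<close>) everything takes place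
  in a single petal.
\<close>

definition parabolic_coset :: "nat set \<Rightarrow> (nat \<Rightarrow> nat) set \<Rightarrow> nat list \<Rightarrow> bool" where
  "parabolic_coset J C l0 \<longleftrightarrow> set l0 \<subseteq> {1..<n} \<and> C \<subseteq> perms \<and> (\<forall>v\<in>C. \<forall>i\<in>J. v \<circ> adj i \<in> C) \<and>
     (\<forall>v\<in>C. \<exists>l. set l \<subseteq> J \<and> (\<forall>k. mP v k = Phi l0 (Phi l k)))"

text \<open>Each cocycle value along the word is \<open>Phi l0\<close> of an element of the petal of
  \<open>T\<close>, since the words attached to the coset and the local lifts use letters from
  \<open>J\<close> only. As \<open>Phi l0\<close> is a homomorphism, these values multiply to one of
  the same form.\<close>

lemma act_parabolic:
  assumes J: "J \<subseteq> {1..<n}" and T: "T \<subseteq> {1..n}" "\<And>i. i \<in> J \<Longrightarrow> i \<in> T \<and> i + 1 \<in> T"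
    and C: "parabolic_coset J C l0"
    and u: "\<And>x e. (x, e) \<in> set u \<Longrightarrow> e \<and> x \<in> sg_gens n \<and> sgen_index x \<in> J" and w: "w \<in> C"
  shows "\<exists>y\<in>kpetal T. \<forall>k\<in>carrier K. fst (act u (k, w)) = k \<otimes>\<^bsub>K\<^esub> Phi l0 y"
  using u w
proof (induction u arbitrary: w)
  case Nil
  have "Phi l0 \<one>\<^bsub>K\<^esub> = \<one>\<^bsub>K\<^esub>"
    using C group_hom.hom_one[OF Phi_group_hom] unfolding parabolic_coset_def by blast
  then show ?case
    using subgroup.one_closed[OF kpetal_subgroup[OF T(1)]] by (intro bexI[of _ "\<one>\<^bsub>K\<^esub>"]) simp_all
next
  case (Cons a u)
  obtain x e where a: "a = (x, e)" by (cases a)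
  let ?i = "sgen_index x"
  have x: "e" "x \<in> sg_gens n" "?i \<in> J" using Cons.prems(1)[of x e] a by auto
  have l0: "set l0 \<subseteq> {1..<n}" and CP: "C \<subseteq> perms" and cl: "\<And>v i. v \<in> C \<Longrightarrow> i \<in> J \<Longrightarrow> v \<circ> adj i \<in> C"
    and rep: "\<And>v. v \<in> C \<Longrightarrow> \<exists>l. set l \<subseteq> J \<and> (\<forall>k. mP v k = Phi l0 (Phi l k))"
    using C unfolding parabolic_coset_def by blast+
  have wx: "w \<circ> adj ?i \<in> C" by (rule cl[OF Cons.prems(2) x(3)])
  have sg: "subgroup (kpetal T) K" by (rule kpetal_subgroup[OF T(1)])
  have lift: "\<exists>y\<in>kpetal T. mP v (local_lift b x) = Phi l0 y" if v: "v \<in> C" for v b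
  proof -
    obtain l where l: "set l \<subseteq> J" "\<And>k. mP v k = Phi l0 (Phi l k)" using rep[OF v] by blast
    have "Phi l (local_lift b x) \<in> kpetal T"
    proof (rule Phi_in_kpetal)
      show "local_lift b x \<in> kpetal T" using T x by (intro local_lift_in_kpetal) simp_all
    qed (use l J T in auto)
    then show ?thesis using l(2) by blast
  qed
  have "\<exists>y\<in>kpetal T. cocycle w x = Phi l0 y"
    using lift[OF Cons.prems(2), of True] lift[OF wx, of False] by (simp add: cocycle_def Let_def)
  then obtain y where y: "y \<in> kpetal T" "cocycle w x = Phi l0 y" by blast
  have "\<exists>y'\<in>kpetal T. \<forall>k\<in>carrier K. fst (act u (k, w \<circ> adj ?i)) = k \<otimes>\<^bsub>K\<^esub> Phi l0 y'"
    by (rule Cons.IH[OF Cons.prems(1) wx]) auto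
  then obtain y' where y': "y' \<in> kpetal T" "\<And>k. k \<in> carrier K \<Longrightarrow> fst (act u (k, w \<circ> adj ?i)) = k \<otimes>\<^bsub>K\<^esub> Phi l0 y'"
    by blast
  have yc: "y \<in> carrier K" "y' \<in> carrier K" using y y' kpetal_carrier[OF T(1)] by blast+
  have hom: "group_hom K K (Phi l0)" by (rule Phi_group_hom[OF l0])
  show ?case
  proof (intro bexI ballI)
    show "y \<otimes>\<^bsub>K\<^esub> y' \<in> kpetal T" using y y' subgroup.m_closed[OF sg] by blast
    fix k assume k: "k \<in> carrier K"
    have Pc: "Phi l0 y \<in> carrier K" "Phi l0 y' \<in> carrier K" using Phi_closed[OF l0] yc by blast+
    have "fst (act (a # u) (k, w)) = k \<otimes>\<^bsub>K\<^esub> Phi l0 y \<otimes>\<^bsub>K\<^esub> Phi l0 y'"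
      using y'(2)[of "k \<otimes>\<^bsub>K\<^esub> Phi l0 y"] k Pc y(2) x(1) by (simp add: a Let_def)
    also have "\<dots> = k \<otimes>\<^bsub>K\<^esub> Phi l0 (y \<otimes>\<^bsub>K\<^esub> y')"
      using k Pc group_hom.hom_mult[OF hom yc] by (simp add: k.K.m_assoc)
    finally show "fst (act (a # u) (k, w)) = k \<otimes>\<^bsub>K\<^esub> Phi l0 (y \<otimes>\<^bsub>K\<^esub> y')" .
  qed
qed

text \<open>Both words multiply \<open>k\<close> by \<open>Phi l0\<close> of elements
  \<open>y\<close> and \<open>z\<close> of one petal. By \<open>act_p\<close> the images agree in
  \<open>SG n\<close>, where the conjugation can be cancelled although \<open>Phi l0\<close> is not
  known to be injective; then \<open>kpetal_inj\<close> gives \<open>y = z\<close>.\<close>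

lemma act_eq_of_parabolic:
  assumes J: "J \<subseteq> {1..<n}" and T: "T \<subseteq> {1..n}" "\<And>i. i \<in> J \<Longrightarrow> i \<in> T \<and> i + 1 \<in> T" "card T \<le> 4"
    and C: "parabolic_coset J C l0" "w \<in> C"
    and u: "\<And>x e. (x, e) \<in> set u \<Longrightarrow> e \<and> x \<in> sg_gens n \<and> sgen_index x \<in> J"
    and v: "\<And>x e. (x, e) \<in> set v \<Longrightarrow> e \<and> x \<in> sg_gens n \<and> sgen_index x \<in> J"
    and uv: "(u, v) \<in> sg_rels n" and k: "k \<in> carrier K"
  shows "act u (k, w) = act v (k, w)"
proof -
  have l0: "set l0 \<subseteq> {1..<n}" and w: "w \<in> perms" using C unfolding parabolic_coset_def by blast+
  obtain y where y: "y \<in> kpetal T" "fst (act u (k, w)) = k \<otimes>\<^bsub>K\<^esub> Phi l0 y"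
    using act_parabolic[OF J T(1,2) C(1) u C(2)] k by blast
  obtain z where z: "z \<in> kpetal T" "fst (act v (k, w)) = k \<otimes>\<^bsub>K\<^esub> Phi l0 z"
    using act_parabolic[OF J T(1,2) C(1) v C(2)] k by blast
  have yc: "y \<in> carrier K" "z \<in> carrier K" using y z kpetal_carrier[OF T(1)] by blast+
  have Pc: "Phi l0 y \<in> carrier K" "Phi l0 z \<in> carrier K" using Phi_closed[OF l0] yc by blast+
  have ww: "u \<in> words (sg_gens n)" "v \<in> words (sg_gens n)" using uv sg_rels_words by auto
  have s: "snd (act u (k, w)) = snd (act v (k, w))"
    using act_perm[OF ww(1) conjunct1[OF u]] act_perm[OF ww(2) conjunct1[OF v]] sgen_perm_rels[OF uv] by simp
  have O: "(k, w) \<in> Omega" using k w by simp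
  have "snd (act v (k, w)) \<in> perms" using act_closed[OF ww(2) O] by (cases "act v (k, w)") simp
  then have mc: "mB (snd (act v (k, w))) \<in> carrier G" by (rule mB_closed)
  have "p (k \<otimes>\<^bsub>K\<^esub> Phi l0 y) \<otimes>\<^bsub>G\<^esub> mB (snd (act v (k, w))) = p (k \<otimes>\<^bsub>K\<^esub> Phi l0 z) \<otimes>\<^bsub>G\<^esub> mB (snd (act v (k, w)))"
    using act_p[OF ww(1) O] act_p[OF ww(2) O] y(2) z(2) s rel_holds[OF uv] by simp
  then have "p k \<otimes>\<^bsub>G\<^esub> p (Phi l0 y) = p k \<otimes>\<^bsub>G\<^esub> p (Phi l0 z)"
    using mc k Pc G.right_cancel[of "p (k \<otimes>\<^bsub>K\<^esub> Phi l0 y)" "mB (snd (act v (k, w)))" "p (k \<otimes>\<^bsub>K\<^esub> Phi l0 z)"] by simp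
  then have "p (Phi l0 y) = p (Phi l0 z)" using k Pc by simp
  then have e: "cj (B.ev l0) (p y) = cj (B.ev l0) (p z)" by (simp only: p_Phi[OF l0] yc)
  have bc: "B.ev l0 \<in> carrier G" by (rule B.ev_closed[OF l0])
  have "p y = p z"
    using arg_cong[OF e, of "cj (inv\<^bsub>G\<^esub> (B.ev l0))"] G.conj_by_inv_cancel(2)[OF bc] yc by simp
  then have "y = z" by (rule kpetal_inj[OF T(1,3) y(1) z(1)])
  then show ?thesis using y z s by (simp add: prod_eq_iff)
qed

section \<open>Cosets of parabolic subgroups of rank at most two\<close>

lemma coset_step:
  assumes v: "v \<in> perms" "1 \<le> i" "i < n" "v i < v (i + 1)" and l: "\<And>k. mP v k = Phi l0 (Phi l k)"
  shows "mP (v \<circ> adj i) k = Phi l0 (Phi (l @ [i]) k)"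
  using mP_up[OF v] l by (simp add: Phi_append)

lemma parabolic_coset_single:
  assumes i: "1 \<le> i" "i < n" and w: "w \<in> perms"
  shows "\<exists>C l0. parabolic_coset {i} C l0 \<and> w \<in> C"
proof -
  \<comment> \<open>The shorter of the two elements of the coset.\<close>
  obtain w0 where w0: "w0 \<in> perms" "w0 i < w0 (i + 1)" "w = w0 \<or> w = w0 \<circ> adj i"
    using w perm_adj[OF w i] perm_cmp[OF w] adj_adj by metis
  have 1: "mP (w0 \<circ> adj i) k = mP w0 (Phi [i] k)" for k
    using coset_step[OF w0(1) i w0(2), of "red_word n w0" "[]"] by simp
  have "parabolic_coset {i} {w0, w0 \<circ> adj i} (red_word n w0)"
    unfolding parabolic_coset_def
  proof (intro conjI ballI)
    fix v assume "v \<in> {w0, w0 \<circ> adj i}"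
    then consider "v = w0" | "v = w0 \<circ> adj i" by blast
    then show "\<exists>l. set l \<subseteq> {i} \<and> (\<forall>k. mP v k = mP w0 (Phi l k))"
    proof cases
      case 1
      then show ?thesis by (intro exI[of _ "[]"]) simp
    next
      case 2
      then show ?thesis using 1 by (intro exI[of _ "[i]"]) (simp only:, simp)
    qed
  qed (use w0 red_word_perm_letters[OF w0(1)] perm_adj[OF w0(1) i] adj_adj in auto)
  then show ?thesis using w0(3) by blast
qed

lemma parabolic_coset_far:
  assumes i: "1 \<le> i" "i + 2 \<le> j" "j < n" and w: "w \<in> perms"
  shows "\<exists>C l0. parabolic_coset {i, j} C l0 \<and> w \<in> C"
proof -
  have i': "i < n" "1 \<le> j" using i by auto
  obtain w1 where w1: "w1 \<in> perms" "w1 i < w1 (i + 1)" "w = w1 \<or> w = w1 \<circ> adj i"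
    using w perm_adj[OF w i(1) i'(1)] perm_cmp[OF w] adj_adj by metis
  have sep: "(v \<circ> adj j) i = v i" "(v \<circ> adj j) (i + 1) = v (i + 1)"
    "(v \<circ> adj i) j = v j" "(v \<circ> adj i) (j + 1) = v (j + 1)" for v :: "nat \<Rightarrow> nat"
    using i(2) by (simp_all add: transpose_def)
  \<comment> \<open>Sorting at \<open>j\<close> does not disturb the values at \<open>i\<close> and
    \<open>i + 1\<close>, so \<open>w0\<close> ascends at both places.\<close>
  obtain w0 where w0: "w0 \<in> perms" "w0 j < w0 (j + 1)" "w0 i < w0 (i + 1)" "w1 = w0 \<or> w1 = w0 \<circ> adj j"
  proof (cases "w1 j < w1 (j + 1)")
    case False
    show ?thesis
    proof (rule that)
      show "w1 \<circ> adj j \<in> perms" by (rule perm_adj[OF w1(1) i'(2) i(3)])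
      show "(w1 \<circ> adj j) j < (w1 \<circ> adj j) (j + 1)" by (rule perm_cmp[OF w1(1) False])
      show "(w1 \<circ> adj j) i < (w1 \<circ> adj j) (i + 1)" using w1(2) by (simp only: sep)
      show "w1 = w1 \<circ> adj j \<or> w1 = w1 \<circ> adj j \<circ> adj j" by (simp only: adj_adj simp_thms)
    qed
  qed (use w1 in blast)
  let ?C = "{w0, w0 \<circ> adj i, w0 \<circ> adj j, w0 \<circ> adj i \<circ> adj j}"
  have wC: "w \<in> ?C" using w1(3) w0(4) adj_commute[OF i(2), of w0] by auto
  have P: "w0 \<circ> adj i \<in> perms" "w0 \<circ> adj j \<in> perms" "w0 \<circ> adj i \<circ> adj j \<in> perms"
    using perm_adj[OF w0(1) i(1) i'(1)] perm_adj[OF w0(1) i'(2) i(3)] perm_adj[OF _ i'(2) i(3)] by blast+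
  have m0: "\<And>k. mP w0 k = mP w0 (Phi [] k)" by simp
  note m1 = coset_step[OF w0(1) i(1) i'(1) w0(3) m0]
  note m2 = coset_step[OF w0(1) i'(2) i(3) w0(2) m0]
  have "(w0 \<circ> adj i) j < (w0 \<circ> adj i) (j + 1)" using w0(2) by (simp only: sep)
  note m3 = coset_step[OF P(1) i'(2) i(3) this m1]
  have "parabolic_coset {i, j} ?C (red_word n w0)"
    unfolding parabolic_coset_def
  proof (intro conjI)
    show "set (red_word n w0) \<subseteq> {1..<n}" by (rule red_word_perm_letters[OF w0(1)])
    show "?C \<subseteq> perms" using w0(1) P by blast
    show "\<forall>v\<in>?C. \<forall>m\<in>{i, j}. v \<circ> adj m \<in> ?C"
      by (simp only: ball_simps insert_iff adj_commute[OF i(2)] adj_adj simp_thms)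
    show "\<forall>v\<in>?C. \<exists>l. set l \<subseteq> {i, j} \<and> (\<forall>k. mP v k = mP w0 (Phi l k))"
    proof
      fix v assume "v \<in> ?C"
      then consider "v = w0" | "v = w0 \<circ> adj i" | "v = w0 \<circ> adj j" | "v = w0 \<circ> adj i \<circ> adj j" by blast
      then show "\<exists>l. set l \<subseteq> {i, j} \<and> (\<forall>k. mP v k = mP w0 (Phi l k))"
      proof cases
        case 1 show ?thesis unfolding 1 by (intro exI conjI allI, rule_tac[2] m0) simp
      next
        case 2 show ?thesis unfolding 2 by (intro exI conjI allI, rule_tac[2] m1) simp
      next
        case 3 show ?thesis unfolding 3 by (intro exI conjI allI, rule_tac[2] m2) simp
      next
        case 4 show ?thesis unfolding 4 by (intro exI conjI allI, rule_tac[2] m3) simp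
      qed
    qed
  qed
  then show ?thesis using wC by blast
qed

text \<open>The minimal representative \<open>w0\<close> has the values of \<open>w\<close> at
  \<open>i\<close>, \<open>i + 1\<close>, \<open>i + 2\<close> in increasing order. The six possible
  orders are the six elements of the coset, and each is reached from \<open>w0\<close> by ascending
  steps.\<close>

lemma parabolic_coset_braid:
  assumes i: "1 \<le> i" "i + 1 < n" and w: "w \<in> perms"
  shows "\<exists>C l0. parabolic_coset {i, i + 1} C l0 \<and> w \<in> C"
proof -
  let ?a = "adj i" and ?b = "adj (i + 1)"
  have i': "i < n" "1 \<le> i + 1" using i by auto
  have va: "(v \<circ> ?a) i = v (i + 1)" "(v \<circ> ?a) (i + 1) = v i" "(v \<circ> ?a) (i + 1 + 1) = v (i + 1 + 1)"
    and vb: "(v \<circ> ?b) i = v i" "(v \<circ> ?b) (i + 1) = v (i + 1 + 1)" "(v \<circ> ?b) (i + 1 + 1) = v (i + 1)"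
    for v :: "nat \<Rightarrow> nat" by (simp_all add: transpose_def)
  have pa: "v \<circ> ?a \<in> perms" and pb: "v \<circ> ?b \<in> perms" if "v \<in> perms" for v
    using perm_adj[OF that] i i' by blast+
  have inj: "inj w" using permutes_inj w by simp
  have d: "w i \<noteq> w (i + 1)" "w i \<noteq> w (i + 1 + 1)" "w (i + 1) \<noteq> w (i + 1 + 1)"
    using inj_eq[OF inj] by simp_all
  define S where "S v \<longleftrightarrow> v \<in> perms \<and> v i < v (i + 1) \<and> v (i + 1) < v (i + 1 + 1)" for v
  have "S w \<or> S (w \<circ> ?a) \<or> S (w \<circ> ?b) \<or> S (w \<circ> ?a \<circ> ?b) \<or> S (w \<circ> ?b \<circ> ?a) \<or> S (w \<circ> ?a \<circ> ?b \<circ> ?a)"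
  proof -
    have "S (w \<circ> ?a) \<longleftrightarrow> w (i + 1) < w i \<and> w i < w (i + 1 + 1)"
      "S (w \<circ> ?b) \<longleftrightarrow> w i < w (i + 1 + 1) \<and> w (i + 1 + 1) < w (i + 1)"
      "S (w \<circ> ?a \<circ> ?b) \<longleftrightarrow> w (i + 1) < w (i + 1 + 1) \<and> w (i + 1 + 1) < w i"
      "S (w \<circ> ?b \<circ> ?a) \<longleftrightarrow> w (i + 1 + 1) < w i \<and> w i < w (i + 1)"
      "S (w \<circ> ?a \<circ> ?b \<circ> ?a) \<longleftrightarrow> w (i + 1 + 1) < w (i + 1) \<and> w (i + 1) < w i"
      "S w \<longleftrightarrow> w i < w (i + 1) \<and> w (i + 1) < w (i + 1 + 1)"
      unfolding S_def va vb using w pa pb by (simp_all only: simp_thms)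
    then show ?thesis using three_orders[OF d] by blast
  qed
  then obtain w0 where S0: "S w0" and
    "w0 = w \<or> w0 = w \<circ> ?a \<or> w0 = w \<circ> ?b \<or> w0 = w \<circ> ?a \<circ> ?b \<or> w0 = w \<circ> ?b \<circ> ?a \<or> w0 = w \<circ> ?a \<circ> ?b \<circ> ?a"
    by blast
  then have w0w: "w0 = w \<or> w0 = w \<circ> ?a \<or> w0 = w \<circ> ?b \<or> w0 = w \<circ> ?a \<circ> ?b \<or> w0 = w \<circ> ?b \<circ> ?a \<or> w0 = w \<circ> ?a \<circ> ?b \<circ> ?a"
    by blast
  have ww: "w = w0 \<or> w = w0 \<circ> ?a \<or> w = w0 \<circ> ?b \<or> w = w0 \<circ> ?b \<circ> ?a \<or> w = w0 \<circ> ?a \<circ> ?b \<or> w = w0 \<circ> ?a \<circ> ?b \<circ> ?a"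
    using w0w by (elim disjE; hypsubst; simp only: adj_adj simp_thms)
  have w0: "w0 \<in> perms" and lt: "w0 i < w0 (i + 1)" "w0 (i + 1) < w0 (i + 1 + 1)" "w0 i < w0 (i + 1 + 1)"
    using S0 unfolding S_def by auto
  let ?C = "{w0, w0 \<circ> ?a, w0 \<circ> ?b, w0 \<circ> ?a \<circ> ?b, w0 \<circ> ?b \<circ> ?a, w0 \<circ> ?a \<circ> ?b \<circ> ?a}"
  have wC: "w \<in> ?C" using ww by blast
  have m0: "\<And>k. mP w0 k = mP w0 (Phi [] k)" by simp
  note ia = i(1) i'(1) and ib = i'(2) i(2)
  note m1 = coset_step[OF w0 ia lt(1) m0]
  note m2 = coset_step[OF w0 ib lt(2) m0]
  have "(w0 \<circ> ?a) (i + 1) < (w0 \<circ> ?a) (i + 1 + 1)" using lt by (simp only: va)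
  note m3 = coset_step[OF pa[OF w0] ib this m1]
  have "(w0 \<circ> ?b) i < (w0 \<circ> ?b) (i + 1)" using lt by (simp only: vb)
  note m4 = coset_step[OF pb[OF w0] ia this m2]
  have "(w0 \<circ> ?a \<circ> ?b) i < (w0 \<circ> ?a \<circ> ?b) (i + 1)" using lt by (simp only: vb va)
  note m5 = coset_step[OF pb[OF pa[OF w0]] ia this m3]
  have "parabolic_coset {i, i + 1} ?C (red_word n w0)"
    unfolding parabolic_coset_def
  proof (intro conjI)
    show "set (red_word n w0) \<subseteq> {1..<n}" by (rule red_word_perm_letters[OF w0])
    show "?C \<subseteq> perms" using w0 pa pb by blast
    \<comment> \<open>Products that leave the list are led back into it by
      \<open>adj_braid\<close>.\<close>
    show "\<forall>v\<in>?C. \<forall>m\<in>{i, i + 1}. v \<circ> adj m \<in> ?C"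
      by (simp only: ball_simps insert_iff adj_braid adj_adj simp_thms)
    show "\<forall>v\<in>?C. \<exists>l. set l \<subseteq> {i, i + 1} \<and> (\<forall>k. mP v k = mP w0 (Phi l k))"
    proof
      fix v assume "v \<in> ?C"
      then consider "v = w0" | "v = w0 \<circ> ?a" | "v = w0 \<circ> ?b" | "v = w0 \<circ> ?a \<circ> ?b" | "v = w0 \<circ> ?b \<circ> ?a"
        | "v = w0 \<circ> ?a \<circ> ?b \<circ> ?a" by blast
      then show "\<exists>l. set l \<subseteq> {i, i + 1} \<and> (\<forall>k. mP v k = mP w0 (Phi l k))"
      proof cases
        case 1 show ?thesis unfolding 1 by (intro exI conjI allI, rule_tac[2] m0) simp
      next
        case 2 show ?thesis unfolding 2 by (intro exI conjI allI, rule_tac[2] m1) simp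
      next
        case 3 show ?thesis unfolding 3 by (intro exI conjI allI, rule_tac[2] m2) simp
      next
        case 4 show ?thesis unfolding 4 by (intro exI conjI allI, rule_tac[2] m3) simp
      next
        case 5 show ?thesis unfolding 5 by (intro exI conjI allI, rule_tac[2] m4) simp
      next
        case 6 show ?thesis unfolding 6 by (intro exI conjI allI, rule_tac[2] m5) simp
      qed
    qed
  qed
  then show ?thesis using wC by blast
qed

section \<open>Descent of the action to the singular braid group\<close>

lemma sg_gens_iff: "Sigma i \<in> sg_gens n \<longleftrightarrow> 1 \<le> i \<and> i < n" "Tau i \<in> sg_gens n \<longleftrightarrow> 1 \<le> i \<and> i < n"
  by (auto simp: sg_gens_def)

lemma act_rel:
  assumes uv: "(u, v) \<in> sg_rels n" and o: "\<omega> \<in> Omega"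
  shows "act u \<omega> = act v \<omega>"
proof -
  obtain k w where kw: "\<omega> = (k, w)" "k \<in> carrier K" "w \<in> perms" using o by blast
  define ok where "ok J = {x \<in> sg_gens n. sgen_index x \<in> J} \<times> {True}" for J
  have local: "act u \<omega> = act v \<omega>"
    if H: "J \<subseteq> {1..<n}" "T \<subseteq> {1..n}" "\<And>i. i \<in> J \<Longrightarrow> i \<in> T \<and> i + 1 \<in> T" "card T \<le> 4"
      "\<exists>C l0. parabolic_coset J C l0 \<and> w \<in> C" "set u \<subseteq> ok J" "set v \<subseteq> ok J" for J T
  proof -
    obtain C l0 where C: "parabolic_coset J C l0" "w \<in> C" using H(5) by blast
    show ?thesis unfolding kw(1)
      by (rule act_eq_of_parabolic[OF H(1-4) C _ _ uv kw(2)])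
        (use H(6,7) in \<open>auto simp: ok_def\<close>)
  qed
  have len3: ?thesis if i: "1 \<le> i" "i + 2 \<le> n" and "set u \<subseteq> ok {i, i + 1}" "set v \<subseteq> ok {i, i + 1}" for i
  \<comment> \<open>Strand \<open>i + 2\<close> is listed twice so that
    \<open>card_insert4_le\<close> applies.\<close>
  proof (rule local[where T = "{i, i + 1, i + 2, i + 2}"])
    show "card {i, i + 1, i + 2, i + 2} \<le> 4" by (rule card_insert4_le)
    show "\<exists>C l0. parabolic_coset {i, i + 1} C l0 \<and> w \<in> C"
      using i kw(3) by (intro parabolic_coset_braid) simp_all
  qed (use that in auto)
  have far': ?thesis
    if i: "1 \<le> i" "i + 2 \<le> j" "j < n" and "set u \<subseteq> ok {i, j}" "set v \<subseteq> ok {i, j}" for i j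
  proof (rule local[where T = "{i, i + 1, j, j + 1}"])
    show "\<exists>C l0. parabolic_coset {i, j} C l0 \<and> w \<in> C" by (rule parabolic_coset_far[OF i kw(3)])
    show "card {i, i + 1, j, j + 1} \<le> 4" by (rule card_insert4_le)
  qed (use that in auto)
  have far: ?thesis
    if i: "i \<in> {1..<n}" "j \<in> {1..<n}" "2 \<le> \<bar>int i - int j\<bar>" and s: "set u \<subseteq> ok {i, j}" "set v \<subseteq> ok {i, j}" for i j
  proof (cases "i < j")
    case True
    then show ?thesis using i by (intro far'[OF _ _ _ s]) simp_all
  next
    case False
    have s': "set u \<subseteq> ok {j, i}" "set v \<subseteq> ok {j, i}" using s by (simp_all add: insert_commute)
    show ?thesis using i False by (intro far'[OF _ _ _ s']) simp_all
  qed
  have single: ?thesis if i: "i \<in> {1..<n}" and s: "set u \<subseteq> ok {i}" "set v \<subseteq> ok {i}" for i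
  proof (rule local[where T = "{i, i + 1}"])
    show "\<exists>C l0. parabolic_coset {i} C l0 \<and> w \<in> C" using i by (intro parabolic_coset_single[OF _ _ kw(3)]) simp_all
  qed (use i s in auto)
  show ?thesis
    using uv unfolding sg_rels_def
  proof (elim UnE CollectE exE conjE)
    fix i assume "(u, v) = ([s_ltr i, s_ltr (i+1), s_ltr i], [s_ltr (i+1), s_ltr i, s_ltr (i+1)])" "1 \<le> i" "i + 2 \<le> n"
    then show ?thesis by (intro len3[of i]) (simp_all add: ok_def sg_gens_iff)
  next
    fix i j assume "(u, v) = ([s_ltr i, s_ltr j], [s_ltr j, s_ltr i])" "i \<in> {1..<n}" "j \<in> {1..<n}" "2 \<le> \<bar>int i - int j\<bar>"
    then show ?thesis by (intro far[of i j]) (simp_all add: ok_def sg_gens_iff)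
  next
    fix i j assume "(u, v) = ([t_ltr i, t_ltr j], [t_ltr j, t_ltr i])" "i \<in> {1..<n}" "j \<in> {1..<n}" "2 \<le> \<bar>int i - int j\<bar>"
    then show ?thesis by (intro far[of i j]) (simp_all add: ok_def sg_gens_iff)
  next
    fix i j assume "(u, v) = ([t_ltr i, s_ltr j], [s_ltr j, t_ltr i])" "i \<in> {1..<n}" "j \<in> {1..<n}" "2 \<le> \<bar>int i - int j\<bar>"
    then show ?thesis by (intro far[of i j]) (simp_all add: ok_def sg_gens_iff)
  next
    fix i assume "(u, v) = ([t_ltr i, s_ltr i], [s_ltr i, t_ltr i])" "i \<in> {1..<n}"
    then show ?thesis by (intro single[of i]) (simp_all add: ok_def sg_gens_iff)
  next
    fix i assume "(u, v) = ([s_ltr i, s_ltr (i+1), t_ltr i], [t_ltr (i+1), s_ltr i, s_ltr (i+1)])" "1 \<le> i" "i + 2 \<le> n"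
    then show ?thesis by (intro len3[of i]) (simp_all add: ok_def sg_gens_iff)
  next
    fix i assume "(u, v) = ([s_ltr (i+1), s_ltr i, t_ltr (i+1)], [t_ltr i, s_ltr (i+1), s_ltr i])" "1 \<le> i" "i + 2 \<le> n"
    then show ?thesis by (intro len3[of i]) (simp_all add: ok_def sg_gens_iff)
  qed
qed

lemma act_cong: "pres_cong (sg_gens n) (sg_rels n) u v \<Longrightarrow> \<omega> \<in> Omega \<Longrightarrow> act u \<omega> = act v \<omega>"
proof (induction arbitrary: \<omega> rule: pres_cong.induct)
  case (cancel q r x e)
  then have "act q \<omega> \<in> Omega" using act_closed by blast
  then show ?case using act1_cancel[OF cancel(3)] by (simp only: act_append act_Cons act_Nil)
next
  case (rel q r u v)
  then have "act q \<omega> \<in> Omega" using act_closed by blast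
  then show ?case using act_rel[OF rel(3)] by (simp only: act_append)
qed simp_all

text \<open>\<open>m\<^sub>w k = (m\<^sub>w k m\<^sub>w\<^sup>-\<^sup>1) m\<^sub>w\<close> holds for the action, not just in the group.\<close>

definition tracks :: "label word set \<Rightarrow> bool" where
  "tracks k \<longleftrightarrow> (\<forall>u\<in>words (sg_gens n). word_eval G selt u = p k \<longrightarrow>
     (\<forall>h\<in>carrier K. \<forall>w\<in>perms. act u (h, w) = (h \<otimes>\<^bsub>K\<^esub> mP w k, w)))"

section \<open>Injectivity of \<open>p\<close>\<close>

lemma act_eq_of_eval:
  assumes "u \<in> words (sg_gens n)" "v \<in> words (sg_gens n)" "word_eval G selt u = word_eval G selt v" "\<omega> \<in> Omega"
  shows "act u \<omega> = act v \<omega>"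
  using act_cong[OF _ assms(4)] sg.word_eval_gen_eq_iff[OF assms(1,2)] assms(3) by (simp add: SG_def)

text \<open>The action depends on the value of a word only, so one word for \<open>p k\<close>
  decides.\<close>

lemma tracksI:
  assumes "u \<in> words (sg_gens n)" "word_eval G selt u = p k"
    "\<And>h w. h \<in> carrier K \<Longrightarrow> w \<in> perms \<Longrightarrow> act u (h, w) = (h \<otimes>\<^bsub>K\<^esub> mP w k, w)"
  shows "tracks k"
  unfolding tracks_def
proof (intro ballI impI)
  fix v h w assume v: "v \<in> words (sg_gens n)" "word_eval G selt v = p k" and h: "h \<in> carrier K" "w \<in> perms"
  have "act v (h, w) = act u (h, w)"
    by (rule act_eq_of_eval) (use v h assms in simp_all)
  then show "act v (h, w) = (h \<otimes>\<^bsub>K\<^esub> mP w k, w)" using assms(3)[OF h] by simp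
qed

lemma tracksD:
  "tracks k \<Longrightarrow> u \<in> words (sg_gens n) \<Longrightarrow> word_eval G selt u = p k \<Longrightarrow> h \<in> carrier K \<Longrightarrow> w \<in> perms \<Longrightarrow>
    act u (h, w) = (h \<otimes>\<^bsub>K\<^esub> mP w k, w)"
  unfolding tracks_def by blast

lemma word_of_elt:
  assumes "g \<in> carrier G"
  obtains u where "u \<in> words (sg_gens n)" "word_eval G selt u = g"
  using sg.carrierE_word assms by (metis SG_def)

lemma eval_append:
  "u \<in> words (sg_gens n) \<Longrightarrow> v \<in> words (sg_gens n) \<Longrightarrow>
    word_eval G selt (u @ v) = word_eval G selt u \<otimes>\<^bsub>G\<^esub> word_eval G selt v"
  by (rule G.word_eval_append_gens[of "sg_gens n"]) (simp_all add: selt_closed)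

lemma tracks_one: "tracks \<one>\<^bsub>K\<^esub>"
  by (rule tracksI[of "[]"]) (use group_hom.hom_one[OF mP_hom] in simp_all)

lemma tracks_mult:
  assumes k: "k \<in> carrier K" "k' \<in> carrier K" and t: "tracks k" "tracks k'"
  shows "tracks (k \<otimes>\<^bsub>K\<^esub> k')"
proof -
  obtain u where u: "u \<in> words (sg_gens n)" "word_eval G selt u = p k" by (rule word_of_elt[OF p.hom_closed[OF k(1)]])
  obtain v where v: "v \<in> words (sg_gens n)" "word_eval G selt v = p k'" by (rule word_of_elt[OF p.hom_closed[OF k(2)]])
  show ?thesis
  proof (rule tracksI)
    show "u @ v \<in> words (sg_gens n)" using u v by simp
    show "word_eval G selt (u @ v) = p (k \<otimes>\<^bsub>K\<^esub> k')" using u v k by (simp add: eval_append)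
    fix h w assume h: "h \<in> carrier K" "w \<in> perms"
    have m: "mP w k \<in> carrier K" "mP w k' \<in> carrier K" using mP_closed[OF h(2)] k by blast+
    have "act (u @ v) (h, w) = act v (h \<otimes>\<^bsub>K\<^esub> mP w k, w)"
      using tracksD[OF t(1) u h] by (simp only: act_append)
    also have "\<dots> = (h \<otimes>\<^bsub>K\<^esub> mP w k \<otimes>\<^bsub>K\<^esub> mP w k', w)"
      using h m by (intro tracksD[OF t(2) v]) simp_all
    finally show "act (u @ v) (h, w) = (h \<otimes>\<^bsub>K\<^esub> mP w (k \<otimes>\<^bsub>K\<^esub> k'), w)"
      using h m group_hom.hom_mult[OF mP_hom[OF h(2)] k] by (simp add: k.K.m_assoc)
  qed
qed

text \<open>A word for the inverse followed by a word for \<open>k\<close> acts like the empty word;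
  the known action of the second word then determines that of the first.\<close>

lemma tracks_inv:
  assumes k: "k \<in> carrier K" and t: "tracks k"
  shows "tracks (inv\<^bsub>K\<^esub> k)"
proof -
  obtain u where u: "u \<in> words (sg_gens n)" "word_eval G selt u = p k" by (rule word_of_elt[OF p.hom_closed[OF k]])
  obtain v where v: "v \<in> words (sg_gens n)" "word_eval G selt v = p (inv\<^bsub>K\<^esub> k)"
    by (rule word_of_elt[OF p.hom_closed[OF k.K.inv_closed[OF k]]])
  show ?thesis
  proof (rule tracksI[OF v])
    fix h w assume h: "h \<in> carrier K" "w \<in> perms"
    then obtain h' w' where a: "act v (h, w) = (h', w')" "h' \<in> carrier K" "w' \<in> perms"
      using act_closed[OF v(1), of "(h, w)"] by (cases "act v (h, w)") auto
    have "act (v @ u) (h, w) = act [] (h, w)"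
      by (rule act_eq_of_eval) (use u v h k in \<open>simp_all add: eval_append\<close>)
    then have "(h' \<otimes>\<^bsub>K\<^esub> mP w' k, w') = (h, w)"
      using tracksD[OF t u a(2,3)] a(1) by (simp only: act_append act_Nil)
    then have w: "w' = w" and hh: "h = h' \<otimes>\<^bsub>K\<^esub> mP w k" by auto
    have "h' = h \<otimes>\<^bsub>K\<^esub> inv\<^bsub>K\<^esub> (mP w k)"
      unfolding hh using a(2) mP_closed[OF h(2) k] by (simp only: k.K.inv_solve_right k.K.m_closed)
    then show "act v (h, w) = (h \<otimes>\<^bsub>K\<^esub> mP w (inv\<^bsub>K\<^esub> k), w)"
      using a(1) w group_hom.hom_inv[OF mP_hom[OF h(2)] k] by simp
  qed
qed

lemma s_map_kB: "1 \<le> i \<Longrightarrow> i < n \<Longrightarrow> s_map i (kB i) = kB i"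
proof -
  assume i: "1 \<le> i" "i < n"
  then have "(False, i, Suc i) \<in> L" by (simp add: mem_L)
  then show ?thesis unfolding kB_def using s_map_kgen[OF i] by (simp add: lab_swap.simps)
qed

lemma cocycle_up:
  "w (sgen_index x) < w (sgen_index x + 1) \<Longrightarrow> cocycle w x = mP w (local_lift True x)"
  by (simp add: cocycle_def)

lemma cocycle_down:
  "\<not> w (sgen_index x) < w (sgen_index x + 1) \<Longrightarrow>
    cocycle w x = mP (w \<circ> adj (sgen_index x)) (local_lift False x)"
  by (simp only: cocycle_def Let_def if_False)

text \<open>Meant for \<open>k\<close> one of \<open>kA i\<close>, \<open>kB i\<close>, with
  \<open>p k\<close> spelt by \<open>x\<close> followed by \<open>sigma n i\<close>. If the first
  step ascends, the two lifts multiply to \<open>k\<close> under \<open>mP w\<close>; if it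
  descends, the second lift is trivial, and the invariance of \<open>k\<close> under
  \<open>s_map i\<close> allows the passage from the shorter permutation to
  \<open>w\<close>.\<close>

lemma cocycle_sigma_pair:
  assumes x: "x \<in> sg_gens n" "sgen_index x = i" and w: "w \<in> perms"
    and e: "k = local_lift False x" "k = local_lift True x \<otimes>\<^bsub>K\<^esub> kA i" "s_map i k = k"
  shows "cocycle w x \<otimes>\<^bsub>K\<^esub> cocycle (w \<circ> adj i) (Sigma i) = mP w k"
proof -
  have i: "1 \<le> i" "i < n" using sg_gens_index[OF x(1)] x(2) by auto
  have w': "w \<circ> adj i \<in> perms" by (rule perm_adj[OF w i])
  have lc: "local_lift b x \<in> carrier K" for b by (rule local_lift_closed[OF x(1)])
  show ?thesis
  proof (cases "w i < w (i + 1)")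
    case True
    then have "\<not> (w \<circ> adj i) i < (w \<circ> adj i) (i + 1)" by simp
    then have "cocycle (w \<circ> adj i) (Sigma i) = mP w (kA i)"
      using cocycle_down[of "w \<circ> adj i" "Sigma i"] by (simp only: sgen_index.simps adj_adj local_lift.simps if_False not_False_eq_True simp_thms)
    moreover have "cocycle w x = mP w (local_lift True x)" using True cocycle_up x(2) by blast
    ultimately show ?thesis using e(2) group_hom.hom_mult[OF mP_hom[OF w]] lc i by simp
  next
    case False
    then have "(w \<circ> adj i) i < (w \<circ> adj i) (i + 1)" by (rule perm_cmp[OF w])
    then have "cocycle (w \<circ> adj i) (Sigma i) = \<one>\<^bsub>K\<^esub>"
      using cocycle_up[of "w \<circ> adj i" "Sigma i"] group_hom.hom_one[OF mP_hom[OF w']]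
      by (simp only: sgen_index.simps local_lift.simps if_True)
    moreover have "cocycle w x = mP (w \<circ> adj i) k" using False cocycle_down[of w x] x(2) e(1) by simp
    moreover have "mP w k = mP (w \<circ> adj i) k" using mP_down[OF w i False, of k] e(3) by simp
    moreover have "mP (w \<circ> adj i) k \<in> carrier K" using mP_closed[OF w'] lc e(1) by simp
    ultimately show ?thesis by simp
  qed
qed

lemma tracks_kAB:
  assumes i: "1 \<le> i" "i < n" shows "tracks (kA i)" "tracks (kB i)"
proof -
  have g: "Sigma i \<in> sg_gens n" "Tau i \<in> sg_gens n" using i by (auto simp: sg_gens_def)
  have *: "tracks k"
    if x: "x \<in> sg_gens n" "sgen_index x = i" and pk: "p k = selt x \<otimes>\<^bsub>G\<^esub> sigma n i"
      and e: "k = local_lift False x" "k = local_lift True x \<otimes>\<^bsub>K\<^esub> kA i" "s_map i k = k" for x k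
  proof (rule tracksI)
    show "[(x, True), (Sigma i, True)] \<in> words (sg_gens n)" using x g by simp
    show "word_eval G selt [(x, True), (Sigma i, True)] = p k"
      using pk selt_closed[OF x(1)] i by (simp add: selt_index[of "Sigma i"])
    fix h w assume h: "h \<in> carrier K" "w \<in> perms"
    have w': "w \<circ> adj i \<in> perms" by (rule perm_adj[OF h(2) i])
    have "act [(x, True), (Sigma i, True)] (h, w)
        = (h \<otimes>\<^bsub>K\<^esub> cocycle w x \<otimes>\<^bsub>K\<^esub> cocycle (w \<circ> adj i) (Sigma i), w)"
      using x(2) by (simp only: act_Cons act_Nil act1.simps Let_def if_True sgen_index.simps adj_adj)
    also have "\<dots> = (h \<otimes>\<^bsub>K\<^esub> mP w k, w)"
      using cocycle_sigma_pair[OF x h(2) e] h cocycle_closed[OF x(1) h(2)] cocycle_closed[OF g(1) w']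
      by (simp only: k.K.m_assoc)
    finally show "act [(x, True), (Sigma i, True)] (h, w) = (h \<otimes>\<^bsub>K\<^esub> mP w k, w)" .
  qed
  show "tracks (kA i)"
    by (rule *[of "Sigma i"]) (use i g s_map_kA[OF i] in \<open>simp_all add: p_kA selt_index\<close>)
  show "tracks (kB i)"
    by (rule *[of "Tau i"]) (use i g s_map_kB[OF i] in \<open>simp_all add: p_kB selt_index k.K.m_assoc\<close>)
qed

text \<open>If the step ascends, the cocycle is trivial and \<open>mP_up\<close> applies; if it
  descends, the cocycle comes from \<open>kA i\<close>, and \<open>s_map_square\<close> absorbs the
  conjugation by it.\<close>

lemma cocycle_conj:
  assumes i: "1 \<le> i" "i < n" and w: "w \<in> perms" and k: "k \<in> carrier K"
  shows "cocycle w (Sigma i) \<otimes>\<^bsub>K\<^esub> mP (w \<circ> adj i) k \<otimes>\<^bsub>K\<^esub> inv\<^bsub>K\<^esub> (cocycle w (Sigma i)) = mP w (s_map i k)"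
proof (cases "w i < w (i + 1)")
  case True
  then have "cocycle w (Sigma i) = \<one>\<^bsub>K\<^esub>"
    using cocycle_up[of w "Sigma i"] group_hom.hom_one[OF mP_hom[OF w]] by simp
  then show ?thesis
    using mP_up[OF w i True, of k] mP_closed[OF w s_map_closed[OF i k]] by simp
next
  case False
  let ?v = "w \<circ> adj i"
  have v: "?v \<in> perms" by (rule perm_adj[OF w i])
  have c: "cocycle w (Sigma i) = mP ?v (kA i)"
    using False cocycle_down[of w "Sigma i"] by (simp only: sgen_index.simps local_lift.simps if_False not_False_eq_True simp_thms)
  have "mP ?v (cK (kA i) k) = mP w (s_map i k)"
    using mP_down[OF w i False, of "s_map i k"] s_map_square[OF i k] by simp
  moreover have "mP ?v (cK (kA i) k) = cK (mP ?v (kA i)) (mP ?v k)"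
    using group_hom.conj_by_map[OF mP_hom[OF v]] i k by simp
  ultimately show ?thesis unfolding c conj_by_def by simp
qed

lemma tracks_s_map:
  assumes i: "1 \<le> i" "i < n" and k: "k \<in> carrier K" and t: "tracks k"
  shows "tracks (s_map i k)"
proof -
  obtain u where u: "u \<in> words (sg_gens n)" "word_eval G selt u = p k" by (rule word_of_elt[OF p.hom_closed[OF k]])
  have g: "Sigma i \<in> sg_gens n" using i by (auto simp: sg_gens_def)
  let ?u = "(Sigma i, True) # u @ [(Sigma i, False)]"
  show ?thesis
  proof (rule tracksI)
    show "?u \<in> words (sg_gens n)" using u g by simp
    show "word_eval G selt ?u = p (s_map i k)"
      using u g i k by (simp add: eval_append selt_index p_s_map conj_by_def G.m_assoc)
    fix h w assume h: "h \<in> carrier K" "w \<in> perms"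
    let ?c = "cocycle w (Sigma i)"
    have w': "w \<circ> adj i \<in> perms" by (rule perm_adj[OF h(2) i])
    have c: "?c \<in> carrier K" by (rule cocycle_closed[OF g h(2)])
    have "act ?u (h, w) = act1 (act u (h \<otimes>\<^bsub>K\<^esub> ?c, w \<circ> adj i)) (Sigma i, False)"
      by (simp only: act_Cons act_append act_Nil act1.simps Let_def if_True sgen_index.simps)
    also have "act u (h \<otimes>\<^bsub>K\<^esub> ?c, w \<circ> adj i) = (h \<otimes>\<^bsub>K\<^esub> ?c \<otimes>\<^bsub>K\<^esub> mP (w \<circ> adj i) k, w \<circ> adj i)"
      using h c w' by (intro tracksD[OF t u]) simp_all
    also have "act1 \<dots> (Sigma i, False) = (h \<otimes>\<^bsub>K\<^esub> ?c \<otimes>\<^bsub>K\<^esub> mP (w \<circ> adj i) k \<otimes>\<^bsub>K\<^esub> inv\<^bsub>K\<^esub> ?c, w)"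
      by (simp only: act1.simps Let_def if_False sgen_index.simps adj_adj)
    also have "h \<otimes>\<^bsub>K\<^esub> ?c \<otimes>\<^bsub>K\<^esub> mP (w \<circ> adj i) k \<otimes>\<^bsub>K\<^esub> inv\<^bsub>K\<^esub> ?c
        = h \<otimes>\<^bsub>K\<^esub> (?c \<otimes>\<^bsub>K\<^esub> mP (w \<circ> adj i) k \<otimes>\<^bsub>K\<^esub> inv\<^bsub>K\<^esub> ?c)"
      using h c mP_closed[OF w' k] by (simp add: k.K.m_assoc)
    also have "\<dots> = h \<otimes>\<^bsub>K\<^esub> mP w (s_map i k)" by (simp only: cocycle_conj[OF i h(2) k])
    finally show "act ?u (h, w) = (h \<otimes>\<^bsub>K\<^esub> mP w (s_map i k), w)" .
  qed
qed

text \<open>Each generator arises from one with adjacent strands by successive maps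
  \<open>s_map l\<close>, just as the \<open>a\<close> and \<open>b\<close> are defined by
  conjugation.\<close>

lemma tracks_kgen: "1 \<le> j \<Longrightarrow> j < l \<Longrightarrow> l \<le> n \<Longrightarrow> tracks (kgen (e, j, l))"
proof (induction l)
  case (Suc l)
  show ?case
  proof (cases "l = j")
    case True
    then show ?thesis using tracks_kAB[of j] Suc.prems by (cases e) (simp_all add: kA_def kB_def)
  next
    case False
    have y: "(e, j, l) \<in> L" using Suc.prems False by (simp add: mem_L)
    have l: "1 \<le> l" "l < n" using Suc.prems by auto
    have "lab_swap l (e, j, l) = (e, j, Suc l)" using Suc.prems False by (simp add: lab_swap.simps transpose_def)
    then have "s_map l (kgen (e, j, l)) = kgen (e, j, Suc l)"
      using s_map_kgen[OF l y] by simp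
    moreover have "tracks (s_map l (kgen (e, j, l)))"
      using Suc False l k.gen_closed[OF y] by (intro tracks_s_map) simp_all
    ultimately show ?thesis by simp
  qed
qed simp

lemma tracks_all: "k \<in> carrier K \<Longrightarrow> tracks k"
proof (induction rule: k.carrier_induct)
  case (gen y)
  then show ?case using tracks_kgen by (cases y) (simp add: mem_L)
qed (auto intro: tracks_one tracks_mult tracks_inv)

lemma id_perms: "id \<in> perms"
  by (simp add: permutes_id)

theorem p_inj: "inj_on p (carrier K)"
proof (rule p.inj_on_one_iff[THEN iffD2], intro allI impI)
  fix k assume k: "k \<in> carrier K" "p k = \<one>\<^bsub>G\<^esub>"
  \<comment> \<open>The empty word has the value \<open>p k\<close>, so it acts as right
    multiplication by \<open>mP id k\<close>, which is \<open>k\<close>.\<close>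
  have "act [] (\<one>\<^bsub>K\<^esub>, id) = (\<one>\<^bsub>K\<^esub> \<otimes>\<^bsub>K\<^esub> mP id k, id)"
    by (rule tracksD[OF tracks_all]) (use k id_perms in simp_all)
  then show "k = \<one>\<^bsub>K\<^esub>" using k by simp
qed

text \<open>A word for \<open>g\<close> acts on the pair of the two identities, and
  \<open>act_p\<close> reads the factors off the result.\<close>

lemma factorization:
  assumes "g \<in> carrier G"
  obtains k w where "k \<in> carrier K" "w \<in> perms" "g = p k \<otimes>\<^bsub>G\<^esub> mB w"
proof -
  obtain u where u: "u \<in> words (sg_gens n)" "word_eval G selt u = g" by (rule word_of_elt[OF assms])
  have o: "(\<one>\<^bsub>K\<^esub>, id) \<in> Omega" using id_perms by simp
  obtain k w where kw: "act u (\<one>\<^bsub>K\<^esub>, id) = (k, w)" "k \<in> carrier K" "w \<in> perms"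
    using act_closed[OF u(1) o] by (cases "act u (\<one>\<^bsub>K\<^esub>, id)") auto
  have "g = p k \<otimes>\<^bsub>G\<^esub> mB w" using act_p[OF u(1) o] kw u assms by simp
  then show ?thesis using that kw by blast
qed

end

section \<open>Coset representatives and conjugate petals\<close>

context singular_braid
begin

lemma SP_normal: "SP n \<lhd> G"
  unfolding SP_def
  by (rule group_hom.normal_kernel)
    (simp add: group_hom_def group_hom_axioms_def sg_pi_hom sym_group_is_group)

lemma SP_subgroup: "subgroup (SP n) G"
  using SP_normal normal_imp_subgroup by blast

lemma pi_hom: "group_hom G (sym_group n) (sg_pi n)"
  by (simp add: group_hom_def group_hom_axioms_def sg_pi_hom sym_group_is_group)

lemma SP_iff: "g \<in> SP n \<longleftrightarrow> g \<in> carrier G \<and> sg_pi n g = id"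
  by (simp add: SP_def kernel_def sym_group_one)

lemma pi_mult: "x \<in> carrier G \<Longrightarrow> y \<in> carrier G \<Longrightarrow> sg_pi n (x \<otimes>\<^bsub>G\<^esub> y) = sg_pi n x \<circ> sg_pi n y"
  using group_hom.hom_mult[OF pi_hom] by (simp add: sym_group_mult)

lemma pi_B_ev: "set l \<subseteq> {1..<n} \<Longrightarrow> sg_pi n (B.ev l) = list_perm l"
proof (induction l)
  case Nil
  then show ?case using group_hom.hom_one[OF pi_hom] by (simp add: sym_group_one)
next
  case (Cons i l)
  then have "sigma n i \<in> carrier G" "B.ev l \<in> carrier G" "i \<in> {1..<n}" by (auto intro!: B.ev_closed sigma_closed)
  then show ?case using Cons sg_pi_generators(1)[of i n] by (simp add: pi_mult)
qed

lemma pi_mB: "w \<in> perms \<Longrightarrow> sg_pi n (mB w) = w"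
  using pi_B_ev[OF red_word_perm_letters] list_perm_red_word by simp

lemma bas_in_SP: "1 \<le> i \<Longrightarrow> i < n \<Longrightarrow> bas e i \<in> SP n"
  using sg_pi_generators[of i n] by (simp add: SP_iff bas_closed bas_def pi_mult xelt_def fun_eq_iff)

lemma lab_in_SP: "y \<in> L \<Longrightarrow> lab n y \<in> SP n"
proof (cases y)
  case (fields e i j)
  assume "y \<in> L"
  then have ij: "1 \<le> i" "i < j" "j \<le> n" using fields by (simp_all add: mem_L)
  show ?thesis
    unfolding fields lab_eq conj_by_def
    using normal.inv_op_closed2[OF SP_normal desc_sigma_closed bas_in_SP] ij by simp
qed

text \<open>The permutation of \<open>p k\<close> times \<open>mB w\<close> is \<open>w\<close>, so
  a pure element has \<open>w = id\<close> in \<open>factorization\<close>. That the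
  \<open>a\<close> and \<open>b\<close> generate \<open>SP n\<close> is thereby derived, not
  assumed.\<close>

lemma p_image: "p ` carrier K = SP n"
proof
  show "p ` carrier K \<subseteq> SP n"
  proof
    fix g assume "g \<in> p ` carrier K"
    then obtain k where k: "k \<in> generate K (kgen ` L)" "g = p k" using k.carrier_eq_generate by blast
    have "kgen ` L \<subseteq> carrier K" using k.gen_closed by blast
    then show "g \<in> SP n" unfolding k(2)
      by (rule p.image_generate_le[OF _ SP_subgroup _ k(1)]) (use p_kgen lab_in_SP in force)
  qed
  show "SP n \<subseteq> p ` carrier K"
  proof
    fix g assume g: "g \<in> SP n"
    then have gc: "g \<in> carrier G" by (simp add: SP_iff)
    obtain k w where k: "k \<in> carrier K" and w: "w \<in> perms" and e: "g = p k \<otimes>\<^bsub>G\<^esub> mB w"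
      by (rule factorization[OF gc])
    have "p k \<in> SP n" using k \<open>p ` carrier K \<subseteq> SP n\<close> by blast
    then have "sg_pi n g = w" unfolding e using k mB_closed[OF w] pi_mB[OF w] by (simp add: pi_mult SP_iff)
    then have "w = id" using g by (simp add: SP_iff)
    then have "g = p k" using e k by simp
    then show "g \<in> p ` carrier K" using k by (rule image_eqI)
  qed
qed

lemma SP_generate: "SP n = generate G (lab n ` L)"
proof -
  have c: "kgen ` L \<subseteq> carrier K" using k.gen_closed by blast
  have "SP n = generate G (p ` kgen ` L)"
    unfolding p_image[symmetric] k.carrier_eq_generate by (rule p.generate_img[OF c, symmetric])
  moreover have "p ` kgen ` L = lab n ` L"
    unfolding image_image by (rule image_cong[OF HOL.refl p_kgen])
  ultimately show ?thesis by simp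
qed

lemma petal_SP: "S \<subseteq> {1..n} \<Longrightarrow> petal S \<subseteq> SP n"
  unfolding petal_def by (rule G.generate_subgroup_incl[OF _ SP_subgroup]) (use lab_in_SP labels_L in blast)

lemma petal_carrier: "S \<subseteq> {1..n} \<Longrightarrow> petal S \<subseteq> carrier G"
  by (rule subgroup.subset[OF petal_subgroup])

lemma SP_sub_eq: "SP_sub n m = petal {1..m}"
proof -
  have "{sp_a n i j | i j. 1 \<le> i \<and> i < j \<and> j \<le> m} \<union> {sp_b n i j | i j. 1 \<le> i \<and> i < j \<and> j \<le> m}
      = lab n ` labels {1..m}" (is "?A \<union> ?B = _")
  proof (intro equalityI subsetI)
    fix x assume "x \<in> ?A \<union> ?B"
    then have "\<exists>e i j. 1 \<le> i \<and> i < j \<and> j \<le> m \<and> x = lab n (e, i, j)"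
    proof
      assume "x \<in> ?A"
      then obtain i j where "1 \<le> i" "i < j" "j \<le> m" "x = sp_a n i j" by blast
      then show ?thesis by (intro exI[of _ True] exI[of _ i] exI[of _ j]) (simp add: lab.simps)
    next
      assume "x \<in> ?B"
      then obtain i j where "1 \<le> i" "i < j" "j \<le> m" "x = sp_b n i j" by blast
      then show ?thesis by (intro exI[of _ False] exI[of _ i] exI[of _ j]) (simp add: lab.simps)
    qed
    then obtain e i j where "1 \<le> i" "i < j" "j \<le> m" "x = lab n (e, i, j)" by blast
    then show "x \<in> lab n ` labels {1..m}" by (intro image_eqI[of _ _ "(e, i, j)"]) (simp_all add: labels_def)
  next
    fix x assume "x \<in> lab n ` labels {1..m}"
    then obtain e i j where ij: "1 \<le> i" "i < j" "j \<le> m" "x = lab n (e, i, j)"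
      by (auto simp: labels_def)
    show "x \<in> ?A \<union> ?B"
    proof (cases e)
      case True
      then have "x \<in> ?A" using ij by (simp only: lab.simps if_True) blast
      then show ?thesis ..
    next
      case False
      then have "x \<in> ?B" using ij by (simp only: lab.simps if_False) blast
      then show ?thesis ..
    qed
  qed
  then show ?thesis unfolding SP_sub_def petal_def by simp
qed

section \<open>Coset representatives as inverses of permutation braids\<close>

lemma list_mult_append:
  "set xs \<subseteq> carrier G \<Longrightarrow> set ys \<subseteq> carrier G \<Longrightarrow> list_mult G (xs @ ys) = list_mult G xs \<otimes>\<^bsub>G\<^esub> list_mult G ys"
proof (induction xs)
  case Nil
  then show ?case using list_mult_closed[of ys] by (simp add: list_mult_def)
next
  case (Cons x xs)
  have e: "list_mult G (z # zs) = z \<otimes>\<^bsub>G\<^esub> list_mult G zs" for z zs by (simp add: list_mult_def)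
  have "list_mult G xs \<in> carrier G" "list_mult G ys \<in> carrier G"
    using list_mult_closed Cons.prems by simp_all
  then show ?case using Cons by (simp add: e G.m_assoc)
qed

lemma list_mult_inv_rev:
  "set xs \<subseteq> {1..<n} \<Longrightarrow> list_mult G (map (\<lambda>i. inv\<^bsub>G\<^esub> (sigma n i)) (rev xs)) = inv\<^bsub>G\<^esub> (B.ev xs)"
proof (induction xs)
  case Nil
  then show ?case by (simp add: list_mult_def)
next
  case (Cons x xs)
  have cl: "set (map (\<lambda>i. inv\<^bsub>G\<^esub> (sigma n i)) (rev xs)) \<subseteq> carrier G" "sigma n x \<in> carrier G" "B.ev xs \<in> carrier G"
    using Cons.prems by (auto intro!: B.ev_closed)
  have s: "list_mult G [y] = y" if "y \<in> carrier G" for y using that by (simp add: list_mult_def)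
  show ?case
    using Cons cl list_mult_append[OF cl(1), of "[inv\<^bsub>G\<^esub> (sigma n x)]"] by (simp add: s G.inv_mult_group)
qed

lemma rep_n_eq: "1 \<le> l \<Longrightarrow> k \<le> n \<Longrightarrow> rep_n n k l = inv\<^bsub>G\<^esub> (B.ev [l..<k])"
  unfolding rep_n_def by (rule list_mult_inv_rev) auto

lemma B_ev_upt_closed: "1 \<le> l \<Longrightarrow> k \<le> n \<Longrightarrow> B.ev [l..<k] \<in> carrier G"
  by (rule B.ev_closed) auto

lemma B_ev_red_word_closed: "w permutes {1..m} \<Longrightarrow> m \<le> n \<Longrightarrow> B.ev (red_word m w) \<in> carrier G"
  by (rule B.ev_closed) (use red_word_letters in fastforce)

lemma B_ev_red_word_Suc:
  assumes "w permutes {1..m}" "1 \<le> l" "l \<le> Suc m" "Suc m \<le> n"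
  shows "B.ev (red_word (Suc m) (cycle_up l (Suc m) \<circ> w)) = B.ev [l..<Suc m] \<otimes>\<^bsub>G\<^esub> B.ev (red_word m w)"
proof -
  have wf: "w (Suc m) = Suc m" using assms(1) by (simp add: permutes_def)
  have v: "(cycle_up l (Suc m) \<circ> w) (Suc m) = l" using wf by (simp add: cycle_up_def)
  have c: "cycle_down l (Suc m) \<circ> (cycle_up l (Suc m) \<circ> w) = w" using assms(3) by (simp add: fun_eq_iff)
  have "red_word (Suc m) (cycle_up l (Suc m) \<circ> w) = [l..<Suc m] @ red_word m w"
    by (simp only: red_word.simps v c)
  moreover have "set [l..<Suc m] \<subseteq> {1..<n}" "set (red_word m w) \<subseteq> {1..<n}"
    using red_word_letters[OF assms(1)] assms by auto
  ultimately show ?thesis by (simp only: B.ev_append)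
qed

lemma sg_M_Suc:
  assumes "1 \<le> m" "Suc m \<le> n"
  shows "sg_M n (Suc m) = {x \<otimes>\<^bsub>G\<^esub> rep_n n (Suc m) l | x l. x \<in> sg_M n m \<and> 1 \<le> l \<and> l \<le> Suc m}"
proof -
  have cl: "set (map (\<lambda>k. rep_n n k (j k)) [2..<m + 1]) \<subseteq> carrier G" if "\<forall>k\<in>{2..m}. 1 \<le> j k \<and> j k \<le> k" for j
    using that assms by (auto simp: rep_n_eq B_ev_upt_closed)
  have split: "list_mult G (map (\<lambda>k. rep_n n k (j k)) [2..<Suc m + 1])
      = list_mult G (map (\<lambda>k. rep_n n k (j k)) [2..<m + 1]) \<otimes>\<^bsub>G\<^esub> rep_n n (Suc m) (j (Suc m))"
    if "\<forall>k\<in>{2..Suc m}. 1 \<le> j k \<and> j k \<le> k" for j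
  proof -
    have r: "rep_n n (Suc m) (j (Suc m)) \<in> carrier G"
      using that assms by (simp add: rep_n_eq B_ev_upt_closed del: upt_Suc)
    have "[2..<Suc m + 1] = [2..<m + 1] @ [Suc m]" using assms by simp
    then show ?thesis
      using list_mult_append[OF cl[of j], of "[rep_n n (Suc m) (j (Suc m))]"] that r
      by (simp add: list_mult_def del: upt_Suc)
  qed
  show ?thesis
  proof (intro equalityI subsetI)
    fix x assume "x \<in> sg_M n (Suc m)"
    then obtain j where j: "\<forall>k\<in>{2..Suc m}. 1 \<le> j k \<and> j k \<le> k"
      "x = list_mult G (map (\<lambda>k. rep_n n k (j k)) [2..<Suc m + 1])" unfolding sg_M_def by blast
    have "list_mult G (map (\<lambda>k. rep_n n k (j k)) [2..<m + 1]) \<in> sg_M n m"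
      unfolding sg_M_def using j(1) by auto
    moreover have "1 \<le> j (Suc m) \<and> j (Suc m) \<le> Suc m" using j(1) assms by simp
    ultimately show "x \<in> {x \<otimes>\<^bsub>G\<^esub> rep_n n (Suc m) l | x l. x \<in> sg_M n m \<and> 1 \<le> l \<and> l \<le> Suc m}"
      unfolding j(2) split[OF j(1)] by blast
  next
    fix y assume "y \<in> {x \<otimes>\<^bsub>G\<^esub> rep_n n (Suc m) l | x l. x \<in> sg_M n m \<and> 1 \<le> l \<and> l \<le> Suc m}"
    then obtain x l where xl: "y = x \<otimes>\<^bsub>G\<^esub> rep_n n (Suc m) l" "x \<in> sg_M n m" "1 \<le> l" "l \<le> Suc m" by blast
    then obtain j where j: "\<forall>k\<in>{2..m}. 1 \<le> j k \<and> j k \<le> k"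
      "x = list_mult G (map (\<lambda>k. rep_n n k (j k)) [2..<m + 1])" unfolding sg_M_def by blast
    let ?j = "j(Suc m := l)"
    have j': "\<forall>k\<in>{2..Suc m}. 1 \<le> ?j k \<and> ?j k \<le> k" using j(1) xl(3,4) by auto
    have "map (\<lambda>k. rep_n n k (?j k)) [2..<m + 1] = map (\<lambda>k. rep_n n k (j k)) [2..<m + 1]"
      by (rule map_cong) auto
    then have "y = list_mult G (map (\<lambda>k. rep_n n k (?j k)) [2..<Suc m + 1])"
      unfolding split[OF j'] xl(1) j(2) by (simp only: fun_upd_same)
    then show "y \<in> sg_M n (Suc m)" unfolding sg_M_def using j' by blast
  qed
qed

text \<open>Inversion reverses the factors, so a product of \<open>rep_n\<close> with increasing
  first index is the inverse of a reduced word whose runs start with the largest index;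
  \<open>cycle_up\<close> records the choice of the last factor.\<close>

lemma sg_M_eq:
  "1 \<le> m \<Longrightarrow> m \<le> n \<Longrightarrow> sg_M n m = (\<lambda>w. inv\<^bsub>G\<^esub> (B.ev (red_word m w))) ` {w. w permutes {1..m}}"
proof (induction m rule: dec_induct)
  case base
  have "sg_M n 1 = {\<one>\<^bsub>G\<^esub>}" by (simp add: sg_M_def list_mult_def)
  moreover have "red_word 1 id = []" by (rule red_word_id)
  moreover have "{w. w permutes {1..1::nat}} = {id}" by (auto simp: permutes_sing)
  ultimately show ?case by simp
next
  case (step m)
  let ?f = "\<lambda>m w. inv\<^bsub>G\<^esub> (B.ev (red_word m w))"
  have prod: "?f (Suc m) (cycle_up l (Suc m) \<circ> w) = ?f m w \<otimes>\<^bsub>G\<^esub> rep_n n (Suc m) l"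
    if "w permutes {1..m}" "1 \<le> l" "l \<le> Suc m" for w l
    using B_ev_red_word_Suc[OF that step.prems] B_ev_red_word_closed[OF that(1)] B_ev_upt_closed[OF that(2) step.prems]
      rep_n_eq[OF that(2) step.prems] step.prems by (simp add: G.inv_mult_group del: upt_Suc red_word.simps)
  have IH: "sg_M n m = ?f m ` {w. w permutes {1..m}}" using step by simp
  show ?case unfolding sg_M_Suc[OF step.hyps(1) step.prems] IH
  proof (intro equalityI subsetI)
    fix y assume "y \<in> {x \<otimes>\<^bsub>G\<^esub> rep_n n (Suc m) l | x l. x \<in> ?f m ` {w. w permutes {1..m}} \<and> 1 \<le> l \<and> l \<le> Suc m}"
    then obtain w l where "w permutes {1..m}" "1 \<le> l" "l \<le> Suc m" "y = ?f m w \<otimes>\<^bsub>G\<^esub> rep_n n (Suc m) l" by blast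
    then show "y \<in> ?f (Suc m) ` {w. w permutes {1..Suc m}}"
      using prod[of w l] cycle_up_comp_permutes[of w m l]
      by (intro image_eqI[of _ _ "cycle_up l (Suc m) \<circ> w"]) (simp_all del: red_word.simps)
  next
    fix y assume "y \<in> ?f (Suc m) ` {w. w permutes {1..Suc m}}"
    then obtain w where w: "w permutes {1..Suc m}" "y = ?f (Suc m) w" by blast
    obtain l v where v: "v permutes {1..m}" "1 \<le> l" "l \<le> Suc m" "w = cycle_up l (Suc m) \<circ> v"
      by (rule permutes_Suc_cases[OF w(1)])
    then show "y \<in> {x \<otimes>\<^bsub>G\<^esub> rep_n n (Suc m) l | x l. x \<in> ?f m ` {w. w permutes {1..m}} \<and> 1 \<le> l \<and> l \<le> Suc m}"
      unfolding w(2) v(4) prod[OF v(1-3)] by blast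
  qed
qed

lemma sg_M_n: "sg_M n n = (\<lambda>w. inv\<^bsub>G\<^esub> (mB w)) ` perms"
  using sg_M_eq[of n] n by simp

text \<open>A right coset of the kernel consists of the elements with one permutation, and by
  \<open>pi_mB\<close> every permutation occurs for exactly one representative.\<close>

lemma sg_M_reps: "coset_representatives G (SP n) (sg_M n n)"
  unfolding coset_representatives_def
proof (intro conjI ballI)
  show "sg_M n n \<subseteq> carrier G" unfolding sg_M_n using mB_closed by blast
  fix C assume "C \<in> rcosets\<^bsub>G\<^esub> (SP n)"
  then obtain g where g: "g \<in> carrier G" "C = SP n #>\<^bsub>G\<^esub> g" unfolding RCOSETS_def by blast
  interpret S: group "sym_group n" by (rule sym_group_is_group)
  interpret pi: group_hom G "sym_group n" "sg_pi n" by (rule pi_hom)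
  have mem: "m \<in> C \<longleftrightarrow> sg_pi n m = sg_pi n g" if m: "m \<in> carrier G" for m
  proof
    assume "m \<in> C"
    then obtain h where h: "h \<in> SP n" "m = h \<otimes>\<^bsub>G\<^esub> g" unfolding g(2) r_coset_def by blast
    then show "sg_pi n m = sg_pi n g" using g(1) by (simp add: pi_mult SP_iff del: group_hom.hom_mult pi.hom_mult)
  next
    assume e: "sg_pi n m = sg_pi n g"
    have "sg_pi n (m \<otimes>\<^bsub>G\<^esub> inv\<^bsub>G\<^esub> g) = sg_pi n m \<otimes>\<^bsub>sym_group n\<^esub> inv\<^bsub>sym_group n\<^esub> (sg_pi n g)"
      by (simp only: pi.hom_mult pi.hom_inv G.inv_closed m g(1))
    also have "\<dots> = \<one>\<^bsub>sym_group n\<^esub>" unfolding e by (rule S.r_inv[OF pi.hom_closed[OF g(1)]])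
    finally have "sg_pi n (m \<otimes>\<^bsub>G\<^esub> inv\<^bsub>G\<^esub> g) = \<one>\<^bsub>sym_group n\<^esub>" .
    then have "m \<otimes>\<^bsub>G\<^esub> inv\<^bsub>G\<^esub> g \<in> SP n" using g(1) m by (simp add: SP_iff sym_group_one)
    moreover have "m = (m \<otimes>\<^bsub>G\<^esub> inv\<^bsub>G\<^esub> g) \<otimes>\<^bsub>G\<^esub> g" using g(1) m by (simp add: G.m_assoc)
    ultimately show "m \<in> C" unfolding g(2) r_coset_def by blast
  qed
  have pim: "sg_pi n (inv\<^bsub>G\<^esub> (mB w)) = inv\<^bsub>sym_group n\<^esub> w" if "w \<in> perms" for w
    using pi_mB[OF that] mB_closed[OF that] by simp
  have car: "w \<in> carrier (sym_group n) \<longleftrightarrow> w \<in> perms" for w by (simp add: sym_group_carrier)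
  let ?w = "inv\<^bsub>sym_group n\<^esub> (sg_pi n g)"
  have gw: "sg_pi n g \<in> carrier (sym_group n)" using g(1) by (rule pi.hom_closed)
  have w: "?w \<in> perms" using gw car S.inv_closed by blast
  show "\<exists>!m. m \<in> sg_M n n \<and> m \<in> C"
  proof (rule ex1I[of _ "inv\<^bsub>G\<^esub> (mB ?w)"])
    have "sg_pi n (inv\<^bsub>G\<^esub> (mB ?w)) = sg_pi n g" using pim[OF w] S.inv_inv[OF gw] by simp
    then show "inv\<^bsub>G\<^esub> (mB ?w) \<in> sg_M n n \<and> inv\<^bsub>G\<^esub> (mB ?w) \<in> C"
      using mem mB_closed[OF w] w unfolding sg_M_n by simp
    fix m assume m: "m \<in> sg_M n n \<and> m \<in> C"
    then obtain v where v: "v \<in> perms" "m = inv\<^bsub>G\<^esub> (mB v)" unfolding sg_M_n by blast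
    have "inv\<^bsub>sym_group n\<^esub> v = sg_pi n g"
      using mem[of m] m v pim[OF v(1)] mB_closed[OF v(1)] by simp
    then have "v = ?w" using S.inv_inv[of v] v(1) car by metis
    then show "m = inv\<^bsub>G\<^esub> (mB ?w)" using v(2) by (simp only:)
  qed
qed

section \<open>Conjugation of petals by permutation braids\<close>

lemma cj_upt_petal:
  "1 \<le> l \<Longrightarrow> l \<le> Suc k \<Longrightarrow> Suc k \<le> n \<Longrightarrow> S \<subseteq> {1..k} \<Longrightarrow>
    cj (B.ev [l..<Suc k]) ` petal S = petal (cycle_up l (Suc k) ` S)"
proof (induction "Suc k - l" arbitrary: l)
  case 0
  then have l: "l = Suc k" by simp
  have pc: "petal S \<subseteq> carrier G" using 0 by (intro petal_carrier) auto
  have "cycle_up l (Suc k) ` S = S" unfolding l by (auto simp: cycle_up_def image_iff)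
  moreover have "cj \<one>\<^bsub>G\<^esub> ` petal S = petal S"
    using pc G.conj_by_one by (intro image_cong[where g = id, simplified]) auto
  ultimately show ?case using l by simp
next
  case (Suc d)
  have l: "l < Suc k" using Suc.hyps(2) by simp
  have pc: "petal S \<subseteq> carrier G" using Suc.prems by (intro petal_carrier) auto
  have cl: "sigma n l \<in> carrier G" "B.ev [Suc l..<Suc k] \<in> carrier G"
    using Suc.prems l by (auto intro!: sigma_closed B_ev_upt_closed simp del: upt_Suc)
  let ?S = "cycle_up (Suc l) (Suc k) ` S"
  \<comment> \<open>The strand \<open>k + 1\<close> missing from \<open>S\<close> is a gap. The
    letters above \<open>l\<close> have moved it down to \<open>l + 1\<close>, where
    \<open>cj_petal_move\<close> requires it.\<close>
  have S': "?S \<subseteq> {1..n}" "l + 1 \<notin> ?S"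
    using Suc.prems by (auto simp: cycle_up_def split: if_splits dest: subsetD)
  have comp: "cycle_up l (Suc k) x = adj l (cycle_up (Suc l) (Suc k) x)" for x
    using l by (simp add: cycle_up_def transpose_def)
  have "cj (B.ev [l..<Suc k]) x = cj (sigma n l) (cj (B.ev [Suc l..<Suc k]) x)" if "x \<in> petal S" for x
    using l that pc cl by (auto simp: upt_conv_Cons G.conj_by_mult simp del: upt_Suc)
  then have "cj (B.ev [l..<Suc k]) ` petal S = cj (sigma n l) ` (cj (B.ev [Suc l..<Suc k]) ` petal S)"
    unfolding image_image by (rule image_cong[OF HOL.refl])
  also have "cj (B.ev [Suc l..<Suc k]) ` petal S = petal ?S"
    using Suc.hyps(2) Suc.prems l by (intro Suc.hyps(1)) auto
  also have "cj (sigma n l) ` petal ?S = petal (adj l ` ?S)"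
    using Suc.prems l S' by (intro cj_petal_move) auto
  also have "adj l ` ?S = cycle_up l (Suc k) ` S"
    unfolding image_image comp ..
  finally show ?case .
qed

lemma cj_inside_petal:
  "set l \<subseteq> {1..<4} \<Longrightarrow> cj (B.ev l) ` petal {1..4} = petal {1..4}"
proof (induction l)
  case Nil
  have "petal {1..4} \<subseteq> carrier G" using n by (intro petal_carrier) auto
  then show ?case using G.conj_by_one by (intro image_cong[where g = id, simplified]) auto
next
  case (Cons i l)
  have pc: "petal {1..4} \<subseteq> carrier G" using n by (intro petal_carrier) auto
  have cl: "sigma n i \<in> carrier G" "B.ev l \<in> carrier G"
    using Cons.prems n by (auto intro!: B.ev_closed sigma_closed)
  have "cj (B.ev (i # l)) ` petal {1..4} = cj (sigma n i) ` (cj (B.ev l) ` petal {1..4})"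
    unfolding image_image using pc cl by (intro image_cong[OF HOL.refl]) (simp add: G.conj_by_mult subset_iff)
  then show ?case using Cons cj_petal_inside[of i "{1..4}"] n by simp
qed

text \<open>The runs for indices above four move a gap at their top strand; the rest of the word has
  letters up to 3, which preserve the petal of \<open>{1..4}\<close>.\<close>

lemma cj_red_word_petal:
  "4 \<le> k \<Longrightarrow> k \<le> n \<Longrightarrow> w permutes {1..k} \<Longrightarrow>
    cj (B.ev (red_word k w)) ` petal {1..4} = petal (w ` {1..4})"
proof (induction k arbitrary: w rule: dec_induct)
  case base
  then show ?case using cj_inside_petal[OF red_word_letters] permutes_image by metis
next
  case (step k)
  obtain l v where v: "v permutes {1..k}" "1 \<le> l" "l \<le> Suc k" and w: "w = cycle_up l (Suc k) \<circ> v"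
    by (rule permutes_Suc_cases[OF step.prems(2)])
  have pc: "petal {1..4} \<subseteq> carrier G" using n by (intro petal_carrier) auto
  note cl = B_ev_upt_closed[OF v(2) step.prems(1)] B_ev_red_word_closed[OF v(1)]
  have kn: "k \<le> n" using step.prems by simp
  have "cj (B.ev (red_word (Suc k) w)) ` petal {1..4} = cj (B.ev [l..<Suc k]) ` (cj (B.ev (red_word k v)) ` petal {1..4})"
    unfolding image_image w B_ev_red_word_Suc[OF v step.prems(1)]
    using pc cl kn by (intro image_cong[OF HOL.refl]) (simp add: G.conj_by_mult subset_iff del: upt_Suc)
  also have "cj (B.ev (red_word k v)) ` petal {1..4} = petal (v ` {1..4})"
    by (rule step.IH[OF kn v(1)])
  also have "cj (B.ev [l..<Suc k]) ` petal (v ` {1..4}) = petal (cycle_up l (Suc k) ` v ` {1..4})"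
  proof (rule cj_upt_petal[OF v(2,3) step.prems(1)])
    have "v ` {1..4} \<subseteq> v ` {1..k}" using step.hyps by (intro image_mono) auto
    then show "v ` {1..4} \<subseteq> {1..k}" using permutes_image[OF v(1)] by simp
  qed
  finally show ?case by (simp only: w image_comp)
qed

end

section \<open>The presentation of the singular pure braid group\<close>

text \<open>A positive letter counts when the strand enters from the left, a negative one when it
  enters from the right, so that cancelling letters compensate. \<open>Sigma\<close> and
  \<open>Tau\<close> count alike, so that the mixed relations are respected too.\<close>

fun wind1 :: "nat \<times> int \<Rightarrow> sgen \<times> bool \<Rightarrow> nat \<times> int" where
  "wind1 (a, z) (x, e) = (let i = sgen_index x in
     if a = i then (i + 1, if e then z + 1 else z)
     else if a = i + 1 then (i, if e then z else z - 1) else (a, z))"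

text \<open>Follows a strand from its position, counting its signed crossings from left to right.\<close>

definition wind :: "sgen word \<Rightarrow> nat \<times> int \<Rightarrow> nat \<times> int" where
  "wind u s = foldl wind1 s u"

lemma wind_Nil [simp]: "wind [] s = s" and wind_Cons [simp]: "wind (a # u) s = wind u (wind1 s a)"
  and wind_append: "wind (u @ v) s = wind v (wind u s)"
  by (simp_all add: wind_def)

lemma wind1_cancel: "wind1 (wind1 s (x, e)) (x, \<not> e) = s"
  by (cases s) (auto simp: Let_def)

lemma wind_rel: "(u, v) \<in> sg_rels n \<Longrightarrow> wind u s = wind v s"
  by (cases s) (auto simp: sg_rels_def Let_def)

lemma wind_cong: "pres_cong X (sg_rels n) u v \<Longrightarrow> wind u s = wind v s"
  by (induction arbitrary: s rule: pres_cong.induct)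
    (simp_all add: wind_append wind1_cancel wind_rel del: wind1.simps)

lemma wind_fix:
  assumes "\<And>x e. (x, e) \<in> set u \<Longrightarrow> sgen_index x + 1 < a"
  shows "wind u (a, z) = (a, z)"
  using assms
proof (induction u)
  case (Cons b u)
  obtain x e where "b = (x, e)" by (cases b)
  then show ?case using Cons.IH Cons.prems[of x e] Cons.prems by (auto simp: Let_def)
qed simp

context singular_braid
begin

section \<open>Properness of the highlighted petal\<close>

lemma lab_in_small_subgroup:
  assumes U: "subgroup U G" "\<And>i. 1 \<le> i \<Longrightarrow> i < m \<Longrightarrow> sigma n i \<in> U \<and> tau n i \<in> U" and m: "m \<le> n"
  shows "1 \<le> i \<Longrightarrow> i < j \<Longrightarrow> j \<le> m \<Longrightarrow> lab n (e, i, j) \<in> U"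
proof (induction j)
  case (Suc j)
  have j: "sigma n j \<in> U" using U(2) Suc.prems by simp
  show ?case
  proof (cases "j = i")
    case True
    then have "lab n (e, i, Suc j) = bas e i" using Suc.prems m by (simp add: lab_base)
    then show ?thesis using True U Suc.prems subgroup.m_closed[OF U(1)] by (simp add: bas_def xelt_def)
  next
    case False
    then have "lab n (e, i, Suc j) = cj (sigma n j) (lab n (e, i, j))" using Suc.prems m by (intro lab_Suc) simp_all
    then show ?thesis using G.conj_by_in_subgroup[OF U(1) j] Suc False by simp
  qed
qed simp

text \<open>The witness, the square of \<open>sigma n (n - 1)\<close>, is pure, so permutations do
  not detect it. The count along strand \<open>n\<close> does: words in the generators of index
  below 4 leave that strand alone, as \<open>n\<close> is at least 5, while the witness gives
  1.\<close>

lemma petal4_proper: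
  assumes n5: "5 \<le> n" shows "petal {1..4} \<subset> SP n"
proof -
  let ?Y = "{x \<in> sg_gens n. sgen_index x < 4}"
  let ?U = "generate G (selt ` ?Y)"
  have Yc: "\<And>x. x \<in> ?Y \<Longrightarrow> selt x \<in> carrier G" using selt_closed by blast
  have U: "subgroup ?U G" by (rule G.generate_is_subgroup) (use Yc in blast)
  have gens: "sigma n i \<in> ?U \<and> tau n i \<in> ?U" if "1 \<le> i" "i < 4" for i
  proof -
    have "Sigma i \<in> ?Y" "Tau i \<in> ?Y" using that n by (simp_all add: sg_gens_iff)
    then have "selt (Sigma i) \<in> ?U" "selt (Tau i) \<in> ?U" by (blast intro: generate.incl)+
    then show ?thesis by (simp add: sigma_def tau_def)
  qed
  have "lab n ` labels {1..4} \<subseteq> ?U"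
    using lab_in_small_subgroup[OF U gens n] by (auto simp: labels_def)
  then have sub: "petal {1..4} \<subseteq> ?U" unfolding petal_def using U by (rule G.generate_subgroup_incl)
  let ?w = "[s_ltr (n - 1), s_ltr (n - 1)]"
  have i: "1 \<le> n - 1" "n - 1 < n" using n by auto
  have ww: "?w \<in> words (sg_gens n)" using i by (simp add: sg_gens_iff)
  have ev: "word_eval G selt ?w = bas True (n - 1)"
    using i by (simp add: bas_def xelt_def sigma_def[symmetric])
  have "bas True (n - 1) \<notin> petal {1..4}"
  proof
    assume "bas True (n - 1) \<in> petal {1..4}"
    then have "bas True (n - 1) \<in> word_eval G selt ` words ?Y"
      using sub G.generate_eq_word_eval[of ?Y selt] Yc by blast
    then obtain u where u: "u \<in> words ?Y" "bas True (n - 1) = word_eval G selt u" by blast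
    have u': "u \<in> words (sg_gens n)" by (rule words_mono[OF _ u(1)]) blast
    have "pres_cong (sg_gens n) (sg_rels n) u ?w"
      using sg.word_eval_gen_eq_iff[OF u' ww] u(2) ev by (simp add: SG_def)
    then have eq: "wind u (n, 0) = wind ?w (n, 0)" by (rule wind_cong)
    have "wind u (n, 0) = (n, 0)"
      by (rule wind_fix) (use u(1) n5 in \<open>force simp: words_def\<close>)
    moreover have "wind ?w (n, 0) = (n, 1)" using n by (simp add: Let_def)
    ultimately show False using eq by simp
  qed
  moreover have "bas True (n - 1) \<in> SP n" using i by (rule bas_in_SP)
  moreover have "petal {1..4} \<subseteq> SP n" using n by (intro petal_SP) auto
  ultimately show ?thesis by blast
qed

section \<open>Conjugate petals and four-element sets\<close>

abbreviation "petal_sets \<equiv> {S. S \<subseteq> {1..n} \<and> card S = 4}"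

lemma mB_inj: "w \<in> perms \<Longrightarrow> v \<in> perms \<Longrightarrow> inv\<^bsub>G\<^esub> (mB w) = inv\<^bsub>G\<^esub> (mB v) \<Longrightarrow> w = v"
  using G.inv_inj mB_closed pi_mB by (metis inj_onD)

lemma one_sg_M_conj: "\<one>\<^bsub>G\<^esub> \<in> sg_M_conj n 4"
proof -
  have "\<one>\<^bsub>G\<^esub> = inv\<^bsub>G\<^esub> (mB id)" by simp
  then have "\<one>\<^bsub>G\<^esub> \<in> sg_M n n" unfolding sg_M_n using id_perms by blast
  then show ?thesis by (simp add: sg_M_conj_def)
qed

lemma conj_elt_petal:
  assumes "w \<in> perms"
  shows "conj_elt G (inv\<^bsub>G\<^esub> (mB w)) ` petal {1..4} = petal (w ` {1..4})"
    and "w ` {1..4} \<in> petal_sets"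
proof -
  have "conj_elt G (inv\<^bsub>G\<^esub> (mB w)) = cj (mB w)"
    by (rule ext) (rule G.conj_elt_eq[OF mB_closed[OF assms]])
  then show "conj_elt G (inv\<^bsub>G\<^esub> (mB w)) ` petal {1..4} = petal (w ` {1..4})"
    using cj_red_word_petal[OF n order.refl, of w] assms by simp
  have w: "w permutes {1..n}" using assms by simp
  have "w ` {1..4} \<subseteq> w ` {1..n}" using n by (intro image_mono) auto
  moreover have "card (w ` {1..4}) = card {1..4::nat}"
    by (rule card_image) (rule inj_on_subset[OF permutes_inj[OF w]], simp)
  ultimately show "w ` {1..4} \<in> petal_sets" using permutes_image[OF w] by simp
qed

text \<open>The representative of \<open>w\<close> carries the petal of \<open>{1..4}\<close> to
  that of its image under \<open>w\<close>. A set other than \<open>{1..4}\<close> is the image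
  under some \<open>w\<close> that does not preserve \<open>{1..4}\<close>, so its representative
  was not removed; \<open>{1..4}\<close> itself comes from the unit.\<close>

lemma conj_set_petals:
  "(\<lambda>m. conj_elt G m ` petal {1..4}) ` sg_M_conj n 4 = petal ` petal_sets"
  "(\<lambda>m. (\<lambda>(u, v). (conj_word G m u, conj_word G m v)) ` valid_rels G (petal {1..4})) ` sg_M_conj n 4
    = (\<lambda>S. valid_rels G (petal S)) ` petal_sets"
proof -
  let ?c = "\<lambda>m. conj_elt G m ` petal {1..4}"
  let ?r = "\<lambda>m. (\<lambda>(u, v). (conj_word G m u, conj_word G m v)) ` valid_rels G (petal {1..4})"
  have pc: "petal {1..4} \<subseteq> carrier G" using n by (intro petal_carrier) auto
  have r: "?r (inv\<^bsub>G\<^esub> (mB w)) = valid_rels G (petal (w ` {1..4}))" if "w \<in> perms" for w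
  proof -
    have "cj (mB w) ` petal {1..4} = petal (w ` {1..4})"
      using cj_red_word_petal[OF n order.refl, of w] that by simp
    then show ?thesis using G.conj_word_valid_rels[OF mB_closed[OF that] pc] by simp
  qed
  have into: "\<exists>S\<in>petal_sets. ?c m = petal S \<and> ?r m = valid_rels G (petal S)" if m: "m \<in> sg_M_conj n 4" for m
  proof -
    obtain w where w: "w \<in> perms" "m = inv\<^bsub>G\<^esub> (mB w)"
      using m unfolding sg_M_conj_def sg_M_n by blast
    show ?thesis unfolding w(2) using conj_elt_petal[OF w(1)] r[OF w(1)] by blast
  qed
  have onto: "\<exists>m\<in>sg_M_conj n 4. ?c m = petal S \<and> ?r m = valid_rels G (petal S)" if S: "S \<in> petal_sets" for S
  proof -
    have "\<exists>w\<in>perms. w ` {1..4} = S \<and> inv\<^bsub>G\<^esub> (mB w) \<in> sg_M_conj n 4"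
    proof (cases "S = {1..4}")
      case True
      then show ?thesis using one_sg_M_conj id_perms by (intro bexI[of _ id]) simp_all
    next
      case False
      have "{1..4} \<subseteq> {1..n}" "card {1..4::nat} = card S" using n S by auto
      then obtain w where w: "w permutes {1..n}" "w ` {1..4} = S"
        using ex_permutes_image[of "{1..n}" "{1..4}" S] S by blast
      have "inv\<^bsub>G\<^esub> (mB w) \<notin> sg_M n 4"
      proof
        assume "inv\<^bsub>G\<^esub> (mB w) \<in> sg_M n 4"
        then obtain v where v: "v permutes {1..4}" "inv\<^bsub>G\<^esub> (mB w) = inv\<^bsub>G\<^esub> (B.ev (red_word 4 v))"
          using sg_M_eq[of 4] n by auto
        have "v \<in> perms" using permutes_subset[OF v(1), of "{1..n}"] n by simp
        moreover have "red_word n v = red_word 4 v" by (rule red_word_restrict[OF v(1) n])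
        ultimately have "w = v" using mB_inj[of w v] w v(2) by simp
        then show False using w(2) permutes_image[OF v(1)] False by simp
      qed
      moreover have "inv\<^bsub>G\<^esub> (mB w) \<in> sg_M n n" unfolding sg_M_n using w(1) by blast
      ultimately show ?thesis using w by (intro bexI[of _ w]) (simp_all add: sg_M_conj_def)
    qed
    then show ?thesis using conj_elt_petal(1) r by blast
  qed
  show "?c ` sg_M_conj n 4 = petal ` petal_sets"
  proof (rule image_eq_of_correspondence)
    show "\<exists>S\<in>petal_sets. ?c m = petal S" if "m \<in> sg_M_conj n 4" for m
      using into[OF that] by (elim bexE conjE) (rule bexI)
    show "\<exists>m\<in>sg_M_conj n 4. ?c m = petal S" if "S \<in> petal_sets" for S
      using onto[OF that] by (elim bexE conjE) (rule bexI)
  qed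
  show "?r ` sg_M_conj n 4 = (\<lambda>S. valid_rels G (petal S)) ` petal_sets"
  proof (rule image_eq_of_correspondence)
    show "\<exists>S\<in>petal_sets. ?r m = valid_rels G (petal S)" if "m \<in> sg_M_conj n 4" for m
      using into[OF that] by (elim bexE conjE) (rule bexI)
    show "\<exists>m\<in>sg_M_conj n 4. ?r m = valid_rels G (petal S)" if "S \<in> petal_sets" for S
      using onto[OF that] by (elim bexE conjE) (rule bexI)
  qed
qed

lemma ex_petal_set:
  assumes "S \<subseteq> {1..n}" "card S \<le> 4" shows "\<exists>T\<in>petal_sets. S \<subseteq> T"
  using exists_subset_between[OF assms(2) _ assms(1), of] n by auto

text \<open>The generators are elements of \<open>SG n\<close>, so those common to several petals
  are identified. \<open>K\<close>, with labels as generators, maps by \<open>Q\<close> onto the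
  group presented in this way, and \<open>r\<close> maps that group to \<open>SG n\<close> with
  composite \<open>p\<close>. As \<open>p\<close> is injective and \<open>Q\<close> is onto,
  \<open>r\<close> is injective.\<close>

lemma SP_presentation:
  "has_presentation (G\<lparr>carrier := SP n\<rparr>) (\<Union> (petal ` petal_sets))
     (\<Union>S\<in>petal_sets. valid_rels G (petal S))"
proof -
  define X where "X = \<Union> (petal ` petal_sets)"
  define R where "R = (\<Union>S\<in>petal_sets. valid_rels G (petal S))"
  have XSP: "X \<subseteq> SP n" unfolding X_def using petal_SP by blast
  have Xc: "X \<subseteq> carrier G" using XSP subgroup.subset[OF SP_subgroup] by blast
  have pX: "petal S \<subseteq> X" if "S \<in> petal_sets" for S unfolding X_def using that by blast
  have RX: "R \<subseteq> words X \<times> words X"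
    unfolding R_def valid_rels_def using words_mono[OF pX] by blast
  have valid: "word_eval G id u = word_eval G id v" if "(u, v) \<in> R" for u v
    using that unfolding R_def valid_rels_def by blast
  have labX: "lab n y \<in> X" if y: "y \<in> L" for y
  proof -
    obtain e j k where yy: "y = (e, j, k)" by (cases y)
    have "{j, k} \<subseteq> {1..n}" "card {j, k} \<le> 4" using y yy by (simp_all add: mem_L card_insert_if)
    then obtain T where T: "T \<in> petal_sets" "{j, k} \<subseteq> T" using ex_petal_set[of "{j, k}"] by blast
    then have "y \<in> labels T" using y yy by (simp add: labels_def mem_L)
    then have "lab n y \<in> petal T" by (rule lab_in_petal)
    then show ?thesis by (rule subsetD[OF pX[OF T(1)]])
  qed
  interpret q: presentation X R by unfold_locales (rule RX)
  define f where "f y = q.gen (lab n y)" for y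
  have fc: "\<And>y. y \<in> L \<Longrightarrow> f y \<in> carrier q.K" unfolding f_def by (rule q.gen_closed[OF labX])
  have eval_f: "word_eval q.K f u = word_eval q.K q.gen (map_word (lab n) u)" for u
    by (simp add: word_eval_map_word f_def[abs_def])
  have id_lab: "word_eval G id (map_word (lab n) u) = word_eval G (lab n) u" for u
    by (simp add: word_eval_map_word)
  have rel: "word_eval q.K q.gen u = word_eval q.K q.gen v" if "(u, v) \<in> R" for u v
  proof -
    have uv: "u \<in> words X" "v \<in> words X" using that RX by blast+
    have "pres_cong X R ([] @ u @ []) ([] @ v @ [])" using that by (intro pres_cong.rel) simp_all
    then show ?thesis using q.word_eval_gen_eq_iff[OF uv] by simp
  qed
  have respects: "word_eval q.K f u = word_eval q.K f v" if uv: "(u, v) \<in> petal_rels" for u v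
  proof -
    obtain S where S: "S \<subseteq> {1..n}" "card S \<le> 4" "u \<in> words (labels S)" "v \<in> words (labels S)"
      "word_eval G (lab n) u = word_eval G (lab n) v"
      using uv unfolding petal_rels_def by blast
    obtain T where T: "T \<in> petal_sets" "S \<subseteq> T" using ex_petal_set[OF S(1,2)] by blast
    have "map_word (lab n) w \<in> words (petal T)" if "w \<in> words (labels S)" for w
      using that by (rule map_word_words) (use labels_mono[OF T(2)] lab_in_petal in blast)
    then have "(map_word (lab n) u, map_word (lab n) v) \<in> valid_rels G (petal T)"
      using S(3-5) by (simp add: valid_rels_def id_lab)
    then have "(map_word (lab n) u, map_word (lab n) v) \<in> R" unfolding R_def using T(1) by blast
    then show ?thesis unfolding eval_f by (rule rel)
  qed
  define Q where "Q = presented_map q.K f"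
  interpret Q: group_hom K q.K Q
    unfolding Q_def by (rule k.map_hom[OF q.K.is_group fc respects])
  have Q_gen: "Q (kgen y) = f y" if "y \<in> L" for y
    unfolding Q_def by (rule k.map_gen[OF q.K.is_group fc respects that])
  have Q_word: "Q (word_eval K kgen u) = word_eval q.K f u" if "u \<in> words L" for u
    unfolding Q_def by (rule k.map_word_eval[OF q.K.is_group fc respects that])
  have idX: "\<And>x. x \<in> X \<Longrightarrow> id x \<in> carrier G" using Xc by auto
  define r where "r = presented_map G id"
  interpret r: group_hom q.K G r
    unfolding r_def by (rule q.map_hom[OF G.is_group idX valid])
  have r_gen: "r (q.gen x) = x" if "x \<in> X" for x
    unfolding r_def using q.map_gen[OF G.is_group idX valid that] by simp
  have r_word: "r (word_eval q.K q.gen u) = word_eval G id u" if "u \<in> words X" for u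
    unfolding r_def by (rule q.map_word_eval[OF G.is_group idX valid that])
  have rQ: "r (Q k) = p k" if "k \<in> carrier K" for k
  proof (rule k.hom_eqI[OF G.is_group _ p.homh _ that])
    show "(\<lambda>k. r (Q k)) \<in> hom K G"
      by (rule group_hom.homh[OF group_hom_comp[OF Q.group_hom_axioms r.group_hom_axioms]])
    show "r (Q (kgen y)) = p (kgen y)" if y: "y \<in> L" for y
      by (simp only: Q_gen[OF y] p_kgen[OF y] f_def r_gen[OF labX[OF y]])
  qed
  \<comment> \<open>The equation between \<open>x\<close> and a label word for it is valid in a
    petal and hence one of the relations.\<close>
  have surj: "q.gen x \<in> Q ` carrier K" if x: "x \<in> X" for x
  proof -
    obtain S where S: "S \<in> petal_sets" "x \<in> petal S" using x unfolding X_def by blast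
    then have S1: "S \<subseteq> {1..n}" by blast
    have lc: "\<And>y. y \<in> labels S \<Longrightarrow> lab n y \<in> carrier G" using lab_closed_labels[OF _ S1] .
    have "petal S = word_eval G (lab n) ` words (labels S)"
      unfolding petal_def by (rule G.generate_eq_word_eval[OF lc])
    then have "x \<in> word_eval G (lab n) ` words (labels S)" using S(2) by (simp only:)
    then obtain u where u: "u \<in> words (labels S)" "x = word_eval G (lab n) u" by blast
    have uL: "u \<in> words L" by (rule labels_words_L[OF S1 u(1)])
    have "map_word (lab n) u \<in> words (petal S)" by (rule map_word_words[OF u(1) lab_in_petal])
    moreover have "word_eval G id [(x, True)] = x" using idX[OF x] by simp
    ultimately have "([(x, True)], map_word (lab n) u) \<in> valid_rels G (petal S)"
      using S(2) u(2) by (simp add: valid_rels_def id_lab)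
    then have "([(x, True)], map_word (lab n) u) \<in> R" unfolding R_def using S(1) by blast
    then have "word_eval q.K q.gen [(x, True)] = word_eval q.K f u"
      unfolding eval_f by (rule rel)
    then have "q.gen x = Q (word_eval K kgen u)"
      using q.gen_closed[OF x] Q_word[OF uL] by simp
    moreover have "word_eval K kgen u \<in> carrier K"
      by (rule k.K.word_eval_in_carrier[OF k.gen_closed uL])
    ultimately show ?thesis by (rule image_eqI)
  qed
  have "has_presentation (G\<lparr>carrier := SP n\<rparr>) X R"
  proof (rule has_presentationI[OF G.is_group _ Xc RX valid])
    have "generate G X \<subseteq> SP n" by (rule G.generate_subgroup_incl[OF XSP SP_subgroup])
    moreover have "generate G (lab n ` L) \<subseteq> generate G X"
      using labX by (intro G.mono_generate) blast
    ultimately show "SP n = generate G X" using SP_generate by blast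
    fix u assume u: "u \<in> words X" "word_eval G id u = \<one>\<^bsub>G\<^esub>"
    have "word_eval q.K q.gen u \<in> Q ` carrier K"
      by (rule q.K.word_eval_in_subgroup[OF Q.img_is_subgroup surj u(1)])
    then obtain k where k: "k \<in> carrier K" "word_eval q.K q.gen u = Q k" by blast
    have "p k = p \<one>\<^bsub>K\<^esub>" using rQ[OF k(1)] k(2) r_word[OF u(1)] u(2) by simp
    then have "k = \<one>\<^bsub>K\<^esub>" by (rule inj_onD[OF p_inj _ k(1) k.K.one_closed])
    then have "word_eval q.K q.gen u = word_eval q.K q.gen []" using k(2) by simp
    then show "pres_cong X R u []" using q.word_eval_gen_eq_iff[OF u(1), of "[]"] by simp
  qed
  then show ?thesis unfolding X_def R_def .
qed

lemma camomile_SP: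
  assumes "5 \<le> n"
  shows "camomile G (SP n) (sg_M n n) (SP_sub n 4) (sg_M_conj n 4)"
proof -
  have S: "subgroup (petal {1..4}) G" using n by (intro petal_subgroup) auto
  have "has_presentation (G\<lparr>carrier := SP n\<rparr>) (\<Union>m\<in>sg_M_conj n 4. conj_elt G m ` petal {1..4})
      (\<Union>m\<in>sg_M_conj n 4. (\<lambda>(u, v). (conj_word G m u, conj_word G m v)) ` valid_rels G (petal {1..4}))"
    \<comment> \<open>A union over \<open>sg_M_conj n 4\<close> is the union of an image of that
      set, and \<open>conj_set_petals\<close> rewrites these images.\<close>
    unfolding conj_set_petals by (rule SP_presentation)
  moreover have "sg_M_conj n 4 \<subseteq> sg_M n n" by (auto simp: sg_M_conj_def)
  ultimately show ?thesis
    unfolding camomile_def SP_sub_eq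
    using G.is_group SP_normal sg_M_reps S petal4_proper[OF assms] one_sg_M_conj
      G.has_presentation_valid_rels[OF S] by blast
qed

end

theorem theorem4p6:
  fixes n :: nat
  assumes "n \<ge> 5"
  shows "camomile (SG n) (SP n) (sg_M n n) (SP_sub n 4) (sg_M_conj n 4)"
proof -
  interpret singular_braid n by unfold_locales (use assms in simp)
  show ?thesis using assms by (rule camomile_SP)
qed

end
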